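(* Let $G$ be the Heisenberg group of dimension $2n+1$ with Lie algebra $\mathfrak{g}$, and let $H$ be a non-trivial connected closed subgroup of $G$ with Lie algebra $\mathfrak{h}$. Put $d=\dim G-\dim H$, take a co-exponential basis $\{W_1,\ldots,W_d\}$ to $\mathfrak{h}$ in $\mathfrak{g}$, let $\mathfrak{q}=\operatorname{span}_{\mathbb{R}}\{W_1,\ldots,W_d\}$, and let $Q=\langle\exp\mathfrak{q}\rangle$ be the closed subgroup of $G$ generated by $\exp\mathfrak{q}$. Suppose that the quasi-regular representation $\pi_H$ of $G$ is multiplicity-free. Then one can construct a slice $S$ for the strongly visible $Q$-action on $G^{\mathbb{C}}/H^{\mathbb{C}}$ whose dimension equals the rank of the support of $\pi_H$: $$\dim S=\operatorname{rank}(\operatorname{Supp}(\pi_H)).$$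
   Context: Let $n\ge 1$ and let $G=\exp\mathfrak{g}$ be the connected, simply connected Heisenberg group of dimension $2n+1$. A Heisenberg basis of $\mathfrak{g}$ is a basis $X_1,\dots,X_n,Y_1,\dots,Y_n,Z$ with $[X_i,Y_j]=\delta_{ij}Z$ and all other brackets of basis elements zero. A connected closed subgroup is of the form $H=\exp\mathfrak{h}$ for a subalgebra $\mathfrak{h}$; non-trivial means $H\neq\{e\}$ and $H\neq G$. A co-exponential basis to $\mathfrak{h}$ in $\mathfrak{g}$ is a family $\{W_1,\dots,W_d\}\subset\mathfrak{g}$ such that $H\times\mathbb{R}^d\to G$, $(h,w_1,\dots,w_d)\mapsto h\,e^{w_1W_1}\cdots e^{w_dW_d}$ is a diffeomorphism. Its span $\mathfrak{q}$ is a complementary subspace of $\mathfrak{h}$ in $\mathfrak{g}$. $G^{\mathbb{C}}=\exp\mathfrak{g}^{\mathbb{C}}$ and $H^{\mathbb{C}}=\exp\mathfrak{h}^{\mathbb{C}}$ are the complexifications of $G$ and $H$; subgroups of $G$ act holomorphically on $G^{\mathbb{C}}/H^{\mathbb{C}}$ by left translation. The quasi-regular representation $\pi_H$ is the unitary representation of $G$ on $L^2(G/H)$ (with respect to a $G$-invariant measure) given by $[\pi_H(g)f](xH)=f(g^{-1}xH)$. It is multiplicity-free if the multiplicity function in its direct integral decomposition into irreducible unitary representations is at most $1$ almost everywhere. A holomorphic action of a Lie group $L$ on a connected complex manifold $D$ is strongly visible if there exist a real submanifold $S$ in $D$ and an anti-holomorphic diffeomorphism $\sigma$ on $D$ such that: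 $D':=L\cdot S$ is a non-empty open set in $D$; $\sigma|_S=\operatorname{id}_S$; and $\sigma$ preserves each $L$-orbit in $D'$. Such an $S$ is called a slice. Support and rank. When $\pi_H$ is multiplicity-free, one may take (up to an automorphism of $G$, i.e. by choice of the Heisenberg basis) $\mathfrak{h}$ to be the real span of one of: $\{Z\}$; $\{X_1,\dots,X_p,Y_1,\dots,Y_q,Z\}$ with $1\le p\le q\le n$, $(p,q)\neq(n,n)$; $\{X_1,\dots,X_m,Z\}$ with $1\le m\le n$; $\{X_1,\dots,X_n\}$. Let $X_i^*,Y_j^*,Z^*$ be the dual basis of $\mathfrak{g}^*$ and write $\xi(\boldsymbol\alpha,\boldsymbol\beta,\gamma)=\sum_i\alpha_iX_i^*+\sum_j\beta_jY_j^*+\gamma Z^*$. The dual $\mathfrak{q}^*$ is regarded as the subspace of $\mathfrak{g}^*$ of functionals vanishing on $\mathfrak{h}$. The group $G$ acts on $\mathfrak{g}^*$ by the coadjoint action, and $R=\{\xi(\boldsymbol0,\boldsymbol0,\gamma):\gamma\in\mathbb{R}\setminus\{0\}\}\sqcup\{\xi(\boldsymbol\alpha,\boldsymbol\beta,0):\boldsymbol\alpha,\boldsymbol\beta\in\mathbb{R}^n\}$ is a cross-section of $\mathfrak{g}^*/G$. Put $R(\mathfrak{q}^* )=R\cap(G\cdot\mathfrak{q}^* )$, which coincides with $R\cap\mathfrak{q}^*$. For $\xi\in R$ let $\tau_\xi\in\widehat{G}$ be the irreducible unitary representation attached to $G\cdot\xi$ by the Kirillov orbit method. By the Corwin–Greenleaf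 formula, $\pi_H\simeq\int^{\oplus}_{(G\cdot\mathfrak{q}^* )/G}m_{\pi_H}(\xi)\,\tau_\xi\,d\xi$ with multiplicity function $m_{\pi_H}$. The support is $\operatorname{Supp}(\pi_H)=\{\tau_\xi\in\widehat{G}:\xi\in R(\mathfrak{q}^* ),\ m_{\pi_H}(\xi)\neq0\}$. Its rank $\operatorname{rank}(\operatorname{Supp}(\pi_H))$ is the number of elements of a minimal finite subset of $\mathfrak{q}^*$ that is linearly independent and such that every element of $R(\mathfrak{q}^* )$ is a linear combination of its elements.
   Formalization: For an arbitrary co-exponential basis the Q-action need not be strongly visible (n=2, h=span{X1,X2}, basis Y1+X2, Y2-X1, Z). Proved: some co-exponential basis has a strongly visible Q-action, and every one whose Q-action is strongly visible admits a slice of dimension equal to the rank. *)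

theory Defs
  imports "HOL-Probability.Probability"
begin

section \<open>The Heisenberg group and its complexification\<close>

text \<open>
  A triple \<open>(x, y, z)\<close> stands for \<open>\<Sum> x\<^sub>i X\<^sub>i + \<Sum> y\<^sub>j Y\<^sub>j + z Z\<close>, with \<open>n = CARD('n)\<close>.
  The group is used in exponential coordinates: group and Lie algebra have the same carrier, \<open>exp\<close>
  is the identity, and the product is the Baker-Campbell-Hausdorff product, which is exact because the algebra
  is two-step nilpotent. In particular \<open>exp(t V)\<close> is \<open>t *\<^sub>R V\<close>, the inverse of \<open>g\<close> is \<open>- g\<close>, and
  the subgroup \<open>exp h\<close> of a subalgebra \<open>h\<close> is the set \<open>h\<close> itself.
  Taking \<open>'a = real\<close> gives \<open>G\<close>, taking \<open>'a = complex\<close> gives its complexification.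
\<close>

type_synonym ('a, 'n) heis = "('a ^ 'n) \<times> ('a ^ 'n) \<times> 'a"

definition hbracket :: "('a::real_normed_field, 'n::finite) heis \<Rightarrow> ('a, 'n) heis \<Rightarrow> ('a, 'n) heis" where
  "hbracket = (\<lambda>(x, y, z) (x', y', z'). (0, 0, \<Sum>i\<in>UNIV. x $ i * y' $ i - y $ i * x' $ i))"

definition hmult :: "('a::real_normed_field, 'n::finite) heis \<Rightarrow> ('a, 'n) heis \<Rightarrow> ('a, 'n) heis"
    (infixl "\<star>" 70) where
  "u \<star> v = u + v + (1/2) *\<^sub>R hbracket u v"

definition heis_of_real :: "(real, 'n::finite) heis \<Rightarrow> (complex, 'n) heis" where
  "heis_of_real = (\<lambda>(x, y, z). (\<chi> i. of_real (x $ i), \<chi> i. of_real (y $ i), of_real z))"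

definition cscale :: "complex \<Rightarrow> (complex, 'n::finite) heis \<Rightarrow> (complex, 'n) heis" where
  "cscale c = (\<lambda>(x, y, z). (c *s x, c *s y, c * z))"

definition lie_subalgebra :: "(real, 'n::finite) heis set \<Rightarrow> bool" where
  "lie_subalgebra h \<longleftrightarrow> subspace h \<and> (\<forall>u\<in>h. \<forall>v\<in>h. hbracket u v \<in> h)"

definition complexify :: "(real, 'n::finite) heis set \<Rightarrow> (complex, 'n) heis set" where
  "complexify h = {heis_of_real u + cscale \<i> (heis_of_real v) | u v. u \<in> h \<and> v \<in> h}"

definition closed_subgroup :: "(real, 'n::finite) heis set \<Rightarrow> bool" where
  "closed_subgroup K \<longleftrightarrow> closed K \<and> 0 \<in> K \<and> (\<forall>u\<in>K. - u \<in> K) \<and> (\<forall>u\<in>K. \<forall>v\<in>K. u \<star> v \<in> K)"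

definition closed_subgroup_generated :: "(real, 'n::finite) heis set \<Rightarrow> (real, 'n) heis set" where
  "closed_subgroup_generated A = \<Inter>{K. closed_subgroup K \<and> A \<subseteq> K}"


section \<open>Smooth maps and co-exponential bases\<close>

primrec Ck_on :: "nat \<Rightarrow> ('a::real_normed_vector \<Rightarrow> 'b::real_normed_vector) \<Rightarrow> 'a set \<Rightarrow> bool" where
  "Ck_on 0 f U \<longleftrightarrow> continuous_on U f"
| "Ck_on (Suc k) f U \<longleftrightarrow> (\<forall>x\<in>U. f differentiable (at x)) \<and>
     (\<forall>v. Ck_on k (\<lambda>x. frechet_derivative f (at x) v) U)"

text \<open>Only used for open \<open>U\<close>.\<close>

definition smooth_on :: "('a::real_normed_vector \<Rightarrow> 'b::real_normed_vector) \<Rightarrow> 'a set \<Rightarrow> bool" where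
  "smooth_on f U \<longleftrightarrow> (\<forall>k. Ck_on k f U)"

definition coexp_map ::
  "(real, 'n::finite) heis list \<Rightarrow> (real, 'n) heis \<Rightarrow> real list \<Rightarrow> (real, 'n) heis" where
  "coexp_map W a w = foldl (\<star>) a (map2 (*\<^sub>R) w W)"

text \<open>
  The map \<open>H \<times> \<real>\<^sup>d \<rightarrow> G\<close> is polynomial, hence smooth, so being a diffeomorphism means having a
  smooth two-sided inverse \<open>g \<mapsto> (\<eta> g, \<omega> g)\<close>. A tuple in \<open>\<real>\<^sup>d\<close> is a list of length \<open>d\<close>.
\<close>

definition coexponential_basis ::
  "(real, 'n::finite) heis set \<Rightarrow> (real, 'n) heis list \<Rightarrow> bool" where
  "coexponential_basis h W \<longleftrightarrow>
     (\<exists>\<eta> \<omega>. smooth_on \<eta> UNIV \<and> (\<forall>i<length W. smooth_on (\<lambda>g. \<omega> g ! i) UNIV) \<and>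
        (\<forall>g. \<eta> g \<in> h \<and> length (\<omega> g) = length W \<and> coexp_map W (\<eta> g) (\<omega> g) = g) \<and>
        (\<forall>a\<in>h. \<forall>w. length w = length W \<longrightarrow>
            \<eta> (coexp_map W a w) = a \<and> \<omega> (coexp_map W a w) = w))"


section \<open>Homogeneous spaces\<close>

definition lcoset :: "('a::real_normed_field, 'n::finite) heis set \<Rightarrow> ('a, 'n) heis \<Rightarrow> ('a, 'n) heis set" where
  "lcoset K g = (\<star>) g ` K"

definition lcosets :: "('a::real_normed_field, 'n::finite) heis set \<Rightarrow> ('a, 'n) heis set set" where
  "lcosets K = range (lcoset K)"

definition act :: "('a::real_normed_field, 'n::finite) heis \<Rightarrow> ('a, 'n) heis set \<Rightarrow> ('a, 'n) heis set" where
  "act g c = (\<star>) g ` c"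

text \<open>For a set \<open>V\<close> of cosets, \<open>\<Union>V\<close> is its preimage under the projection, so this is the
  quotient topology.\<close>

definition qopen :: "('a::real_normed_field, 'n::finite) heis set \<Rightarrow> ('a, 'n) heis set set \<Rightarrow> bool" where
  "qopen K V \<longleftrightarrow> V \<subseteq> lcosets K \<and> open (\<Union>V)"

text \<open>
  The manifold structure of \<open>D = G\<^sup>C / H\<^sup>C\<close> is the one for which the projection is a
  holomorphic submersion. It is given by its sheaves of functions: a function on an open subset of \<open>D\<close>
  is smooth (holomorphic) iff its pullback to an open subset of \<open>G\<^sup>C\<close> is.
\<close>

abbreviation cspace :: "(real, 'n::finite) heis set \<Rightarrow> (complex, 'n) heis set set" where
  "cspace h \<equiv> lcosets (complexify h)"

definition smooth_fun ::
  "(real, 'n::finite) heis set \<Rightarrow> (complex, 'n) heis set set \<Rightarrow> ((complex, 'n) heis set \<Rightarrow> real) \<Rightarrow> bool" where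
  "smooth_fun h V f \<longleftrightarrow> qopen (complexify h) V \<and> smooth_on (\<lambda>g. f (lcoset (complexify h) g)) (\<Union>V)"

definition holomorphic_heis :: "((complex, 'n::finite) heis \<Rightarrow> complex) \<Rightarrow> (complex, 'n) heis set \<Rightarrow> bool" where
  "holomorphic_heis f U \<longleftrightarrow>
     (\<forall>g\<in>U. \<exists>A. (f has_derivative A) (at g) \<and> (\<forall>v. A (cscale \<i> v) = \<i> * A v))"

definition holomorphic_fun ::
  "(real, 'n::finite) heis set \<Rightarrow> (complex, 'n) heis set set \<Rightarrow> ((complex, 'n) heis set \<Rightarrow> complex) \<Rightarrow> bool" where
  "holomorphic_fun h V f \<longleftrightarrow>
     qopen (complexify h) V \<and> holomorphic_heis (\<lambda>g. f (lcoset (complexify h) g)) (\<Union>V)"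

definition antiholomorphic_map ::
  "(real, 'n::finite) heis set \<Rightarrow> ((complex, 'n) heis set \<Rightarrow> (complex, 'n) heis set) \<Rightarrow> bool" where
  "antiholomorphic_map h \<sigma> \<longleftrightarrow> \<sigma> ` cspace h \<subseteq> cspace h \<and>
     (\<forall>V f. holomorphic_fun h V f \<longrightarrow>
        holomorphic_fun h {c \<in> cspace h. \<sigma> c \<in> V} (\<lambda>c. cnj (f (\<sigma> c))))"

definition antiholomorphic_diffeo ::
  "(real, 'n::finite) heis set \<Rightarrow> ((complex, 'n) heis set \<Rightarrow> (complex, 'n) heis set) \<Rightarrow> bool" where
  "antiholomorphic_diffeo h \<sigma> \<longleftrightarrow> bij_betw \<sigma> (cspace h) (cspace h) \<and>
     antiholomorphic_map h \<sigma> \<and> antiholomorphic_map h (inv_into (cspace h) \<sigma>)"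

definition rdim :: "(real, 'n::finite) heis set \<Rightarrow> nat" where
  "rdim h = DIM((complex, 'n) heis) - dim (complexify h)"

text \<open>
  Embedded real submanifold of dimension \<open>k\<close> of \<open>G\<^sup>C / H\<^sup>C\<close>: locally the common zero set of
  \<open>rdim h - k\<close> smooth real functions with linearly independent differentials. As the projection is a
  submersion, independence is tested on the pullbacks.
\<close>

definition submanifold ::
  "(real, 'n::finite) heis set \<Rightarrow> (complex, 'n) heis set set \<Rightarrow> nat \<Rightarrow> bool" where
  "submanifold h S k \<longleftrightarrow> S \<subseteq> cspace h \<and> k \<le> rdim h \<and>
     (\<forall>p\<in>S. \<exists>V (f :: nat \<Rightarrow> (complex, 'n) heis set \<Rightarrow> real).
        qopen (complexify h) V \<and> p \<in> V \<and>
        (\<forall>i<rdim h - k. smooth_fun h V (f i)) \<and>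
        (\<forall>g\<in>\<Union>V. \<forall>a :: nat \<Rightarrow> real.
            (\<forall>v. (\<Sum>i<rdim h - k. a i *
                     frechet_derivative (\<lambda>g. f i (lcoset (complexify h) g)) (at g) v) = 0) \<longrightarrow>
            (\<forall>i<rdim h - k. a i = 0)) \<and>
        S \<inter> V = {c \<in> V. \<forall>i<rdim h - k. f i c = 0})"


section \<open>Strongly visible actions\<close>

definition orbit ::
  "(real, 'n::finite) heis set \<Rightarrow> (complex, 'n) heis set \<Rightarrow> (complex, 'n) heis set set" where
  "orbit L c = (\<lambda>l. act (heis_of_real l) c) ` L"

text \<open>\<open>S\<close> is a slice for the action of the subgroup \<open>L\<close> of \<open>G\<close> on \<open>G\<^sup>C / H\<^sup>C\<close>.\<close>

definition slice ::
  "(real, 'n::finite) heis set \<Rightarrow> (real, 'n) heis set \<Rightarrow> (complex, 'n) heis set set \<Rightarrow> bool" where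
  "slice h L S \<longleftrightarrow> (\<exists>k. submanifold h S k) \<and>
     (\<exists>\<sigma>. antiholomorphic_diffeo h \<sigma> \<and>
        (\<Union>s\<in>S. orbit L s) \<noteq> {} \<and> qopen (complexify h) (\<Union>s\<in>S. orbit L s) \<and>
        (\<forall>s\<in>S. \<sigma> s = s) \<and>
        (\<forall>c\<in>(\<Union>s\<in>S. orbit L s). \<sigma> ` orbit L c = orbit L c))"

definition strongly_visible :: "(real, 'n::finite) heis set \<Rightarrow> (real, 'n) heis set \<Rightarrow> bool" where
  "strongly_visible h L \<longleftrightarrow> (\<exists>S. slice h L S)"


section \<open>The quasi-regular representation and multiplicity-freeness\<close>

text \<open>A nonzero \<open>G\<close>-invariant Radon measure on \<open>G / H\<close> (Borel sets of the quotient topology; finiteness on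
  compact sets suffices for Radon here; it is unique up to a factor).\<close>

definition invariant_measure ::
  "(real, 'n::finite) heis set \<Rightarrow> (real, 'n) heis set measure \<Rightarrow> bool" where
  "invariant_measure h M \<longleftrightarrow>
     space M = lcosets h \<and> sets M = sigma_sets (lcosets h) {V. qopen h V} \<and>
     emeasure M (space M) \<noteq> 0 \<and>
     (\<forall>C. compact C \<longrightarrow> emeasure M (lcoset h ` C) < \<infinity>) \<and>
     (\<forall>g. \<forall>A\<in>sets M. emeasure M (act g ` A) = emeasure M A)"

definition sq_norm :: "'a measure \<Rightarrow> ('a \<Rightarrow> complex) \<Rightarrow> ennreal" where
  "sq_norm M f = (\<integral>\<^sup>+ x. ennreal ((cmod (f x))\<^sup>2) \<partial>M)"

text \<open>Square integrable functions; almost everywhere equality is not quotiented out.\<close>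

definition L2 :: "'a measure \<Rightarrow> ('a \<Rightarrow> complex) set" where
  "L2 M = {f \<in> borel_measurable M. sq_norm M f < \<infinity>}"

definition quasi_regular ::
  "(real, 'n::finite) heis \<Rightarrow> ((real, 'n) heis set \<Rightarrow> complex) \<Rightarrow> (real, 'n) heis set \<Rightarrow> complex" where
  "quasi_regular g f = (\<lambda>c. f (act (- g) c))"

text \<open>
  The unitary dual, parametrized by Kirillov's orbit method. A triple \<open>(\<alpha>, \<beta>, \<gamma>)\<close> stands for the functional
  \<open>\<Sum> \<alpha>\<^sub>i X\<^sub>i\<^sup>* + \<Sum> \<beta>\<^sub>j Y\<^sub>j\<^sup>* + \<gamma> Z\<^sup>*\<close> in the dual of the standard basis, and
  \<open>cross_section\<close> meets each coadjoint orbit exactly once. For \<open>\<gamma> = 0\<close> the representation \<open>tau \<xi>\<close> is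
  the character \<open>e\<^sup>i\<^sup>\<xi>\<close>. For \<open>\<gamma> \<noteq> 0\<close> it is the representation induced from the character
  \<open>e\<^sup>i\<^sup>\<xi>\<close> of the exponential of the polarization \<open>span {Y\<^sub>j, Z}\<close>, realized on
  \<open>L\<^sup>2(\<real>\<^sup>n)\<close> by restricting to \<open>exp (\<Sum> t\<^sub>i X\<^sub>i)\<close> (Schroedinger model).
  The one-dimensional space of a character is \<open>L\<^sup>2\<close> of a point mass, so that in both cases
  \<open>tau \<xi>\<close> acts on \<open>L2 (tau_base \<xi>)\<close>.
\<close>

definition cross_section :: "(real, 'n::finite) heis set" where
  "cross_section = {(0, 0, \<gamma>) | \<gamma>. \<gamma> \<noteq> 0} \<union> {(\<alpha>, \<beta>, 0) | \<alpha> \<beta>. True}"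

definition tau_base :: "(real, 'n::finite) heis \<Rightarrow> (real ^ 'n) measure" where
  "tau_base = (\<lambda>(\<alpha>, \<beta>, \<gamma>). if \<gamma> = 0 then return borel 0 else lborel)"

definition tau ::
  "(real, 'n::finite) heis \<Rightarrow> (real, 'n) heis \<Rightarrow> (real ^ 'n \<Rightarrow> complex) \<Rightarrow> real ^ 'n \<Rightarrow> complex" where
  "tau = (\<lambda>(\<alpha>, \<beta>, \<gamma>) (x, y, z) \<phi> t.
     if \<gamma> = 0 then exp (\<i> * of_real (\<alpha> \<bullet> x + \<beta> \<bullet> y)) * \<phi> t
     else exp (\<i> * of_real (\<gamma> * (z - y \<bullet> t + (x \<bullet> y) / 2))) * \<phi> (t - x))"

text \<open>
  The Hilbert space of the direct integral of \<open>m \<xi>\<close> copies of \<open>tau \<xi>\<close> with respect to \<open>\<mu>\<close>: jointly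
  measurable sections \<open>F \<xi> k \<in> L2 (tau_base \<xi>)\<close>, \<open>k < m \<xi>\<close>, of finite norm. Components with
  \<open>k \<ge> m \<xi>\<close> do not count, and sections at distance zero are identified by \<open>di_eq\<close>.
\<close>

type_synonym 'n hsection = "(real, 'n) heis \<Rightarrow> nat \<Rightarrow> real ^ 'n \<Rightarrow> complex"

definition di_sq_norm ::
  "(real, 'n::finite) heis measure \<Rightarrow> ((real, 'n) heis \<Rightarrow> enat) \<Rightarrow> 'n hsection \<Rightarrow> ennreal" where
  "di_sq_norm \<mu> m F =
     (\<integral>\<^sup>+ \<xi>. (\<Sum>k. if enat k < m \<xi> then sq_norm (tau_base \<xi>) (F \<xi> k) else 0) \<partial>\<mu>)"

definition direct_integral ::
  "(real, 'n::finite) heis measure \<Rightarrow> ((real, 'n) heis \<Rightarrow> enat) \<Rightarrow> 'n hsection set" where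
  "direct_integral \<mu> m =
     {F. (\<lambda>(\<xi>, k, t). F \<xi> k t) \<in> borel_measurable (borel \<Otimes>\<^sub>M count_space UNIV \<Otimes>\<^sub>M borel) \<and>
         di_sq_norm \<mu> m F < \<infinity>}"

definition di_eq ::
  "(real, 'n::finite) heis measure \<Rightarrow> ((real, 'n) heis \<Rightarrow> enat) \<Rightarrow> 'n hsection \<Rightarrow> 'n hsection \<Rightarrow> bool" where
  "di_eq \<mu> m F F' \<longleftrightarrow> di_sq_norm \<mu> m (\<lambda>\<xi> k t. F \<xi> k t - F' \<xi> k t) = 0"

text \<open>A unitary equivalence \<open>U\<close> of the quasi-regular representation with the direct integral of
  \<open>m \<xi>\<close> copies of \<open>tau \<xi>\<close> over \<open>cross_section\<close>.\<close>

definition direct_integral_decomposition ::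
  "(real, 'n::finite) heis set measure \<Rightarrow> (real, 'n) heis measure \<Rightarrow> ((real, 'n) heis \<Rightarrow> enat) \<Rightarrow> bool" where
  "direct_integral_decomposition M \<mu> m \<longleftrightarrow>
     sets \<mu> = sets borel \<and> sigma_finite_measure \<mu> \<and> (AE \<xi> in \<mu>. \<xi> \<in> cross_section) \<and>
     m \<in> measurable \<mu> (count_space UNIV) \<and>
     (\<exists>U. (\<forall>f\<in>L2 M. U f \<in> direct_integral \<mu> m \<and> di_sq_norm \<mu> m (U f) = sq_norm M f) \<and>
          (\<forall>f\<in>L2 M. \<forall>f'\<in>L2 M. \<forall>a. di_eq \<mu> m (U (\<lambda>c. a * f c + f' c))
                                              (\<lambda>\<xi> k t. a * U f \<xi> k t + U f' \<xi> k t)) \<and>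
          (\<forall>F\<in>direct_integral \<mu> m. \<exists>f\<in>L2 M. di_eq \<mu> m (U f) F) \<and>
          (\<forall>g. \<forall>f\<in>L2 M. di_eq \<mu> m (U (quasi_regular g f)) (\<lambda>\<xi> k. tau \<xi> g (U f \<xi> k))))"

text \<open>The decomposition is unique (up to the class of \<open>\<mu>\<close> and null sets), so asking for one decomposition
  with multiplicities at most one is the same as asking it of all.\<close>

definition multiplicity_free :: "(real, 'n::finite) heis set measure \<Rightarrow> bool" where
  "multiplicity_free M \<longleftrightarrow>
     (\<exists>\<mu> m. direct_integral_decomposition M \<mu> m \<and> (AE \<xi> in \<mu>. m \<xi> \<le> 1))"


section \<open>The rank of the support\<close>

text \<open>Vectors \<open>X 1, \<dots>, X n, Y 1, \<dots>, Y n, Z\<close>. They are \<open>2 n + 1\<close> spanning vectors, hence a basis.\<close>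

definition heisenberg_basis ::
  "(nat \<Rightarrow> (real, 'n::finite) heis) \<Rightarrow> (nat \<Rightarrow> (real, 'n) heis) \<Rightarrow> (real, 'n) heis \<Rightarrow> bool" where
  "heisenberg_basis X Y Z \<longleftrightarrow>
     span (X ` {1..CARD('n)} \<union> Y ` {1..CARD('n)} \<union> {Z}) = UNIV \<and>
     (\<forall>i\<in>{1..CARD('n)}. \<forall>j\<in>{1..CARD('n)}.
        hbracket (X i) (Y j) = (if i = j then Z else 0) \<and>
        hbracket (X i) (X j) = 0 \<and> hbracket (Y i) (Y j) = 0) \<and>
     (\<forall>i\<in>{1..CARD('n)}. hbracket (X i) Z = 0 \<and> hbracket (Y i) Z = 0)"

definition normal_form ::
  "(nat \<Rightarrow> (real, 'n::finite) heis) \<Rightarrow> (nat \<Rightarrow> (real, 'n) heis) \<Rightarrow> (real, 'n) heis \<Rightarrow>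
   (real, 'n) heis set \<Rightarrow> bool" where
  "normal_form X Y Z h \<longleftrightarrow>
     h = span {Z} \<or>
     (\<exists>p q. 1 \<le> p \<and> p \<le> q \<and> q \<le> CARD('n) \<and> (p, q) \<noteq> (CARD('n), CARD('n)) \<and>
        h = span (X ` {1..p} \<union> Y ` {1..q} \<union> {Z})) \<or>
     (\<exists>m. 1 \<le> m \<and> m \<le> CARD('n) \<and> h = span (X ` {1..m} \<union> {Z})) \<or>
     h = span (X ` {1..CARD('n)})"

text \<open>The dual space of the Lie algebra is \<open>(real, 'n) heis \<Rightarrow>\<^sub>L real\<close>.\<close>

definition annihilator :: "(real, 'n::finite) heis set \<Rightarrow> ((real, 'n) heis \<Rightarrow>\<^sub>L real) set" where
  "annihilator h = {\<xi>. \<forall>v\<in>h. blinfun_apply \<xi> v = 0}"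

text \<open>\<open>Ad(exp u) v = v + [u, v]\<close> and \<open>(g \<cdot> \<xi>)(v) = \<xi>(Ad(g\<^sup>-\<^sup>1) v)\<close>.\<close>

definition coadjoint_saturation ::
  "((real, 'n::finite) heis \<Rightarrow>\<^sub>L real) set \<Rightarrow> ((real, 'n) heis \<Rightarrow>\<^sub>L real) set" where
  "coadjoint_saturation A =
     {\<eta>. \<exists>g. \<exists>\<xi>\<in>A. \<forall>v. blinfun_apply \<eta> v = blinfun_apply \<xi> (v + hbracket (- g) v)}"

text \<open>The cross-section relative to a Heisenberg basis; \<open>\<xi> (X i)\<close>, \<open>\<xi> (Y j)\<close>, \<open>\<xi> Z\<close> are the coordinates
  \<open>\<alpha>\<^sub>i, \<beta>\<^sub>j, \<gamma>\<close> of \<open>\<xi>\<close> in the dual basis.\<close>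

definition dual_cross_section ::
  "(nat \<Rightarrow> (real, 'n::finite) heis) \<Rightarrow> (nat \<Rightarrow> (real, 'n) heis) \<Rightarrow> (real, 'n) heis \<Rightarrow>
   ((real, 'n) heis \<Rightarrow>\<^sub>L real) set" where
  "dual_cross_section X Y Z =
     {\<xi>. (\<forall>i\<in>{1..CARD('n)}. blinfun_apply \<xi> (X i) = 0 \<and> blinfun_apply \<xi> (Y i) = 0) \<and>
          blinfun_apply \<xi> Z \<noteq> 0} \<union>
     {\<xi>. blinfun_apply \<xi> Z = 0}"

definition support_parameters ::
  "(nat \<Rightarrow> (real, 'n::finite) heis) \<Rightarrow> (nat \<Rightarrow> (real, 'n) heis) \<Rightarrow> (real, 'n) heis \<Rightarrow>
   (real, 'n) heis set \<Rightarrow> ((real, 'n) heis \<Rightarrow>\<^sub>L real) set" where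
  "support_parameters X Y Z h =
     dual_cross_section X Y Z \<inter> coadjoint_saturation (annihilator h)"

definition rank_wrt ::
  "(nat \<Rightarrow> (real, 'n::finite) heis) \<Rightarrow> (nat \<Rightarrow> (real, 'n) heis) \<Rightarrow> (real, 'n) heis \<Rightarrow>
   (real, 'n) heis set \<Rightarrow> nat" where
  "rank_wrt X Y Z h =
     (LEAST r. \<exists>B. B \<subseteq> annihilator h \<and> finite B \<and> independent B \<and> card B = r \<and>
        support_parameters X Y Z h \<subseteq> span B)"

text \<open>The rank is computed in a Heisenberg basis in which \<open>h\<close> has normal form; the value does not depend on
  which one.\<close>

definition support_rank :: "(real, 'n::finite) heis set \<Rightarrow> nat" where
  "support_rank h =
     (THE r. \<exists>X Y Z. heisenberg_basis X Y Z \<and> normal_form X Y Z h \<and> r = rank_wrt X Y Z h)"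

end

theory Submission
  imports Defs
begin

text \<open>
  Let \<open>d = dim G - dim H\<close>. Both sides of the dimension formula turn out to be \<open>d\<close>.

  \<^emph>\<open>Rank.\<close> For \<open>h\<close> in normal form, the support parameters lie in the annihilator of \<open>h\<close> and span it
  (\<open>span_support_parameters\<close>), so the rank is the dimension \<open>d\<close> of the annihilator (\<open>support_rank_eq\<close>).

  \<^emph>\<open>Multiplicity.\<close> If \<open>h\<close> misses the center, it is isotropic for the symplectic form. If it is then not Lagrangian,
  two elements \<open>v\<close> and \<open>w\<close> with a nontrivial bracket centralize it (\<open>isotropic_normal_form\<close>). Right translations by
  \<open>v\<close> and \<open>w\<close> are unitary operators on \<open>L\<^sup>2(G/H)\<close> that commute with the representation, and their commutator is a
  nontrivial central translation. But unitary operators that commute with a multiplicity-free representation of this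
  group commute with each other up to what the center sees (\<open>multiplicity_free_commute\<close>): on the infinite-dimensional
  part, a commutative subgroup already has simple spectrum, so they are multiplication operators. Hence \<open>h\<close> contains
  the center or is Lagrangian.

  \<^emph>\<open>Slices.\<close> Let \<open>c\<close> be a complement of \<open>h\<close> such that \<open>h\<close> or \<open>c\<close> contains the center. A polynomial map \<open>K\<close>
  identifies \<open>G\<^sup>C / H\<^sup>C\<close> with the complexification of \<open>c\<close> (locale \<open>splitting\<close>). If \<open>c\<close> is commutative modulo
  \<open>h\<close>, its elements act by real translations. The anti-holomorphic map \<open>u + i v \<mapsto> - u + i v\<close> then fixes the
  imaginary points, which form a submanifold of dimension \<open>d\<close>, and it preserves every orbit that is described by
  imaginary parts alone (\<open>slice_of_orbits\<close>).

  A co-exponential basis spans a complement \<open>q\<close> of \<open>h\<close> (\<open>coexponential_basis_complement\<close>). If \<open>h\<close> contains the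
  center, take \<open>c = q\<close>. Let \<open>h\<close> be Lagrangian. If \<open>q\<close> is commutative and contains the center, then \<open>Q = q\<close> and
  again \<open>c = q\<close>. If \<open>q\<close> does not contain the center, then \<open>Q\<close> contains \<open>q\<close>, the center and a nonzero element of
  \<open>h\<close>; with respect to a commutative complement \<open>c\<close>, generic orbits fix the imaginary part exactly up to the center
  (\<open>slice_shear\<close>). In the remaining case, \<open>q\<close> contains the center and is not commutative, and the action is not
  strongly visible: the orbit condition would make a skew part of a bilinear form the derivative of a holomorphic
  function (\<open>commutative_of_slice\<close>).
\<close>

section \<open>The symplectic form of the Heisenberg algebra\<close>

no_notation convolution (infix "\<star>" 50)

text \<open>The symplectic form: the bracket is its value in the central direction.\<close>

definition symp :: "('a::real_normed_field, 'n::finite) heis \<Rightarrow> ('a, 'n) heis \<Rightarrow> 'a" where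
  "symp u v = (\<Sum>i\<in>UNIV. fst u $ i * fst (snd v) $ i - fst (snd u) $ i * fst v $ i)"

definition central :: "'a \<Rightarrow> ('a::real_normed_field, 'n::finite) heis" where
  "central z = (0, 0, z)"

definition ht :: "('a::real_normed_field, 'n::finite) heis \<Rightarrow> 'a" where
  "ht u = snd (snd u)"

lemma hbracket_symp: "hbracket u v = central (symp u v)"
  by (simp add: hbracket_def symp_def central_def split: prod.splits)

lemma symp_add_left: "symp (u + u') v = symp u v + symp u' v"
  by (simp add: symp_def algebra_simps sum.distrib sum_subtractf)

lemma symp_skew: "symp u v = - symp v u"
  unfolding symp_def sum_negf[symmetric] by (intro sum.cong) (auto simp: mult.commute)

lemma symp_self [simp]: "symp u u = 0"
  by (simp add: symp_def mult.commute)

lemma symp_add_right: "symp v (u + u') = symp v u + symp v u'"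
  by (simp add: symp_def algebra_simps sum.distrib sum_subtractf)

lemma symp_scaleR_left: "symp (r *\<^sub>R u) v = r *\<^sub>R symp u v"
  by (simp add: symp_def scaleR_sum_right algebra_simps)

lemma symp_scaleR_right: "symp u (r *\<^sub>R v) = r *\<^sub>R symp u v"
  by (simp add: symp_def scaleR_sum_right algebra_simps)

lemma symp_zero [simp]: "symp 0 v = 0" "symp v 0 = 0"
  by (simp_all add: symp_def)

lemma symp_minus: "symp (- u) v = - symp u v" "symp v (- u) = - symp v u"
  using symp_scaleR_left[of "-1" u v] symp_scaleR_right[of v "-1" u] by simp_all

lemma symp_diff: "symp (u - u') v = symp u v - symp u' v" "symp v (u - u') = symp v u - symp v u'"
  using symp_add_left[of u "- u'" v] symp_add_right[of v u "- u'"] by (simp_all add: symp_minus)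

lemma symp_central [simp]: "symp (central z) v = 0" "symp v (central z) = 0"
  by (simp_all add: symp_def central_def)

lemmas symp_simps = symp_add_left symp_add_right symp_scaleR_left symp_scaleR_right symp_minus symp_diff

lemma central_simps: "central (a + b) = central a + central b" "central (- a) = - central a"
    "central (a - b) = central a - central b" "central 0 = 0" "r *\<^sub>R central a = central (r *\<^sub>R a)"
  by (simp_all add: central_def zero_prod_def)

lemma ht_central [simp]: "ht (central z) = z"
  by (simp add: ht_def central_def)

lemma ht_simps: "ht (u + v) = ht u + ht v" "ht (u - v) = ht u - ht v" "ht (- u) = - ht u"
    "ht (r *\<^sub>R u) = r *\<^sub>R ht u" "ht 0 = 0"
  by (simp_all add: ht_def)

lemma hmult_symp: "u \<star> v = u + v + central ((1/2) *\<^sub>R symp u v)"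
  by (simp add: hmult_def hbracket_symp central_simps)

lemma hmult_assoc: "(u \<star> v) \<star> w = u \<star> (v \<star> w)"
  by (simp add: hmult_symp symp_simps central_simps scaleR_add_right)

lemma hmult_zero [simp]: "u \<star> 0 = u" "0 \<star> u = u"
  by (simp_all add: hmult_symp central_simps)

lemma hmult_minus [simp]: "u \<star> (- u) = 0" "(- u) \<star> u = 0"
  by (simp_all add: hmult_symp symp_minus central_simps)

lemma hmult_minus_cancel [simp]: "- u \<star> (u \<star> v) = v" "u \<star> (- u \<star> v) = v"
  by (simp_all flip: hmult_assoc)

lemma minus_hmult: "- (u \<star> v) = (- v) \<star> (- u)"
  using symp_skew[of u v] by (simp add: hmult_symp symp_minus central_simps)

lemma hmult_central: "u \<star> central z = u + central z" "central z \<star> u = u + central z"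
  by (simp_all add: hmult_symp central_simps)

lemma hmult_swap: "u \<star> v = (v \<star> u) + central (symp u v)"
proof -
  have "(1/2) *\<^sub>R symp u v = (1/2) *\<^sub>R symp v u + symp u v"
    using symp_skew[of u v] by (simp add: scaleR_conv_of_real field_simps)
  thus ?thesis
    by (simp add: hmult_symp central_simps(1))
qed

lemma bounded_bilinear_hbracket:
  "bounded_bilinear (hbracket :: ('a::real_normed_field, 'n::finite) heis \<Rightarrow> _)"
proof
  fix a a' b b' :: "('a,'n) heis" and r :: real
  show "hbracket (a + a') b = hbracket a b + hbracket a' b"
    by (simp add: hbracket_symp symp_simps central_simps)
  show "hbracket a (b + b') = hbracket a b + hbracket a b'"
    by (simp add: hbracket_symp symp_simps central_simps)
  show "hbracket (r *\<^sub>R a) b = r *\<^sub>R hbracket a b"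
    by (simp add: hbracket_symp symp_simps central_simps)
  show "hbracket a (r *\<^sub>R b) = r *\<^sub>R hbracket a b"
    by (simp add: hbracket_symp symp_simps central_simps)
  show "\<exists>K. \<forall>a b :: ('a,'n) heis. norm (hbracket a b) \<le> norm a * norm b * K"
  proof (intro exI allI)
    fix a b :: "('a,'n) heis"
    have c: "norm (fst u $ i) \<le> norm u" "norm (fst (snd u) $ i) \<le> norm u" for u :: "('a,'n) heis" and i
    proof -
      have "norm (fst u) \<le> norm u" "norm (snd u) \<le> norm u" "norm (fst (snd u)) \<le> norm (snd u)"
        using norm_fst_le[of "fst u" "snd u"] norm_snd_le[of "snd u" "fst u"]
          norm_fst_le[of "fst (snd u)" "snd (snd u)"] by simp_all
      thus "norm (fst u $ i) \<le> norm u" "norm (fst (snd u) $ i) \<le> norm u"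
        using Finite_Cartesian_Product.norm_nth_le[of "fst u" i]
          Finite_Cartesian_Product.norm_nth_le[of "fst (snd u)" i] by linarith+
    qed
    have "norm (hbracket a b) = norm (symp a b)"
      by (simp add: hbracket_symp central_def norm_Pair)
    also have "\<dots> \<le> (\<Sum>i\<in>(UNIV::'n set). norm a * norm b + norm a * norm b)"
      unfolding symp_def
    proof (rule sum_norm_le)
      fix i :: 'n
      have "norm (fst a $ i * fst (snd b) $ i - fst (snd a) $ i * fst b $ i)
          \<le> norm (fst a $ i) * norm (fst (snd b) $ i) + norm (fst (snd a) $ i) * norm (fst b $ i)"
        using norm_triangle_ineq4[of "fst a $ i * fst (snd b) $ i" "fst (snd a) $ i * fst b $ i"]
        by (simp only: norm_mult)
      also have "\<dots> \<le> norm a * norm b + norm a * norm b"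
        by (intro add_mono mult_mono c) auto
      finally show "norm (fst a $ i * fst (snd b) $ i - fst (snd a) $ i * fst b $ i)
          \<le> norm a * norm b + norm a * norm b" .
    qed
    also have "\<dots> = norm a * norm b * (2 * CARD('n))" by simp
    finally show "norm (hbracket a b) \<le> norm a * norm b * (2 * CARD('n))" .
  qed
qed

section \<open>Adapted symplectic bases\<close>

definition symplectic_family ::
  "nat \<Rightarrow> (nat \<Rightarrow> (real, 'n::finite) heis) \<Rightarrow> (nat \<Rightarrow> (real, 'n) heis) \<Rightarrow> bool" where
  "symplectic_family m X Y \<longleftrightarrow> (\<forall>i\<in>{1..m}. \<forall>j\<in>{1..m}.
     symp (X i) (Y j) = (if i = j then 1 else 0) \<and> symp (X i) (X j) = 0 \<and> symp (Y i) (Y j) = 0)"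

lemma subspace_symp_perp: "subspace {e. symp (x::(real,'n::finite) heis) e = 0}"
  by (auto simp: subspace_def symp_simps)

lemma image_shift: "(\<lambda>i. if i = 1 then x else f (i - 1)) ` {1..Suc m} = insert x (f ` {1..m::nat})"
proof -
  have *: "{1..Suc m} = insert 1 (Suc ` {1..m})"
    by (auto simp: image_Suc_atLeastAtMost)
  have "(\<lambda>i. if i = 1 then x else f (i - 1)) ` Suc ` {1..m} = f ` {1..m}"
    unfolding image_image by (rule image_cong) auto
  thus ?thesis unfolding * image_insert by simp
qed

lemma span_Un_span: "span (A \<union> span B) = span (A \<union> B)"
  by (simp only: span_Un span_span)

text \<open>Split off one hyperbolic plane at a time, taken inside \<open>W\<close> as long as \<open>W\<close> is not isotropic
  and meeting \<open>W\<close> as much as possible afterwards. The remaining vectors are the symplectic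
  orthogonal of that plane, so the dimension drops by two.\<close>

lemma adapted_symplectic_family:
  fixes E W :: "(real, 'n::finite) heis set"
  assumes "subspace E" "subspace W" "W \<subseteq> E"
    and "\<And>u. u \<in> E \<Longrightarrow> (\<And>v. v \<in> E \<Longrightarrow> symp u v = 0) \<Longrightarrow> u = 0"
  shows "\<exists>m p q X Y. p \<le> q \<and> q \<le> m \<and> symplectic_family m X Y \<and> dim E = 2 * m \<and>
    E = span (X ` {1..m} \<union> Y ` {1..m}) \<and> W = span (X ` {1..p} \<union> Y ` {1..q})"
  using assms
proof (induction "dim E" arbitrary: E W rule: less_induct)
  case (less E W)
  show ?case
  proof (cases "E = {0}")
    case True
    hence "W = {0}" using less.prems subspace_0 by blast
    show ?thesis
      by (rule exI[of _ 0], rule exI[of _ 0], rule exI[of _ 0]) (use True \<open>W = {0}\<close> in \<open>auto simp: symplectic_family_def\<close>)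
  next
    case False
    have nd: "\<exists>x\<in>E. symp x y = 1" if y: "y \<in> E" "y \<noteq> 0" for y
    proof -
      obtain v where v: "v \<in> E" "symp y v \<noteq> 0" using less.prems(4)[OF y(1)] y(2) by blast
      have "symp ((- 1 / symp y v) *\<^sub>R v) y = 1"
        using v symp_skew[of v y] by (simp add: symp_simps)
      thus ?thesis using v less.prems(1) subspace_scale by metis
    qed
    have "\<exists>x y. x \<in> E \<and> y \<in> E \<and> symp x y = 1 \<and>
      ((x \<in> W \<and> y \<in> W) \<or> ((\<forall>u\<in>W. \<forall>v\<in>W. symp u v = 0) \<and> (y \<in> W \<or> W = {0})))"
    proof (cases "\<forall>u\<in>W. \<forall>v\<in>W. symp u v = 0")
      case True
      show ?thesis
      proof (cases "W = {0}")
        case True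
        obtain y where y: "y \<in> E" "y \<noteq> 0" using False less.prems(1) subspace_0 by blast
        then obtain x where "x \<in> E" "symp x y = 1" using nd by blast
        thus ?thesis using y True by (intro exI[of _ x] exI[of _ y]) simp
      next
        case False
        obtain y where y: "y \<in> W" "y \<noteq> 0" using False less.prems(2) subspace_0 by blast
        then obtain x where "x \<in> E" "symp x y = 1" using nd \<open>W \<subseteq> E\<close> by blast
        thus ?thesis using y True \<open>W \<subseteq> E\<close> by (intro exI[of _ x] exI[of _ y]) blast
      qed
    next
      case f: False
      then obtain u v where uv: "u \<in> W" "v \<in> W" "symp u v \<noteq> 0" by blast
      have "symp ((1 / symp u v) *\<^sub>R u) v = 1" using uv by (simp add: symp_simps)
      moreover have "(1 / symp u v) *\<^sub>R u \<in> W" using uv less.prems(2) subspace_scale by blast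
      ultimately show ?thesis using uv \<open>W \<subseteq> E\<close> by blast
    qed
    then obtain x y where xy: "x \<in> E" "y \<in> E" "symp x y = 1"
      and W: "(x \<in> W \<and> y \<in> W) \<or> ((\<forall>u\<in>W. \<forall>v\<in>W. symp u v = 0) \<and> (y \<in> W \<or> W = {0}))" by blast
    have yx: "symp y x = -1" using xy symp_skew[of y x] by simp
    \<comment> \<open>The symplectic orthogonal of the plane and the projection onto it.\<close>
    define E' where "E' = {e\<in>E. symp x e = 0 \<and> symp y e = 0}"
    define pr where "pr e = e - symp e y *\<^sub>R x - symp x e *\<^sub>R y" for e
    have sub': "subspace E'"
      using less.prems(1) unfolding E'_def by (auto simp: subspace_def symp_simps)
    have pr: "pr e \<in> E'" if "e \<in> E" for e
      using that xy yx less.prems(1) symp_skew[of e y] unfolding E'_def pr_def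
      by (auto simp: symp_simps intro!: subspace_diff subspace_add subspace_scale)
    have dec: "e = pr e + symp e y *\<^sub>R x + symp x e *\<^sub>R y" for e by (simp add: pr_def)
    have xs: "x \<notin> span E'"
      using yx sub' by (auto simp: span_eq_iff[THEN iffD2] E'_def)
    have ys: "y \<notin> span (insert x E')"
    proof
      assume "y \<in> span (insert x E')"
      moreover have "span (insert x E') \<subseteq> {e. symp x e = 0}"
        by (rule span_minimal) (auto simp: E'_def subspace_symp_perp)
      ultimately show False using xy by auto
    qed
    have spanE: "E = span (insert y (insert x E'))"
    proof
      show "E \<subseteq> span (insert y (insert x E'))"
      proof
        fix e assume "e \<in> E"
        show "e \<in> span (insert y (insert x E'))"
          using pr[OF \<open>e \<in> E\<close>]
          by (subst dec) (intro span_add span_scale span_base, auto)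
      qed
      show "span (insert y (insert x E')) \<subseteq> E"
        by (rule span_minimal) (use xy less.prems(1) in \<open>auto simp: E'_def\<close>)
    qed
    have dimE: "dim E = dim E' + 2"
      by (subst spanE) (use xs ys in \<open>simp add: dim_insert\<close>)
    have nd': "u = 0" if "u \<in> E'" "\<And>v. v \<in> E' \<Longrightarrow> symp u v = 0" for u
    proof (rule less.prems(4))
      show "u \<in> E" using that by (simp add: E'_def)
      fix v assume v: "v \<in> E"
      have "symp u x = 0" "symp u y = 0" using that(1) symp_skew[of u x] symp_skew[of u y] by (auto simp: E'_def)
      thus "symp u v = 0" using that(2)[OF pr[OF v]]
        by (subst dec) (simp add: symp_simps)
    qed
    define W' where "W' = W \<inter> E'"
    have "subspace W'" unfolding W'_def using less.prems(2) sub' by (rule subspace_inter)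
    have "dim E' < dim E" using dimE by simp
    moreover have "W' \<subseteq> E'" by (simp add: W'_def)
    ultimately obtain m p q X Y where
      IH: "p \<le> q" "q \<le> m" "symplectic_family m X Y" "dim E' = 2 * m"
      "E' = span (X ` {1..m} \<union> Y ` {1..m})" "W' = span (X ` {1..p} \<union> Y ` {1..q})"
      using less.hyps[OF _ sub' \<open>subspace W'\<close> _ nd'] by metis
    define X1 where "X1 = (\<lambda>i. if i = 1 then x else X (i - 1))"
    define Y1 where "Y1 = (\<lambda>i. if i = 1 then y else Y (i - 1))"
    have mem: "X i \<in> E'" "Y i \<in> E'" if "i \<in> {1..m}" for i
      using that by (auto simp: IH(5) intro: span_base)
    have fam: "symplectic_family (Suc m) X1 Y1"
      unfolding symplectic_family_def
    proof (intro ballI)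
      fix i j assume ij: "i \<in> {1..Suc m}" "j \<in> {1..Suc m}"
      have *: "symp x (X i) = 0 \<and> symp x (Y i) = 0 \<and> symp y (X i) = 0 \<and> symp y (Y i) = 0 \<and>
           symp (X i) x = 0 \<and> symp (Y i) x = 0 \<and> symp (X i) y = 0 \<and> symp (Y i) y = 0" if "i \<in> {1..m}" for i
        using mem[OF that] symp_skew[of "X i" x] symp_skew[of "X i" y] symp_skew[of "Y i" x] symp_skew[of "Y i" y]
        by (simp add: E'_def)
      have i': "i = 1 \<or> i - 1 \<in> {1..m}" and j': "j = 1 \<or> j - 1 \<in> {1..m}" using ij by auto
      show "symp (X1 i) (Y1 j) = (if i = j then 1 else 0) \<and> symp (X1 i) (X1 j) = 0 \<and> symp (Y1 i) (Y1 j) = 0"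
      proof (cases "i = 1")
        case True
        show ?thesis
        proof (cases "j = 1")
          case True
          thus ?thesis using \<open>i = 1\<close> xy(3) by (simp add: X1_def Y1_def)
        next
          case False
          thus ?thesis using \<open>i = 1\<close> *[of "j - 1"] j' by (simp add: X1_def Y1_def)
        qed
      next
        case False
        show ?thesis
        proof (cases "j = 1")
          case True
          thus ?thesis using False *[of "i - 1"] i' by (simp add: X1_def Y1_def)
        next
          case j: False
          have m: "i - 1 \<in> {1..m}" "j - 1 \<in> {1..m}" using False j i' j' by blast+
          have "i - 1 = j - 1 \<longleftrightarrow> i = j" using False j ij by auto
          thus ?thesis using IH(3)[unfolded symplectic_family_def, THEN bspec, OF m(1), THEN bspec, OF m(2)]
            by (simp only: X1_def Y1_def False j if_False simp_thms)
        qed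
      qed
    qed
    have imX: "X1 ` {1..Suc k} = insert x (X ` {1..k})" and imY: "Y1 ` {1..Suc k} = insert y (Y ` {1..k})" for k
      unfolding X1_def Y1_def by (rule image_shift)+
    have E1: "E = span (X1 ` {1..Suc m} \<union> Y1 ` {1..Suc m})"
    proof -
      have "X1 ` {1..Suc m} \<union> Y1 ` {1..Suc m} = {x, y} \<union> (X ` {1..m} \<union> Y ` {1..m})"
        unfolding imX imY by blast
      moreover have "insert y (insert x E') = {x, y} \<union> E'" by blast
      ultimately show ?thesis using spanE span_Un_span[of "{x, y}" "X ` {1..m} \<union> Y ` {1..m}"]
        unfolding IH(5) by metis
    qed
    have W'iso: "p = 0" if "\<forall>u\<in>W. \<forall>v\<in>W. symp u v = 0"
    proof (rule ccontr)
      assume "p \<noteq> 0"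
      hence "1 \<in> {1..p}" "1 \<in> {1..q}" "1 \<in> {1..m}" using IH by auto
      hence "X 1 \<in> W'" "Y 1 \<in> W'" unfolding IH(6) by (auto intro: span_base)
      hence "symp (X 1) (Y 1) = 0" using that by (auto simp: W'_def)
      thus False using IH(3) \<open>1 \<in> {1..m}\<close> by (auto simp: symplectic_family_def)
    qed
    have dimE2: "dim E = 2 * Suc m" using dimE IH(4) by simp
    have concl: ?thesis
      if "W = span (X1 ` {1..p'} \<union> Y1 ` {1..q'})" "p' \<le> q'" "q' \<le> Suc m" for p' q'
      by (rule exI[of _ "Suc m"], rule exI[of _ p'], rule exI[of _ q'], rule exI[of _ X1], rule exI[of _ Y1])
        (intro conjI that fam dimE2 E1)
    consider (1) "x \<in> W" "y \<in> W" | (2) "\<forall>u\<in>W. \<forall>v\<in>W. symp u v = 0" "y \<in> W" | (3) "W = {0}"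
      using W by blast
    thus ?thesis
    proof cases
      case 1
      have "W = span ({x, y} \<union> W')"
      proof
        show "span ({x, y} \<union> W') \<subseteq> W"
          by (rule span_minimal) (use 1 less.prems(2) in \<open>auto simp: W'_def\<close>)
        show "W \<subseteq> span ({x, y} \<union> W')"
        proof
          fix e assume "e \<in> W"
          have "pr e \<in> W" unfolding pr_def
            by (intro subspace_diff[OF less.prems(2)] subspace_scale[OF less.prems(2)] 1 \<open>e \<in> W\<close>)
          hence "pr e \<in> W'" using pr \<open>e \<in> W\<close> less.prems(3) unfolding W'_def by blast
          thus "e \<in> span ({x, y} \<union> W')"
            by (subst dec[of e]) (intro span_add span_scale span_base, auto)
        qed
      qed
      moreover have "X1 ` {1..Suc p} \<union> Y1 ` {1..Suc q} = {x, y} \<union> (X ` {1..p} \<union> Y ` {1..q})"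
        unfolding imX imY by blast
      ultimately have "W = span (X1 ` {1..Suc p} \<union> Y1 ` {1..Suc q})"
        unfolding IH(6) by (simp only: span_Un_span)
      thus ?thesis by (rule concl) (use IH(1,2) in auto)
    next
      case 2
      have "W = span ({y} \<union> W')"
      proof
        show "span ({y} \<union> W') \<subseteq> W"
          by (rule span_minimal) (use 2 less.prems(2) in \<open>auto simp: W'_def\<close>)
        show "W \<subseteq> span ({y} \<union> W')"
        proof
          fix e assume "e \<in> W"
          have e: "symp e y = 0" using 2 \<open>e \<in> W\<close> by blast
          have "pr e \<in> W" unfolding pr_def e scaleR_zero_left diff_0_right
            by (intro subspace_diff[OF less.prems(2)] subspace_scale[OF less.prems(2)] 2(2) \<open>e \<in> W\<close>)
          hence "pr e \<in> W'" using pr \<open>e \<in> W\<close> less.prems(3) unfolding W'_def by blast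
          thus "e \<in> span ({y} \<union> W')"
            by (subst dec[of e], unfold e) (intro span_add span_scale span_base, auto)
        qed
      qed
      moreover have "X1 ` {1..0} \<union> Y1 ` {1..Suc q} = {y} \<union> (X ` {1..p} \<union> Y ` {1..q})"
        unfolding imY using W'iso[OF 2(1)] by auto
      ultimately have "W = span (X1 ` {1..0} \<union> Y1 ` {1..Suc q})"
        unfolding IH(6) by (simp only: span_Un_span)
      thus ?thesis by (rule concl) (use IH(1,2) in auto)
    next
      case 3
      have "W = span (X1 ` {1..0} \<union> Y1 ` {1..0})" using 3 by simp
      thus ?thesis by (rule concl) (use IH(1,2) in auto)
    qed
  qed
qed

text \<open>The radical of the form is the center.\<close>

lemma symp_nondegenerate:
  fixes u :: "(real, 'n::finite) heis"
  assumes "\<And>v. ht v = 0 \<Longrightarrow> symp u v = 0"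
  shows "u = central (ht u)"
proof -
  have "fst u $ i = 0 \<and> fst (snd u) $ i = 0" for i
  proof
    have "symp u (0, axis i 1, 0) = (\<Sum>j\<in>UNIV. if j = i then fst u $ j else 0)"
      unfolding symp_def by (intro sum.cong) (auto simp: axis_def)
    thus "fst u $ i = 0" using assms[of "(0, axis i 1, 0)"] by (simp add: ht_def)
    have "symp u (axis i 1, 0, 0) = (\<Sum>j\<in>UNIV. if j = i then - fst (snd u) $ j else 0)"
      unfolding symp_def by (intro sum.cong) (auto simp: axis_def)
    thus "fst (snd u) $ i = 0" using assms[of "(axis i 1, 0, 0)"] by (simp add: ht_def)
  qed
  hence "fst u = 0" "fst (snd u) = 0" by (simp_all add: vec_eq_iff)
  thus ?thesis by (simp add: central_def ht_def prod_eq_iff)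
qed

lemma adapted_heisenberg_family:
  fixes W :: "(real, 'n::finite) heis set"
  assumes "subspace W" "\<And>u. u \<in> W \<Longrightarrow> ht u = 0"
  obtains p q X Y where "p \<le> q" "q \<le> CARD('n)" "symplectic_family (CARD('n)) X Y"
    "{u. ht u = 0} = span (X ` {1..CARD('n)} \<union> Y ` {1..CARD('n)})" "W = span (X ` {1..p} \<union> Y ` {1..q})"
proof -
  let ?E = "{u :: (real, 'n) heis. ht u = 0}"
  have sub: "subspace ?E" by (auto simp: subspace_def ht_simps)
  have nd: "u = 0" if "u \<in> ?E" "\<And>v. v \<in> ?E \<Longrightarrow> symp u v = 0" for u
    using symp_nondegenerate[of u] that by (auto simp: central_simps)
  obtain m p q X Y where *: "p \<le> q" "q \<le> m" "symplectic_family m X Y" "dim ?E = 2 * m"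
    "?E = span (X ` {1..m} \<union> Y ` {1..m})" "W = span (X ` {1..p} \<union> Y ` {1..q})"
    using adapted_symplectic_family[OF sub assms(1) _ nd] assms(2) by blast
  have "?E = {u. (0, 0, 1) \<bullet> u = 0}" by (auto simp: ht_def inner_prod_def)
  hence "dim ?E = 2 * CARD('n)"
    using dim_hyperplane[of "(0, 0, 1) :: (real, 'n) heis"] by (simp add: zero_prod_def)
  hence "m = CARD('n)" using * by simp
  thus ?thesis using * that by blast
qed

lemma heisenberg_basisI:
  fixes X Y :: "nat \<Rightarrow> (real, 'n::finite) heis"
  assumes "symplectic_family (CARD('n)) X Y"
    and "\<And>u. ht u = 0 \<Longrightarrow> u \<in> span (X ` {1..CARD('n)} \<union> Y ` {1..CARD('n)} \<union> {central 1})"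
  shows "heisenberg_basis X Y (central 1)"
  unfolding heisenberg_basis_def
proof (intro conjI ballI)
  let ?S = "X ` {1..CARD('n)} \<union> Y ` {1..CARD('n)} \<union> {central 1}"
  have "u \<in> span ?S" for u :: "(real, 'n) heis"
  proof -
    have "u = (u - ht u *\<^sub>R central 1) + ht u *\<^sub>R central 1" by simp
    moreover have "u - ht u *\<^sub>R central 1 \<in> span ?S" by (rule assms(2)) (simp add: ht_simps)
    moreover have "ht u *\<^sub>R central 1 \<in> span ?S" by (intro span_scale span_base) auto
    ultimately show ?thesis using span_add by metis
  qed
  thus "span ?S = UNIV" by auto
qed (use assms(1) in \<open>auto simp: symplectic_family_def hbracket_symp central_simps\<close>)

section \<open>Normal forms of subalgebras\<close>

lemma symplectic_family_swap:
  assumes "symplectic_family m X Y"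
  shows "symplectic_family m Y (\<lambda>i. - X i)"
  unfolding symplectic_family_def
proof (intro ballI)
  fix i j assume "i \<in> {1..m}" "j \<in> {1..m}"
  thus "symp (Y i) (- X j) = (if i = j then 1 else 0) \<and> symp (Y i) (Y j) = 0 \<and> symp (- X i) (- X j) = 0"
    using assms symp_skew[of "Y i" "X j"] unfolding symplectic_family_def symp_minus by simp
qed

text \<open>Adapt a symplectic basis to the vectors of height zero in \<open>h\<close>. If these are isotropic, they come out as
  \<open>Y 1, \<dots>, Y q\<close>, and the two halves of the basis are swapped.\<close>

lemma normal_form_of_center_mem:
  fixes h :: "(real, 'n::finite) heis set"
  assumes "subspace h" "central 1 \<in> h" "h \<noteq> UNIV"
  shows "\<exists>X Y. heisenberg_basis X Y (central 1) \<and> normal_form X Y (central 1) h"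
proof -
  let ?n = "CARD('n)" and ?Z = "central 1 :: (real, 'n) heis"
  define W where "W = {u \<in> h. ht u = 0}"
  have "subspace W" using assms(1) by (auto simp: W_def subspace_def ht_simps)
  then obtain p q X Y where pq: "p \<le> q" "q \<le> ?n" and fam: "symplectic_family ?n X Y"
    and E: "{u. ht u = 0} = span (X ` {1..?n} \<union> Y ` {1..?n})" and W: "W = span (X ` {1..p} \<union> Y ` {1..q})"
    by (rule adapted_heisenberg_family) (auto simp: W_def)
  have bas: "heisenberg_basis X Y ?Z"
  proof (rule heisenberg_basisI[OF fam])
    fix u :: "(real, 'n) heis" assume "ht u = 0"
    hence "u \<in> span (X ` {1..?n} \<union> Y ` {1..?n})" using E by blast
    thus "u \<in> span (X ` {1..?n} \<union> Y ` {1..?n} \<union> {?Z})" by (rule span_mono[THEN subsetD, rotated]) auto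
  qed
  have bas': "heisenberg_basis Y (\<lambda>i. - X i) ?Z"
  proof (rule heisenberg_basisI[OF symplectic_family_swap[OF fam]])
    fix u :: "(real, 'n) heis" assume "ht u = 0"
    hence "u \<in> span (X ` {1..?n} \<union> Y ` {1..?n})" using E by blast
    moreover have "span (X ` {1..?n} \<union> Y ` {1..?n}) \<subseteq> span (Y ` {1..?n} \<union> (\<lambda>i. - X i) ` {1..?n} \<union> {?Z})"
    proof (rule span_minimal)
      have "- (- X i) \<in> span (Y ` {1..?n} \<union> (\<lambda>i. - X i) ` {1..?n} \<union> {?Z})" if "i \<in> {1..?n}" for i
        by (rule span_neg, rule span_base) (use that in auto)
      thus "X ` {1..?n} \<union> Y ` {1..?n} \<subseteq> span (Y ` {1..?n} \<union> (\<lambda>i. - X i) ` {1..?n} \<union> {?Z})"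
        by (auto intro: span_base)
    qed simp
    ultimately show "u \<in> span (Y ` {1..?n} \<union> (\<lambda>i. - X i) ` {1..?n} \<union> {?Z})" by blast
  qed
  have h: "h = span (X ` {1..p} \<union> Y ` {1..q} \<union> {?Z})"
  proof
    show "span (X ` {1..p} \<union> Y ` {1..q} \<union> {?Z}) \<subseteq> h"
    proof (rule span_minimal[OF _ assms(1)])
      have "X ` {1..p} \<union> Y ` {1..q} \<subseteq> W" unfolding W by (rule span_superset)
      thus "X ` {1..p} \<union> Y ` {1..q} \<union> {?Z} \<subseteq> h" using assms(2) by (auto simp: W_def)
    qed
    show "h \<subseteq> span (X ` {1..p} \<union> Y ` {1..q} \<union> {?Z})"
    proof
      fix u assume u: "u \<in> h"
      have "u - ht u *\<^sub>R ?Z \<in> W" unfolding W_def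
        using assms(1,2) u by (auto simp: ht_simps intro!: subspace_diff subspace_scale)
      hence "u - ht u *\<^sub>R ?Z \<in> span (X ` {1..p} \<union> Y ` {1..q} \<union> {?Z})"
        unfolding W by (rule span_mono[THEN subsetD, rotated]) auto
      moreover have "ht u *\<^sub>R ?Z \<in> span (X ` {1..p} \<union> Y ` {1..q} \<union> {?Z})"
        by (intro span_scale span_base) auto
      ultimately show "u \<in> span (X ` {1..p} \<union> Y ` {1..q} \<union> {?Z})"
        using span_add[of "u - ht u *\<^sub>R ?Z" _ "ht u *\<^sub>R ?Z"] by simp
    qed
  qed
  show ?thesis
  proof (cases "p = 0")
    case False
    have "(p, q) \<noteq> (?n, ?n)"
    proof
      assume "(p, q) = (?n, ?n)"
      hence "h = UNIV" using h bas by (auto simp: heisenberg_basis_def)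
      thus False using assms(3) by blast
    qed
    hence "normal_form X Y ?Z h"
      unfolding normal_form_def using pq False h by (metis One_nat_def Suc_leI neq0_conv)
    thus ?thesis using bas by blast
  next
    case True
    show ?thesis
    proof (cases "q = 0")
      case True
      hence "h = span {?Z}" using h \<open>p = 0\<close> by simp
      thus ?thesis using bas by (auto simp: normal_form_def)
    next
      case False
      have "h = span (Y ` {1..q} \<union> {?Z})" using h \<open>p = 0\<close> by simp
      moreover have "1 \<le> q" using False by simp
      ultimately have "normal_form Y (\<lambda>i. - X i) ?Z h"
        unfolding normal_form_def using pq by blast
      thus ?thesis using bas' by blast
    qed
  qed
qed

text \<open>In a symplectic basis adapted to the projection of \<open>h\<close> along the center, that projection is
  spanned by \<open>Y 1, \<dots>, Y q\<close>. If \<open>q < n\<close>, the pair \<open>X n, Y n\<close> centralizes \<open>h\<close>; if \<open>q = n\<close>, lifting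
  the \<open>Y i\<close> back to \<open>h\<close> gives half of a Heisenberg basis.\<close>

lemma isotropic_normal_form:
  fixes h :: "(real, 'n::finite) heis set"
  assumes "subspace h" "central 1 \<notin> h" "\<And>u v. u \<in> h \<Longrightarrow> v \<in> h \<Longrightarrow> symp u v = 0"
  shows "(\<exists>v w. symp v w = 1 \<and> (\<forall>a\<in>h. symp v a = 0 \<and> symp w a = 0)) \<or>
    (\<exists>X Y. symplectic_family (CARD('n)) X Y \<and> heisenberg_basis X Y (central 1) \<and> h = span (X ` {1..CARD('n)}))"
proof -
  let ?n = "CARD('n)" and ?Z = "central 1 :: (real, 'n) heis"
  define pr where "pr u = u - ht u *\<^sub>R ?Z" for u :: "(real, 'n) heis"
  have lin: "linear pr" by (rule linearI) (auto simp: pr_def ht_simps algebra_simps)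
  have symp_pr: "symp u (pr v) = symp u v" "symp (pr v) u = symp v u" for u v
    by (simp_all add: pr_def symp_simps)
  have "subspace (pr ` h)" using lin assms(1) by (rule linear_subspace_image)
  then obtain p q X Y where pq: "p \<le> q" "q \<le> ?n" and fam: "symplectic_family ?n X Y"
    and E: "{u. ht u = 0} = span (X ` {1..?n} \<union> Y ` {1..?n})"
    and W: "pr ` h = span (X ` {1..p} \<union> Y ` {1..q})"
    by (rule adapted_heisenberg_family) (auto simp: pr_def ht_simps)
  have "p = 0"
  proof (rule ccontr)
    assume "p \<noteq> 0"
    hence "1 \<in> {1..p}" "1 \<in> {1..q}" "1 \<in> {1..?n}" using pq by auto
    hence "X 1 \<in> pr ` h" "Y 1 \<in> pr ` h" unfolding W by (auto intro: span_base)
    hence "symp (X 1) (Y 1) = 0" using assms(3) by (auto simp: symp_pr)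
    thus False using fam \<open>1 \<in> {1..?n}\<close> by (auto simp: symplectic_family_def)
  qed
  hence W: "pr ` h = span (Y ` {1..q})" using W by simp
  have n: "?n \<in> {1..?n}" using zero_less_card_finite[where 'a='n] by auto
  show ?thesis
  proof (cases "q < ?n")
    case True
    have "symp (X ?n) a = 0 \<and> symp (Y ?n) a = 0" if "a \<in> h" for a
    proof -
      have "span (Y ` {1..q}) \<subseteq> {e. symp (X ?n) e = 0} \<inter> {e. symp (Y ?n) e = 0}"
        by (rule span_minimal)
          (use fam n True in \<open>auto simp: symplectic_family_def subspace_symp_perp intro!: subspace_inter\<close>)
      hence "symp (X ?n) (pr a) = 0 \<and> symp (Y ?n) (pr a) = 0" using W that by blast
      thus ?thesis by (simp add: symp_pr)
    qed
    moreover have "symp (X ?n) (Y ?n) = 1" using fam n by (auto simp: symplectic_family_def)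
    ultimately show ?thesis by blast
  next
    case False
    hence W: "pr ` h = span (Y ` {1..?n})" using W pq by simp
    have "\<exists>l. l \<in> h \<and> pr l = Y i" if "i \<in> {1..?n}" for i
    proof -
      have "Y i \<in> pr ` h" unfolding W using that by (intro span_base imageI)
      thus ?thesis by (metis imageE)
    qed
    then obtain L where L: "L i \<in> h" "pr (L i) = Y i" if "i \<in> {1..?n}" for i by metis
    have fam2: "symplectic_family ?n L (\<lambda>i. - X i)"
    proof -
      have "symp (L i) u = symp (Y i) u" "symp u (L i) = symp u (Y i)" if "i \<in> {1..?n}" for i u
        using symp_pr(1)[of u "L i"] symp_pr(2)[of "L i" u] L(2)[OF that] by simp_all
      thus ?thesis using symplectic_family_swap[OF fam] unfolding symplectic_family_def by simp
    qed
    have inj: "inj_on pr h"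
    proof (rule inj_onI)
      fix u v assume uv: "u \<in> h" "v \<in> h" "pr u = pr v"
      have e: "u - v = (ht u - ht v) *\<^sub>R ?Z" using uv(3) by (simp add: pr_def algebra_simps)
      have "(1 / (ht u - ht v)) *\<^sub>R (u - v) \<in> h"
        using uv assms(1) by (intro subspace_scale subspace_diff)
      hence "ht u - ht v = 0" using e assms(2) by (cases "ht u - ht v = 0") auto
      thus "u = v" using e by simp
    qed
    have Lh: "span (L ` {1..?n}) \<subseteq> h" by (rule span_minimal) (use L assms(1) in auto)
    have "pr ` span (L ` {1..?n}) = pr ` h"
    proof -
      have "pr ` L ` {1..?n} = Y ` {1..?n}" unfolding image_image using L(2) by (intro image_cong) auto
      thus ?thesis using W linear_span_image[OF lin, of "L ` {1..?n}"] by simp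
    qed
    hence h: "h = span (L ` {1..?n})" using inj_on_image_eq_iff[OF inj Lh order_refl] by simp
    have "heisenberg_basis L (\<lambda>i. - X i) ?Z"
    proof (rule heisenberg_basisI[OF fam2])
      fix u :: "(real, 'n) heis" assume "ht u = 0"
      let ?S = "L ` {1..?n} \<union> (\<lambda>i. - X i) ` {1..?n} \<union> {?Z}"
      have "u \<in> span (X ` {1..?n} \<union> Y ` {1..?n})" using E \<open>ht u = 0\<close> by blast
      moreover have "span (X ` {1..?n} \<union> Y ` {1..?n}) \<subseteq> span ?S"
      proof (rule span_minimal)
        have "- (- X i) \<in> span ?S" if "i \<in> {1..?n}" for i
          by (rule span_neg, rule span_base) (use that in auto)
        moreover have "Y i \<in> span ?S" if "i \<in> {1..?n}" for i
          unfolding L(2)[OF that, symmetric] pr_def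
          by (intro span_diff span_scale span_base) (use that in auto)
        ultimately show "X ` {1..?n} \<union> Y ` {1..?n} \<subseteq> span ?S" by auto
      qed simp
      ultimately show "u \<in> span ?S" by blast
    qed
    thus ?thesis using fam2 h by blast
  qed
qed


section \<open>The rank of the support\<close>

lemma subspace_annihilator: "subspace (annihilator h)"
  by (auto simp: subspace_def annihilator_def blinfun.add_left blinfun.scaleR_left)

text \<open>Under the inner product the annihilator is the orthogonal complement.\<close>

lemma card_basis_annihilator:
  fixes h :: "(real, 'n::finite) heis set"
  assumes "subspace h" "independent B" "span B = annihilator h"
  shows "card B = DIM((real, 'n) heis) - dim h"
proof -
  let ?P = "{y \<in> (UNIV :: (real, 'n) heis set). \<forall>x\<in>h. orthogonal x y}"
  have dimP: "dim ?P = DIM((real, 'n) heis) - dim h"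
    using dim_subspace_orthogonal_to_vectors[OF assms(1) subspace_UNIV subset_UNIV] by simp
  have subP: "subspace ?P"
    by (auto simp: subspace_def orthogonal_def inner_add_right)
  have lin: "linear (blinfun_inner_left :: (real, 'n) heis \<Rightarrow> _)"
    by (intro linearI blinfun_eqI) (simp_all add: blinfun.bilinear_simps inner_add_right)
  have inj: "inj (blinfun_inner_left :: (real, 'n) heis \<Rightarrow> _)"
  proof (rule injI)
    fix u v :: "(real, 'n) heis" assume "blinfun_inner_left u = blinfun_inner_left v"
    hence "blinfun_inner_left u w = blinfun_inner_left v w" for w by simp
    thus "u = v" by (intro vector_eq_ldot[THEN iffD1]) (simp add: inner_commute)
  qed
  have im: "blinfun_inner_left ` ?P = annihilator h"
  proof (intro equalityI subsetI)
    fix \<xi> assume \<xi>: "\<xi> \<in> annihilator h"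
    define u where "u = (\<Sum>b\<in>Basis. blinfun_apply \<xi> b *\<^sub>R b)"
    have e: "blinfun_apply \<xi> v = u \<bullet> v" for v
    proof -
      have "blinfun_apply \<xi> v = blinfun_apply \<xi> (\<Sum>b\<in>Basis. (v \<bullet> b) *\<^sub>R b)" by (simp only: euclidean_representation)
      also have "\<dots> = u \<bullet> v"
        by (simp add: blinfun.sum_right blinfun.scaleR_right u_def inner_sum_left inner_commute[of v] mult.commute)
      finally show ?thesis .
    qed
    have "\<xi> = blinfun_inner_left u" by (rule blinfun_eqI) (simp add: e inner_commute[of u])
    moreover have "u \<in> ?P" using \<xi> e by (auto simp: annihilator_def orthogonal_def inner_commute)
    ultimately show "\<xi> \<in> blinfun_inner_left ` ?P" by blast
  qed (auto simp: annihilator_def orthogonal_def inner_commute)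
  obtain C where C: "C \<subseteq> ?P" "independent C" "?P \<subseteq> span C" "card C = dim ?P"
    using basis_exists by blast
  have "span C = ?P" using C subP by (intro span_subspace) auto
  hence "span (blinfun_inner_left ` C) = span B"
    using linear_span_image[OF lin, of C] im assms(3) by simp
  moreover have "independent (blinfun_inner_left ` C)"
    using linear_independent_injective_image[OF lin C(2)] inj_on_subset[OF inj subset_UNIV] by simp
  ultimately have "card B = card (blinfun_inner_left ` C)"
    using assms(2) by (metis dim_eq_card_independent dim_span)
  also have "\<dots> = card C" by (rule card_image) (rule inj_on_subset[OF inj subset_UNIV])
  finally show ?thesis using C(4) dimP by simp
qed

text \<open>If \<open>Z\<close> vanished, \<open>2 n\<close> vectors would span the algebra.\<close>

lemma heisenberg_basis_center:
  fixes X Y :: "nat \<Rightarrow> (real, 'n::finite) heis"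
  assumes "heisenberg_basis X Y Z"
  obtains z where "z \<noteq> 0" "Z = central z"
proof -
  have 1: "1 \<in> {1..CARD('n)}" by (simp add: Suc_leI)
  hence "Z = hbracket (X 1) (Y 1)" using assms by (auto simp: heisenberg_basis_def)
  hence Z: "Z = central (symp (X 1) (Y 1))" by (simp add: hbracket_symp)
  have "Z \<noteq> 0"
  proof
    assume "Z = 0"
    hence "span (X ` {1..CARD('n)} \<union> Y ` {1..CARD('n)}) = UNIV"
      using assms by (simp add: heisenberg_basis_def span_insert_0)
    hence "dim (UNIV :: (real, 'n) heis set) \<le> card (X ` {1..CARD('n)} \<union> Y ` {1..CARD('n)})"
      by (intro dim_le_card) auto
    also have "\<dots> \<le> card (X ` {1..CARD('n)}) + card (Y ` {1..CARD('n)})" by (rule card_Un_le)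
    also have "\<dots> \<le> CARD('n) + CARD('n)" by (intro add_mono order_trans[OF card_image_le]) auto
    finally show False by simp
  qed
  thus ?thesis using Z that by (metis central_simps(4))
qed

text \<open>The coadjoint action moves a functional by a multiple of its value at \<open>Z\<close>. If \<open>h\<close> contains the center,
  nothing in the annihilator is moved, and the annihilator lies in the cross-section. Otherwise
  \<open>h = span {X 1, \<dots>, X n}\<close>, and every functional that kills \<open>h\<close> is a multiple of \<open>Z\<^sup>*\<close> plus one that kills \<open>Z\<close>;
  both summands belong to the cross-section.\<close>

lemma span_support_parameters:
  fixes h :: "(real, 'n::finite) heis set"
  assumes bas: "heisenberg_basis X Y Z" and "normal_form X Y Z h"
  shows "support_parameters X Y Z h \<subseteq> annihilator h" "annihilator h \<subseteq> span (support_parameters X Y Z h)"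
proof -
  obtain z where z: "z \<noteq> 0" "Z = central z" using heisenberg_basis_center[OF bas] .
  have sat: "\<xi> \<in> coadjoint_saturation (annihilator h)" if "\<xi> \<in> annihilator h" for \<xi>
    unfolding coadjoint_saturation_def using that
    by (intro CollectI exI[of _ 0] bexI[of _ \<xi>] allI) (simp_all add: hbracket_symp central_simps)
  have cz: "blinfun_apply \<xi> (central t) = (t / z) * blinfun_apply \<xi> Z" for \<xi> t
  proof -
    have "(central t :: (real, 'n) heis) = (t / z) *\<^sub>R Z" using z by (simp add: central_simps)
    thus ?thesis by (simp add: blinfun.scaleR_right)
  qed
  have fix_orb: "\<eta> \<in> annihilator h" if "\<eta> \<in> coadjoint_saturation (annihilator h)" "blinfun_apply \<eta> Z = 0" for \<eta>
  proof -
    obtain g \<xi> where \<xi>: "\<xi> \<in> annihilator h" "\<And>v. blinfun_apply \<eta> v = blinfun_apply \<xi> (v + hbracket (- g) v)"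
      using \<open>\<eta> \<in> coadjoint_saturation _\<close> unfolding coadjoint_saturation_def mem_Collect_eq by metis
    have "blinfun_apply \<xi> Z = 0" using \<xi>(2)[of Z] that(2) z by (simp add: hbracket_symp central_simps)
    hence "blinfun_apply \<eta> v = blinfun_apply \<xi> v" for v
      using \<xi>(2)[of v] by (simp add: blinfun.add_right hbracket_symp cz)
    thus ?thesis using \<xi>(1) by (simp add: annihilator_def)
  qed
  consider (1) "Z \<in> h" | (2) "h = span (X ` {1..CARD('n)})"
    using assms(2) unfolding normal_form_def by (auto intro: span_base)
  hence "support_parameters X Y Z h \<subseteq> annihilator h \<and> annihilator h \<subseteq> span (support_parameters X Y Z h)"
  proof cases
    case 1
    have "blinfun_apply \<eta> Z = 0" if \<eta>: "\<eta> \<in> coadjoint_saturation (annihilator h)" for \<eta>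
    proof -
      obtain g \<xi> where \<xi>: "\<xi> \<in> annihilator h" "\<And>v. blinfun_apply \<eta> v = blinfun_apply \<xi> (v + hbracket (- g) v)"
        using \<eta> unfolding coadjoint_saturation_def mem_Collect_eq by metis
      show ?thesis using \<xi>(2)[of Z] \<xi>(1) 1 z by (simp add: hbracket_symp central_simps annihilator_def)
    qed
    hence "support_parameters X Y Z h = annihilator h"
      using fix_orb sat by (auto simp: support_parameters_def dual_cross_section_def)
    thus ?thesis by (simp add: span_superset)
  next
    case 2
    have ann: "\<xi> \<in> annihilator h" if "\<And>i. i \<in> {1..CARD('n)} \<Longrightarrow> blinfun_apply \<xi> (X i) = 0" for \<xi>
    proof -
      have "span (X ` {1..CARD('n)}) \<subseteq> {v. blinfun_apply \<xi> v = 0}"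
        by (rule span_minimal) (use that in \<open>auto simp: subspace_def blinfun.add_right blinfun.scaleR_right\<close>)
      thus ?thesis using 2 by (auto simp: annihilator_def)
    qed
    have "support_parameters X Y Z h \<subseteq> annihilator h"
      using fix_orb ann by (auto simp: support_parameters_def dual_cross_section_def)
    moreover have "annihilator h \<subseteq> span (support_parameters X Y Z h)"
    proof
      fix \<xi> assume \<xi>: "\<xi> \<in> annihilator h"
      have n1: "1 \<in> {1..CARD('n)}" by (simp add: Suc_leI)
      \<comment> \<open>The functional \<open>Z\<^sup>*\<close>: the height, corrected by multiples of \<open>symp (X i)\<close> and \<open>symp (Y i)\<close>.\<close>
      define f where "f v = ht v - (\<Sum>i\<in>{1..CARD('n)}. ht (X i) * symp v (Y i) / z + ht (Y i) * symp (X i) v / z)" for v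
      have "linear f" by (rule linearI)
        (auto simp: f_def ht_simps symp_simps algebra_simps sum.distrib sum_distrib_left sum_subtractf add_divide_distrib)
      define \<zeta> where "\<zeta> = Blinfun f"
      have \<zeta>: "blinfun_apply \<zeta> = f"
        unfolding \<zeta>_def using \<open>linear f\<close> by (simp add: bounded_linear_Blinfun_apply linear_conv_bounded_linear)
      have rel: "symp (X i) (Y j) = (if i = j then z else 0)" "symp (X i) (X j) = 0" "symp (Y i) (Y j) = 0"
        if "i \<in> {1..CARD('n)}" "j \<in> {1..CARD('n)}" for i j
      proof -
        have "hbracket (X i) (Y j) = (if i = j then Z else 0)" "hbracket (X i) (X j) = 0" "hbracket (Y i) (Y j) = 0"
          using bas that unfolding heisenberg_basis_def by metis+
        from this[THEN arg_cong[where f = ht]] show "symp (X i) (Y j) = (if i = j then z else 0)"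
          "symp (X i) (X j) = 0" "symp (Y i) (Y j) = 0"
          using z(2) by (simp_all add: hbracket_symp ht_simps split: if_splits)
      qed
      have fX: "f (X i) = 0" "f (Y i) = 0" if i: "i \<in> {1..CARD('n)}" for i
      proof -
        have "(\<Sum>j\<in>{1..CARD('n)}. ht (X j) * symp (X i) (Y j) / z + ht (Y j) * symp (X j) (X i) / z)
            = (\<Sum>j\<in>{1..CARD('n)}. if j = i then ht (X j) else 0)"
          using i z by (intro sum.cong) (auto simp: rel)
        thus "f (X i) = 0" using i by (simp add: f_def)
        have "(\<Sum>j\<in>{1..CARD('n)}. ht (X j) * symp (Y i) (Y j) / z + ht (Y j) * symp (X j) (Y i) / z)
            = (\<Sum>j\<in>{1..CARD('n)}. if j = i then ht (Y j) else 0)"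
          using i z by (intro sum.cong) (auto simp: rel)
        thus "f (Y i) = 0" using i by (simp add: f_def)
      qed
      have fZ: "f Z = z" by (simp add: f_def z)
      have \<zeta>ann: "\<zeta> \<in> annihilator h" by (rule ann) (simp add: \<zeta> fX)
      have "\<zeta> \<in> support_parameters X Y Z h"
        using sat[OF \<zeta>ann] fX fZ z by (auto simp: support_parameters_def dual_cross_section_def \<zeta>)
      moreover have "\<xi> - (blinfun_apply \<xi> Z / z) *\<^sub>R \<zeta> \<in> support_parameters X Y Z h"
      proof -
        have "\<xi> - (blinfun_apply \<xi> Z / z) *\<^sub>R \<zeta> \<in> annihilator h"
          using \<xi> \<zeta>ann by (intro subspace_diff subspace_scale subspace_annihilator)
        thus ?thesis using sat fZ z
          by (auto simp: support_parameters_def dual_cross_section_def \<zeta> blinfun.bilinear_simps)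
      qed
      ultimately have "(\<xi> - (blinfun_apply \<xi> Z / z) *\<^sub>R \<zeta>) + (blinfun_apply \<xi> Z / z) *\<^sub>R \<zeta> \<in> span (support_parameters X Y Z h)"
        by (intro span_add span_scale span_base)
      thus "\<xi> \<in> span (support_parameters X Y Z h)" by simp
    qed
    ultimately show ?thesis by blast
  qed
  thus "support_parameters X Y Z h \<subseteq> annihilator h" "annihilator h \<subseteq> span (support_parameters X Y Z h)" by auto
qed

text \<open>A set of the kind minimized in \<open>rank_wrt\<close> lies in the annihilator and spans it, hence is a basis of it.\<close>

lemma support_rank_eq:
  fixes h :: "(real, 'n::finite) heis set"
  assumes "subspace h" "\<exists>X Y. heisenberg_basis X Y (central 1) \<and> normal_form X Y (central 1) h"
  shows "support_rank h = DIM((real, 'n) heis) - dim h"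
proof -
  let ?d = "DIM((real, 'n) heis) - dim h"
  have "rank_wrt X Y Z h = ?d" if XY: "heisenberg_basis X Y Z" "normal_form X Y Z h" for X Y Z
  proof -
    note s = span_support_parameters[OF XY]
    have eq: "(B \<subseteq> annihilator h \<and> finite B \<and> independent B \<and> card B = r \<and> support_parameters X Y Z h \<subseteq> span B)
      \<longleftrightarrow> (span B = annihilator h \<and> finite B \<and> independent B \<and> card B = r)" for B r
    proof
      assume a: "B \<subseteq> annihilator h \<and> finite B \<and> independent B \<and> card B = r \<and> support_parameters X Y Z h \<subseteq> span B"
      hence "span (support_parameters X Y Z h) \<subseteq> span B" by (intro span_minimal) auto
      moreover have "span B \<subseteq> annihilator h" using a by (intro span_minimal subspace_annihilator) auto
      ultimately show "span B = annihilator h \<and> finite B \<and> independent B \<and> card B = r" using a s by blast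
    next
      assume a: "span B = annihilator h \<and> finite B \<and> independent B \<and> card B = r"
      thus "B \<subseteq> annihilator h \<and> finite B \<and> independent B \<and> card B = r \<and> support_parameters X Y Z h \<subseteq> span B"
        using s span_superset[of B] by auto
    qed
    obtain B where B: "independent B" "span B = annihilator h"
      using maximal_independent_subset[of "annihilator h"] subspace_annihilator
      by (metis span_eq_iff span_minimal subset_antisym)
    have "dim h < DIM((real, 'n) heis) \<or> annihilator h = {0}"
    proof (rule disjCI)
      assume "annihilator h \<noteq> {0}"
      then obtain \<xi> where \<xi>: "\<xi> \<in> annihilator h" "\<xi> \<noteq> 0" using subspace_annihilator subspace_0 by blast
      show "dim h < DIM((real, 'n) heis)"
      proof (rule ccontr)
        assume "\<not> dim h < DIM((real, 'n) heis)"
        hence "h = UNIV" using dim_eq_full[of h] dim_subset_UNIV[of h] assms(1)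
          by (metis antisym_conv1 span_eq_iff)
        hence "\<xi> = 0" using \<xi> by (intro blinfun_eqI) (auto simp: annihilator_def)
        thus False using \<xi> by blast
      qed
    qed
    hence fin: "finite B"
    proof
      assume "dim h < DIM((real, 'n) heis)"
      hence "card B > 0" using card_basis_annihilator[OF assms(1) B] by simp
      thus ?thesis using card_gt_0_iff by blast
    next
      assume "annihilator h = {0}"
      hence "B \<subseteq> {0}" using B(2) span_superset by blast
      thus ?thesis using finite_subset by blast
    qed
    show ?thesis unfolding rank_wrt_def eq
    proof (rule Least_equality)
      show "\<exists>B. span B = annihilator h \<and> finite B \<and> independent B \<and> card B = ?d"
        using B fin card_basis_annihilator[OF assms(1) B] by blast
    next
      fix r assume "\<exists>B. span B = annihilator h \<and> finite B \<and> independent B \<and> card B = r"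
      then obtain B where "independent B" "span B = annihilator h" "card B = r" by blast
      thus "?d \<le> r" using card_basis_annihilator[OF assms(1), of B] by simp
    qed
  qed
  note rank = this
  obtain X Y where XY: "heisenberg_basis X Y (central 1)" "normal_form X Y (central 1) h" using assms(2) by blast
  show ?thesis unfolding support_rank_def
  proof (rule the_equality)
    show "\<exists>X Y Z. heisenberg_basis X Y Z \<and> normal_form X Y Z h \<and> ?d = rank_wrt X Y Z h"
      using XY rank[OF XY] by (intro exI[of _ X] exI[of _ Y] exI[of _ "central 1"]) simp
  next
    fix r assume "\<exists>X Y Z. heisenberg_basis X Y Z \<and> normal_form X Y Z h \<and> r = rank_wrt X Y Z h"
    then obtain X Y Z where "heisenberg_basis X Y Z" "normal_form X Y Z h" "r = rank_wrt X Y Z h" by metis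
    thus "r = ?d" using rank by simp
  qed
qed

section \<open>Smooth maps\<close>

lemma frechet_derivative_eqI: "(f has_derivative f') (at x) \<Longrightarrow> frechet_derivative f (at x) = f'"
  using frechet_derivative_at by metis

lemma differentiable_has_frechet: "f differentiable (at x) \<Longrightarrow> (f has_derivative frechet_derivative f (at x)) (at x)"
  using frechet_derivative_works by blast

lemma Ck_on_const: "Ck_on k (\<lambda>x. c) UNIV"
proof (induction k arbitrary: c)
  case (Suc k)
  have "frechet_derivative (\<lambda>x :: 'a. c) (at x) v = 0" for x v
    by (subst frechet_derivative_eqI[OF has_derivative_const]) simp
  thus ?case using Suc by simp
qed simp

lemma Ck_on_SucD: "Ck_on (Suc k) f UNIV \<Longrightarrow> Ck_on k f UNIV"
proof (induction k arbitrary: f)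
  case 0
  thus ?case by (auto simp: continuous_on_eq_continuous_at intro: differentiable_imp_continuous_within)
next
  case (Suc k)
  show ?case unfolding Ck_on.simps(2)[of k]
    using Suc.prems Suc.IH by (auto simp only: Ck_on.simps(2)[of "Suc k"])
qed

lemma Ck_on_add:
  "Ck_on k f UNIV \<Longrightarrow> Ck_on k g UNIV \<Longrightarrow> Ck_on k (\<lambda>x. f x + g x) UNIV"
proof (induction k arbitrary: f g)
  case (Suc k)
  have "((\<lambda>x. f x + g x) has_derivative
      (\<lambda>v. frechet_derivative f (at x) v + frechet_derivative g (at x) v)) (at x)" for x
    using Suc.prems by (intro has_derivative_add differentiable_has_frechet) auto
  note d = this and d' = frechet_derivative_eqI[OF this]
  show ?case using Suc d by (auto simp: d' differentiable_def)
qed (auto intro: continuous_intros)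

lemma Ck_on_bilinear:
  assumes b: "bounded_bilinear b"
  shows "Ck_on k f UNIV \<Longrightarrow> Ck_on k g UNIV \<Longrightarrow> Ck_on k (\<lambda>x. b (f x) (g x)) UNIV"
proof (induction k arbitrary: f g)
  case 0
  thus ?case using bounded_bilinear.continuous_on[OF b] by auto
next
  case (Suc k)
  have "((\<lambda>x. b (f x) (g x)) has_derivative
      (\<lambda>v. b (f x) (frechet_derivative g (at x) v) + b (frechet_derivative f (at x) v) (g x))) (at x)" for x
    using Suc.prems by (intro bounded_bilinear.FDERIV[OF b] differentiable_has_frechet) auto
  note d = this and d' = frechet_derivative_eqI[OF this]
  have "Ck_on k (\<lambda>x. b (f x) (frechet_derivative g (at x) v) + b (frechet_derivative f (at x) v) (g x)) UNIV" for v
    using Suc.prems Ck_on_SucD[OF Suc.prems(1)] Ck_on_SucD[OF Suc.prems(2)]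
    by (intro Ck_on_add Suc.IH) auto
  thus ?case using d by (auto simp: d' differentiable_def)
qed

lemma Ck_on_linear:
  assumes l: "bounded_linear l"
  shows "Ck_on k f UNIV \<Longrightarrow> Ck_on k (\<lambda>x. l (f x)) UNIV"
proof (induction k arbitrary: f)
  case 0
  thus ?case using bounded_linear.continuous_on[OF l] by auto
next
  case (Suc k)
  have "((\<lambda>x. l (f x)) has_derivative (\<lambda>v. l (frechet_derivative f (at x) v))) (at x)" for x
    using Suc.prems by (intro bounded_linear.has_derivative[OF l] differentiable_has_frechet) auto
  note d = this and d' = frechet_derivative_eqI[OF this]
  show ?case using Suc d by (auto simp: d' differentiable_def)
qed

lemma Ck_on_id: "Ck_on k (\<lambda>x. x) UNIV"
proof (cases k)
  case (Suc m)
  have "frechet_derivative (\<lambda>x::'a. x) (at x) v = v" for x v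
    by (subst frechet_derivative_eqI[OF has_derivative_ident]) simp
  thus ?thesis unfolding Suc by (simp add: Ck_on_const)
qed simp

lemma Ck_on_subset: "Ck_on k f UNIV \<Longrightarrow> Ck_on k f U"
proof (induction k arbitrary: f)
  case 0
  thus ?case by (auto intro: continuous_on_subset)
qed auto

lemma smooth_on_const: "smooth_on (\<lambda>x. c) UNIV"
  and smooth_on_id: "smooth_on (\<lambda>x. x) UNIV"
  and smooth_on_add: "smooth_on f UNIV \<Longrightarrow> smooth_on g UNIV \<Longrightarrow> smooth_on (\<lambda>x. f x + g x) UNIV"
  and smooth_on_bilinear: "bounded_bilinear b \<Longrightarrow> smooth_on f UNIV \<Longrightarrow> smooth_on g UNIV
        \<Longrightarrow> smooth_on (\<lambda>x. b (f x) (g x)) UNIV"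
  and smooth_on_linear: "bounded_linear l \<Longrightarrow> smooth_on f UNIV \<Longrightarrow> smooth_on (\<lambda>x. l (f x)) UNIV"
  and smooth_on_subset: "smooth_on f UNIV \<Longrightarrow> smooth_on f U"
  by (simp_all add: smooth_on_def Ck_on_const Ck_on_id Ck_on_add Ck_on_bilinear Ck_on_linear Ck_on_subset)

lemma smooth_on_differentiable: "smooth_on f UNIV \<Longrightarrow> f differentiable (at x)"
  unfolding smooth_on_def by (metis Ck_on.simps(2) UNIV_I)

lemma smooth_on_continuous: "smooth_on f UNIV \<Longrightarrow> continuous_on UNIV f"
  unfolding smooth_on_def by (metis Ck_on.simps(1))

lemma smooth_on_hmult:
  assumes "smooth_on f UNIV" "smooth_on g UNIV"
  shows "smooth_on (\<lambda>x. f x \<star> g x) UNIV"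
  unfolding hmult_def using assms
  by (intro smooth_on_add smooth_on_linear[OF bounded_linear_scaleR_right]
      smooth_on_bilinear[OF bounded_bilinear_hbracket])


section \<open>Splitting the group along a complement of the subalgebra\<close>

text \<open>A subalgebra \<open>h\<close> with a complement \<open>c\<close>, one of which contains the center. Then every group
  element is \<open>w \<star> a\<close> with \<open>w \<in> c\<close> and \<open>a \<in> h\<close> in exactly one way, and \<open>w = K g\<close> is polynomial
  in \<open>g\<close>: the homogeneous space is \<open>c\<close> itself.\<close>

locale splitting =
  fixes h c :: "('a::real_normed_field, 'n::finite) heis set" and P :: "('a, 'n) heis \<Rightarrow> ('a, 'n) heis"
  assumes subspace_h: "subspace h" and subspace_c: "subspace c" and P_linear: "bounded_linear P"
    and P_in: "P u \<in> c" and P_diff: "u - P u \<in> h" and P_id: "v \<in> c \<Longrightarrow> P v = v" and P_0: "a \<in> h \<Longrightarrow> P a = 0"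
    and h_bracket: "a \<in> h \<Longrightarrow> b \<in> h \<Longrightarrow> central (symp a b) \<in> h"
    and center: "(\<forall>t. central t \<in> h) \<or> (\<forall>t. central t \<in> c)"
begin

definition K :: "('a, 'n) heis \<Rightarrow> ('a, 'n) heis" where
  "K g = P (g - (1/2) *\<^sub>R hbracket (P g) g)"

lemmas P_simps = linear_add[OF bounded_linear.linear[OF P_linear]] linear_diff[OF bounded_linear.linear[OF P_linear]]
  linear_cmul[OF bounded_linear.linear[OF P_linear]] linear_neg[OF bounded_linear.linear[OF P_linear]]

lemma K_eq: "K g = P g - P (central ((1/2) *\<^sub>R symp (P g) g))"
  by (simp add: K_def P_simps hbracket_symp central_simps)

lemma K_in: "K g \<in> c"
  by (simp add: K_def P_in)

lemma h_mult: "a \<in> h \<Longrightarrow> b \<in> h \<Longrightarrow> a \<star> b \<in> h"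
  using subspace_scale[OF subspace_h h_bracket, of a b "1/2"] subspace_h
  by (simp add: hmult_symp central_simps subspace_add)

lemma h_minus: "a \<in> h \<Longrightarrow> - a \<in> h"
  using subspace_h by (rule subspace_neg)

lemma K_cofactor: "- K g \<star> g \<in> h"
  using center
proof
  assume z: "\<forall>t. central t \<in> h"
  hence "- K g \<star> g = (g - P g) + central ((1/2) *\<^sub>R symp (- K g) g)"
    by (simp add: hmult_symp K_eq P_0)
  thus ?thesis using z P_diff subspace_h by (simp add: subspace_add)
next
  assume z: "\<forall>t. central t \<in> c"
  hence "- K g \<star> g = g - P g"
    by (simp add: hmult_symp K_eq P_id symp_simps central_simps)
  thus ?thesis using P_diff by simp
qed

lemma K_mult: assumes "w \<in> c" "a \<in> h" shows "K (w \<star> a) = w"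
  using center
proof
  assume z: "\<forall>t. central t \<in> h"
  thus ?thesis using assms by (simp add: hmult_symp K_eq P_0 P_id P_simps)
next
  assume z: "\<forall>t. central t \<in> c"
  thus ?thesis using assms by (simp add: hmult_symp K_eq P_0 P_id P_simps symp_simps)
qed

lemma K_id: "w \<in> c \<Longrightarrow> K w = w"
  using K_mult[of w 0] subspace_0[OF subspace_h] by simp

lemma K_decomp: obtains a where "a \<in> h" "g = K g \<star> a"
  using K_cofactor[of g] hmult_minus_cancel(2)[of "K g" g] by metis

lemma K_mult_h: assumes "a \<in> h" shows "K (g \<star> a) = K g"
proof -
  obtain b where b: "b \<in> h" "g = K g \<star> b" by (rule K_decomp)
  have "K (K g \<star> (b \<star> a)) = K g" using K_in b(1) assms by (intro K_mult h_mult)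
  moreover have "g \<star> a = K g \<star> (b \<star> a)" using b(2) hmult_assoc[of "K g" b a] by simp
  ultimately show ?thesis by simp
qed

lemma K_K_mult: "K (l \<star> K g) = K (l \<star> g)"
proof -
  obtain a where "a \<in> h" "g = K g \<star> a" by (rule K_decomp)
  thus ?thesis using K_mult_h[of a "l \<star> K g"] by (metis hmult_assoc)
qed

lemma lcoset_eq_iff: "lcoset h g = lcoset h g' \<longleftrightarrow> K g = K g'"
proof
  assume "lcoset h g = lcoset h g'"
  moreover have "g \<in> lcoset h g" using subspace_0[OF subspace_h] by (auto simp: lcoset_def image_iff intro!: bexI[of _ 0])
  ultimately obtain a where "a \<in> h" "g = g' \<star> a" by (auto simp: lcoset_def)
  thus "K g = K g'" by (simp add: K_mult_h)
next
  assume e: "K g = K g'"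
  have "lcoset h x = lcoset h (K x)" for x
  proof -
    obtain a where a: "a \<in> h" "x = K x \<star> a" by (rule K_decomp)
    have "x \<star> b \<in> lcoset h (K x)" if "b \<in> h" for b
      using a that h_mult[of a b] hmult_assoc[of "K x" a b] by (auto simp: lcoset_def)
    moreover have "K x \<star> b \<in> lcoset h x" if "b \<in> h" for b
    proof -
      have "K x \<star> b = x \<star> (- a \<star> b)" using a(2) hmult_assoc[of "K x" a "- a \<star> b"] by simp
      thus ?thesis using a(1) that h_mult[of "- a" b] h_minus[of a] by (auto simp: lcoset_def)
    qed
    ultimately show ?thesis by (auto simp: lcoset_def)
  qed
  thus "lcoset h g = lcoset h g'" using e by metis
qed

lemma lcoset_K [simp]: "lcoset h (K g) = lcoset h g"
  by (simp add: lcoset_eq_iff K_id K_in)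

lemma mem_lcoset: "g \<in> lcoset h g' \<longleftrightarrow> K g = K g'"
proof
  assume "g \<in> lcoset h g'"
  thus "K g = K g'" by (auto simp: lcoset_def K_mult_h)
next
  assume "K g = K g'"
  hence "lcoset h g' = lcoset h g" by (simp add: lcoset_eq_iff)
  moreover have "g \<in> lcoset h g" using subspace_0[OF subspace_h] by (auto simp: lcoset_def image_iff intro!: bexI[of _ 0])
  ultimately show "g \<in> lcoset h g'" by simp
qed

lemma act_lcoset: "act l (lcoset h g) = lcoset h (l \<star> g)"
  by (auto simp: act_def lcoset_def image_image hmult_assoc)

definition KC :: "('a, 'n) heis set \<Rightarrow> ('a, 'n) heis" where
  "KC C = K (SOME g. g \<in> C)"

lemma KC_lcoset [simp]: "KC (lcoset h g) = K g"
proof -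
  have "(SOME x. x \<in> lcoset h g) \<in> lcoset h g"
    by (rule someI[of _ g]) (simp add: mem_lcoset)
  thus ?thesis by (simp add: KC_def mem_lcoset)
qed

lemma lcoset_KC: "C \<in> lcosets h \<Longrightarrow> lcoset h (KC C) = C"
  by (auto simp: lcosets_def)

lemma smooth_on_K: "smooth_on K UNIV"
proof -
  have "smooth_on (\<lambda>g. P (g + (- 1/2) *\<^sub>R hbracket (P g) g)) UNIV"
    by (intro smooth_on_linear[OF P_linear] smooth_on_add smooth_on_id
        smooth_on_linear[OF bounded_linear_scaleR_right] smooth_on_bilinear[OF bounded_bilinear_hbracket])
  thus ?thesis by (simp add: K_def[abs_def])
qed

lemma isCont_K: "continuous_on UNIV K"
  by (rule smooth_on_continuous[OF smooth_on_K])

lemma Union_lcosets_vimage: "\<Union>{C \<in> lcosets h. Q (KC C)} = {g. Q (K g)}"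
proof -
  have mem: "g \<in> lcoset h g" for g by (simp add: mem_lcoset)
  have "g \<in> \<Union>{C \<in> lcosets h. Q (KC C)} \<longleftrightarrow> Q (K g)" for g
  proof
    assume "g \<in> \<Union>{C \<in> lcosets h. Q (KC C)}"
    then obtain C where C: "C \<in> lcosets h" "Q (KC C)" "g \<in> C" by blast
    from C(1) obtain g' where "C = lcoset h g'" unfolding lcosets_def by (rule imageE)
    thus "Q (K g)" using C(2,3) by (simp add: mem_lcoset)
  next
    assume "Q (K g)"
    hence "lcoset h g \<in> {C \<in> lcosets h. Q (KC C)}" by (simp add: lcosets_def)
    thus "g \<in> \<Union>{C \<in> lcosets h. Q (KC C)}" using mem by blast
  qed
  thus ?thesis by blast
qed

text \<open>The product \<open>l \<star> w\<close> of two elements of \<open>c\<close> differs from \<open>l + w\<close> by half their bracket, which is either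
  absorbed by \<open>h\<close> or zero.\<close>

lemma K_translate:
  assumes "(\<forall>t. central t \<in> h) \<or> (\<forall>u\<in>c. \<forall>v\<in>c. symp u v = 0)" "l \<in> c"
  shows "K (l \<star> g) = l + K g"
proof -
  obtain t where t: "l \<star> K g = (l + K g) \<star> central t" "central t \<in> h"
  proof (cases "\<forall>t. central t \<in> h")
    case True
    have "l \<star> K g = (l + K g) \<star> central ((1/2) *\<^sub>R symp l (K g))" by (simp add: hmult_central hmult_symp[of l])
    thus ?thesis using True that by blast
  next
    case False
    hence "symp l (K g) = 0" using assms K_in by blast
    hence "l \<star> K g = (l + K g) \<star> central 0" by (simp add: hmult_symp central_simps)
    thus ?thesis using that[of 0] subspace_0[OF subspace_h] by (simp add: central_simps)
  qed
  have "K (l \<star> g) = K ((l + K g) \<star> central t)" using K_K_mult[of l g] t(1) by simp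
  also have "\<dots> = l + K g" using t(2) assms(2) K_in subspace_add[OF subspace_c] by (intro K_mult) auto
  finally show ?thesis .
qed

end

text \<open>The projection onto \<open>c\<close> along \<open>h\<close>.\<close>

lemma splitting_exists:
  fixes h c :: "(real, 'n::finite) heis set"
  assumes h: "lie_subalgebra h" and c: "subspace c" and int: "h \<inter> c = {0}" and sum: "\<And>u. \<exists>a\<in>h. \<exists>w\<in>c. u = a + w"
    and center: "central 1 \<in> h \<or> central 1 \<in> c"
  obtains P where "splitting h c P"
proof -
  have sh: "subspace h" using h by (simp add: lie_subalgebra_def)
  have uniq: "w = w'" if "w \<in> c" "w' \<in> c" "u - w \<in> h" "u - w' \<in> h" for u w w'
  proof -
    have "(u - w) - (u - w') \<in> h" "w' - w \<in> c"
      using subspace_diff[OF sh that(3,4)] subspace_diff[OF c that(2,1)] by simp_all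
    moreover have "(u - w) - (u - w') = w' - w" by simp
    ultimately have "w' - w \<in> h \<inter> c" by simp
    thus ?thesis using int by simp
  qed
  have "\<exists>w. w \<in> c \<and> u - w \<in> h" for u
  proof -
    obtain a w where "a \<in> h" "w \<in> c" "u = a + w" using sum by blast
    thus ?thesis by (intro exI[of _ w]) simp
  qed
  then obtain P where P: "\<And>u. P u \<in> c \<and> u - P u \<in> h" by metis
  have Pu: "P u = w" if "w \<in> c" "u - w \<in> h" for u w using uniq P that by blast
  have "linear P"
  proof (rule linearI)
    fix u v :: "(real, 'n) heis" and r :: real
    show "P (u + v) = P u + P v"
    proof (rule Pu)
      have "u + v - (P u + P v) = (u - P u) + (v - P v)" by simp
      thus "u + v - (P u + P v) \<in> h" using P sh by (metis subspace_add)
    qed (use P in \<open>simp add: subspace_add[OF c]\<close>)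
    show "P (r *\<^sub>R u) = r *\<^sub>R P u"
    proof (rule Pu)
      have "r *\<^sub>R u - r *\<^sub>R P u = r *\<^sub>R (u - P u)" by (simp add: scaleR_diff_right)
      thus "r *\<^sub>R u - r *\<^sub>R P u \<in> h" using P sh by (metis subspace_scale)
    qed (use P in \<open>simp add: subspace_scale[OF c]\<close>)
  qed
  have sc: "central t = t *\<^sub>R central 1" for t :: real by (simp add: central_simps)
  have "splitting h c P"
  proof (rule splitting.intro)
    show "bounded_linear P" using \<open>linear P\<close> by (simp add: linear_conv_bounded_linear)
    show "P v = v" if "v \<in> c" for v by (rule Pu) (use that sh subspace_0 in auto)
    show "P a = 0" if "a \<in> h" for a by (rule Pu) (use that c subspace_0 in auto)
    show "central (symp a b) \<in> h" if "a \<in> h" "b \<in> h" for a b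
      using h that by (auto simp: lie_subalgebra_def hbracket_symp)
    show "(\<forall>t. central t \<in> h) \<or> (\<forall>t. central t \<in> c)"
      using center sh c subspace_scale sc by metis
  qed (use P sh c in auto)
  thus ?thesis by (rule that)
qed

lemma dim_complement:
  fixes h c :: "(real, 'n::finite) heis set"
  assumes "splitting h c P"
  shows "dim c = DIM((real, 'n) heis) - dim h"
proof -
  interpret splitting h c P by (rule assms)
  have "h \<inter> c = {0}" using P_id P_0 subspace_0[OF subspace_h] subspace_0[OF subspace_c]
    by (intro equalityI subsetI) (metis IntD1 IntD2 singletonI, simp)
  moreover have "{x + y |x y. x \<in> h \<and> y \<in> c} = UNIV"
  proof -
    have "u \<in> {x + y |x y. x \<in> h \<and> y \<in> c}" for u
      using P_in[of u] P_diff[of u] by (intro CollectI exI[of _ "u - P u"] exI[of _ "P u"]) simp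
    thus ?thesis by blast
  qed
  ultimately show ?thesis using dim_sums_Int[OF subspace_h subspace_c] by simp
qed


section \<open>Co-exponential bases\<close>

lemma foldl_hmult: "foldl (\<star>) a xs = a \<star> foldl (\<star>) 0 xs"
proof (induction xs arbitrary: a)
  case (Cons x xs)
  show ?case using Cons[of "a \<star> x"] Cons[of x] by (simp add: hmult_assoc)
qed simp

text \<open>To first order at the origin, a product of exponentials is the sum of its factors.\<close>

lemma foldl_hmult_scale:
  fixes xs :: "(real, 'n::finite) heis list"
  shows "\<exists>t. \<forall>s. foldl (\<star>) (s *\<^sub>R a) (map ((*\<^sub>R) s) xs) = s *\<^sub>R (a + sum_list xs) + central (s\<^sup>2 * t)"
proof (induction xs rule: rev_induct)
  case Nil
  show ?case by (rule exI[of _ 0]) (simp add: central_simps)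
next
  case (snoc x xs)
  then obtain t where t: "\<And>s. foldl (\<star>) (s *\<^sub>R a) (map ((*\<^sub>R) s) xs) = s *\<^sub>R (a + sum_list xs) + central (s\<^sup>2 * t)"
    by blast
  show ?case
  proof (intro exI[of _ "t + (1/2) * symp (a + sum_list xs) x"] allI)
    fix s :: real
    have "foldl (\<star>) (s *\<^sub>R a) (map ((*\<^sub>R) s) (xs @ [x])) = (s *\<^sub>R (a + sum_list xs) + central (s\<^sup>2 * t)) \<star> (s *\<^sub>R x)"
      by (simp add: t)
    also have "\<dots> = s *\<^sub>R (a + sum_list xs) + s *\<^sub>R x + (central (s\<^sup>2 * t) + central (s\<^sup>2 * ((1/2) * symp (a + sum_list xs) x)))"
      by (simp add: hmult_symp symp_simps power2_eq_square algebra_simps)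
    also have "\<dots> = s *\<^sub>R (a + sum_list (xs @ [x])) + central (s\<^sup>2 * (t + (1/2) * symp (a + sum_list xs) x))"
      by (simp add: scaleR_add_right distrib_left flip: central_simps(1))
    finally show "foldl (\<star>) (s *\<^sub>R a) (map ((*\<^sub>R) s) (xs @ [x]))
      = s *\<^sub>R (a + sum_list (xs @ [x])) + central (s\<^sup>2 * (t + (1/2) * symp (a + sum_list xs) x))" .
  qed
qed

lemma foldl_hmult_commuting:
  assumes "\<And>x y. x \<in> set xs \<Longrightarrow> y \<in> set xs \<Longrightarrow> symp x y = 0"
  shows "foldl (\<star>) 0 xs = sum_list xs"
  using assms
proof (induction xs rule: rev_induct)
  case (snoc x xs)
  have "symp (sum_list ys) x = 0" if "set ys \<subseteq> set xs" for ys
    using that snoc.prems by (induction ys) (auto simp: symp_simps)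
  thus ?case using snoc by (simp add: hmult_symp central_simps)
qed simp

lemma smooth_on_foldl_hmult:
  "(\<And>f. f \<in> set fs \<Longrightarrow> smooth_on f UNIV) \<Longrightarrow> smooth_on (\<lambda>g. foldl (\<star>) 0 (map (\<lambda>f. f g) fs)) UNIV"
  by (induction fs rule: rev_induct) (auto intro!: smooth_on_const smooth_on_hmult)

lemma sum_list_map2_scaleR:
  assumes "length w = length W"
  shows "sum_list (map2 (*\<^sub>R) w W) = (\<Sum>i<length W. w ! i *\<^sub>R W ! i)"
  using assms by (simp add: sum_list_sum_nth atLeast0LessThan)

lemma orthonormal_list_exists:
  fixes c :: "'a::euclidean_space set"
  assumes subspace_c: "subspace c"
  shows "\<exists>W. length W = dim c \<and> set W \<subseteq> c \<and> span (set W) = c \<and>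
    (\<forall>i<length W. \<forall>j<length W. W ! i \<bullet> W ! j = (if i = j then 1 else 0)) \<and>
    (\<forall>v\<in>c. (\<Sum>i<length W. (v \<bullet> W ! i) *\<^sub>R W ! i) = v)"
proof -
  obtain B where B: "B \<subseteq> c" "pairwise orthogonal B" "\<And>x. x \<in> B \<Longrightarrow> norm x = 1" "independent B"
    "card B = dim c" "span B = c"
    using orthonormal_basis_subspace[OF subspace_c] by blast
  have "finite B" using B(4) independent_imp_finite by blast
  then obtain W where W: "set W = B" "distinct W" using finite_distinct_list by blast
  hence len: "length W = dim c" using B(5) distinct_card by fastforce
  define d where "d = length W"
  have on: "W ! i \<bullet> W ! j = (if i = j then 1 else 0)" if "i < d" "j < d" for i j
  proof (cases "i = j")
    case True
    thus ?thesis using B(3)[of "W ! j"] that W(1) by (auto simp: d_def norm_eq_1)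
  next
    case False
    hence "W ! i \<noteq> W ! j" using W(2) that by (simp add: d_def nth_eq_iff_index_eq)
    moreover have "W ! i \<in> B" "W ! j \<in> B" using W(1) that by (auto simp: d_def)
    ultimately show ?thesis using B(2) False by (auto simp: pairwise_def orthogonal_def)
  qed
  have coord: "(\<Sum>i<d. (v \<bullet> W ! i) *\<^sub>R W ! i) = v" if "v \<in> c" for v
  proof -
    have "v \<in> span B" using that B(6) by simp
    thus ?thesis
    proof (induction rule: span_induct_alt)
      case (step r x y)
      obtain j where j: "j < d" "x = W ! j" using step(1) W(1) by (auto simp: d_def in_set_conv_nth)
      have "(\<Sum>i<d. (x \<bullet> W ! i) *\<^sub>R W ! i) = (\<Sum>i<d. if i = j then W ! i else 0)"
        using j on by (intro sum.cong) auto
      hence "(\<Sum>i<d. (x \<bullet> W ! i) *\<^sub>R W ! i) = x" using j by simp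
      moreover have "(\<Sum>i<d. (r * (x \<bullet> W ! i)) *\<^sub>R W ! i) = r *\<^sub>R (\<Sum>i<d. (x \<bullet> W ! i) *\<^sub>R W ! i)"
        by (simp add: scaleR_sum_right)
      ultimately have "(\<Sum>i<d. (r * (x \<bullet> W ! i)) *\<^sub>R W ! i) = r *\<^sub>R x" by simp
      thus ?case using step(2) by (simp add: inner_add_left scaleR_add_left sum.distrib)
    qed simp
  qed
  have "set W \<subseteq> c" "span (set W) = c" using W(1) B(1,6) by simp_all
  thus ?thesis using len on coord unfolding d_def by blast
qed

text \<open>For an orthonormal basis \<open>W\<close> of \<open>c\<close>, the product of the exponentials of \<open>w\<^sub>i W\<^sub>i\<close> is \<open>\<Sum> w\<^sub>i W\<^sub>i\<close> up to a
  central element of \<open>h\<close>, so \<open>w\<close> is recovered as the coordinates of the factor in \<open>c\<close>. In co-exponential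
  coordinates that factor stands on the right; inversion carries it to the left factor \<open>K\<close>.\<close>

context
  fixes h c :: "(real, 'n::finite) heis set" and P
  assumes split: "splitting h c P"
begin

interpretation splitting h c P by (rule split)

lemma coexponential_basis_exists:
  assumes "(\<forall>t. central t \<in> h) \<or> (\<forall>u\<in>c. \<forall>v\<in>c. symp u v = 0)"
  obtains W where "length W = dim c" "span (set W) = c" "coexponential_basis h W"
proof -
  obtain W where len: "length W = dim c" and Wc: "set W \<subseteq> c" and spanW: "span (set W) = c"
    and "\<forall>i<length W. \<forall>j<length W. W ! i \<bullet> W ! j = (if i = j then 1 else 0)"
    and "\<forall>v\<in>c. (\<Sum>i<length W. (v \<bullet> W ! i) *\<^sub>R W ! i) = v"
    using orthonormal_list_exists[OF subspace_c] by blast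
  define d where "d = length W"
  have on: "W ! i \<bullet> W ! j = (if i = j then 1 else 0)" if "i < d" "j < d" for i j
    using \<open>\<forall>i<length W. _\<close> that by (simp add: d_def)
  have coord: "(\<Sum>i<d. (v \<bullet> W ! i) *\<^sub>R W ! i) = v" if "v \<in> c" for v
    using \<open>\<forall>v\<in>c. _ = v\<close> that by (simp add: d_def)
  have coord': "(\<Sum>i<d. w i *\<^sub>R W ! i) \<bullet> W ! j = w j" if "j < d" for w j
  proof -
    have "(\<Sum>i<d. w i *\<^sub>R W ! i) \<bullet> W ! j = (\<Sum>i<d. if i = j then w i else 0)"
      unfolding inner_sum_left using that on by (intro sum.cong) auto
    thus ?thesis using that by simp
  qed
  have sum_c: "(\<Sum>i<d. w i *\<^sub>R W ! i) \<in> c" for w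
    using Wc by (intro subspace_sum[OF subspace_c] subspace_scale[OF subspace_c]) (auto simp: d_def)
  define L where "L g = - K (- g)" for g
  have L_in: "L g \<in> c" for g using K_in subspace_neg[OF subspace_c] by (simp add: L_def)
  have L_mult: "L (a \<star> w) = w" if "a \<in> h" "w \<in> c" for a w
    using that by (simp add: L_def minus_hmult K_mult h_minus subspace_neg[OF subspace_c])
  have L_h: "g \<star> (- L g) \<in> h" for g
    using h_minus[OF K_cofactor[of "- g"]] by (simp add: L_def minus_hmult)
  have L_smooth: "smooth_on L UNIV"
  proof -
    have "K (- g) = P (- g + (- 1/2) *\<^sub>R hbracket (P (- g)) (- g))" for g by (simp add: K_def)
    hence e: "L = (\<lambda>g. - P (- g + (- 1/2) *\<^sub>R hbracket (P (- g)) (- g)))" by (auto simp: L_def)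
    have m: "bounded_linear (uminus :: (real, 'n) heis \<Rightarrow> _)" by (rule bounded_linear_minus[OF bounded_linear_ident])
    show ?thesis unfolding e
      by (intro smooth_on_linear[OF m] smooth_on_linear[OF P_linear] smooth_on_add smooth_on_id
        smooth_on_linear[OF bounded_linear_scaleR_right] smooth_on_bilinear[OF bounded_bilinear_hbracket])
  qed
  define \<omega> where "\<omega> g = map (\<lambda>i. L g \<bullet> W ! i) [0..<d]" for g
  define E where "E w = coexp_map W 0 w" for w
  define \<eta> where "\<eta> g = g \<star> (- E (\<omega> g))" for g
  have coexp: "coexp_map W a w = a \<star> E w" for a w
    unfolding coexp_map_def E_def by (rule foldl_hmult)
  have E: "\<exists>t. E w = (\<Sum>i<d. w ! i *\<^sub>R W ! i) + central t \<and> central t \<in> h" if "length w = d" for w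
    using assms
  proof
    assume z: "\<forall>t. central t \<in> h"
    obtain t where "\<forall>s. foldl (\<star>) (s *\<^sub>R 0) (map ((*\<^sub>R) s) (map2 (*\<^sub>R) w W))
        = s *\<^sub>R (0 + sum_list (map2 (*\<^sub>R) w W)) + central (s\<^sup>2 * t)"
      using foldl_hmult_scale[of 0 "map2 (*\<^sub>R) w W"] by blast
    from this[THEN spec, of 1] show ?thesis using that z
      by (auto simp: E_def coexp_map_def sum_list_map2_scaleR d_def cong: map_cong)
  next
    assume ab: "\<forall>u\<in>c. \<forall>v\<in>c. symp u v = 0"
    have "foldl (\<star>) 0 (map2 (*\<^sub>R) w W) = sum_list (map2 (*\<^sub>R) w W)"
    proof (rule foldl_hmult_commuting)
      have "x \<in> c" if "x \<in> set (map2 (*\<^sub>R) w W)" for x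
        using that Wc by (auto intro!: subspace_scale[OF subspace_c] dest: set_zip_rightD)
      thus "symp x y = 0" if "x \<in> set (map2 (*\<^sub>R) w W)" "y \<in> set (map2 (*\<^sub>R) w W)" for x y
        using that ab by blast
    qed
    thus ?thesis using that subspace_0[OF subspace_h]
      by (intro exI[of _ 0]) (simp add: E_def coexp_map_def sum_list_map2_scaleR d_def central_simps)
  qed
  have \<omega>_smooth: "smooth_on (\<lambda>g. \<omega> g ! i) UNIV" if "i < d" for i
  proof -
    have "bounded_linear (\<lambda>v. v \<bullet> W ! i)" by (rule bounded_linear_inner_left)
    from smooth_on_linear[OF this L_smooth] show ?thesis using that by (simp add: \<omega>_def)
  qed
  have "coexponential_basis h W"
    unfolding coexponential_basis_def
  proof (intro exI conjI allI impI ballI)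
    have "smooth_on (\<lambda>g. E (\<omega> g)) UNIV"
    proof -
      define fs where "fs = map (\<lambda>i g. (\<omega> g ! i) *\<^sub>R W ! i) [0..<d]"
      have "map2 (*\<^sub>R) (\<omega> g) W = map (\<lambda>f. f g) fs" for g
        by (rule nth_equalityI) (simp_all add: fs_def \<omega>_def d_def)
      moreover have "smooth_on (\<lambda>g. foldl (\<star>) 0 (map (\<lambda>f. f g) fs)) UNIV"
        by (rule smooth_on_foldl_hmult)
          (auto simp: fs_def intro!: smooth_on_linear[OF bounded_linear_scaleR_left] \<omega>_smooth)
      ultimately show ?thesis by (simp add: E_def coexp_map_def)
    qed
    moreover have m: "bounded_linear (uminus :: (real, 'n) heis \<Rightarrow> _)" by (rule bounded_linear_minus[OF bounded_linear_ident])
    ultimately show "smooth_on \<eta> UNIV" unfolding \<eta>_def[abs_def]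
      by (intro smooth_on_hmult smooth_on_id smooth_on_linear[OF m])
    show "smooth_on (\<lambda>g. \<omega> g ! i) UNIV" if "i < length W" for i using that \<omega>_smooth by (simp add: d_def)
  next
    fix g
    show "length (\<omega> g) = length W" by (simp add: \<omega>_def d_def)
    then obtain t where t: "E (\<omega> g) = (\<Sum>i<d. \<omega> g ! i *\<^sub>R W ! i) + central t" "central t \<in> h"
      using E by (auto simp: d_def)
    have "(\<Sum>i<d. \<omega> g ! i *\<^sub>R W ! i) = L g" using coord[OF L_in] by (simp add: \<omega>_def)
    hence "- E (\<omega> g) = (- L g) \<star> central (- t)" using t unfolding hmult_central by (simp add: central_simps)
    hence "\<eta> g = (g \<star> (- L g)) \<star> central (- t)" by (simp add: \<eta>_def hmult_assoc)
    moreover have "central (- t) \<in> h" using h_minus[OF t(2)] by (simp add: central_simps)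
    ultimately show "\<eta> g \<in> h" using h_mult[OF L_h] by simp
    show "coexp_map W (\<eta> g) (\<omega> g) = g" by (simp add: coexp \<eta>_def hmult_assoc)
  next
    fix a and w :: "real list" assume a: "a \<in> h" and w: "length w = length W"
    obtain t where t: "E w = (\<Sum>i<d. w ! i *\<^sub>R W ! i) + central t" "central t \<in> h"
      using E w by (auto simp: d_def)
    have "a \<star> E w = (a \<star> central t) \<star> (\<Sum>i<d. w ! i *\<^sub>R W ! i)"
      unfolding t(1) hmult_assoc hmult_central(2) ..
    hence L: "L (a \<star> E w) = (\<Sum>i<d. w ! i *\<^sub>R W ! i)" using h_mult[OF a t(2)] sum_c by (simp add: L_mult)
    have \<omega>: "\<omega> (a \<star> E w) = w"
    proof (rule nth_equalityI)
      show "length (\<omega> (a \<star> E w)) = length w" by (simp add: \<omega>_def w d_def)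
      fix i assume "i < length (\<omega> (a \<star> E w))"
      hence "i < d" by (simp add: \<omega>_def)
      thus "\<omega> (a \<star> E w) ! i = w ! i" by (simp add: \<omega>_def L coord')
    qed
    thus "\<omega> (coexp_map W a w) = w" by (simp add: coexp)
    show "\<eta> (coexp_map W a w) = a" by (simp add: coexp \<eta>_def \<omega> hmult_assoc)
  qed
  thus ?thesis using that len spanW by blast
qed

end

text \<open>The chain rule: a differentiable map takes the curve \<open>s\<^sup>2 t\<close>, which is at rest at the origin, to a curve at rest.\<close>

lemma no_square_root_speed:
  fixes f :: "(real, 'n::finite) heis \<Rightarrow> 'b::real_normed_vector"
  assumes "f differentiable (at 0)" "\<And>s. f (central (s\<^sup>2 * t)) = s *\<^sub>R a"
  shows "a = 0"
proof -
  have lin: "bounded_linear (\<lambda>r :: real. r *\<^sub>R (central t :: (real, 'n) heis))" by (rule bounded_linear_scaleR_left)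
  have sq: "((\<lambda>s :: real. s\<^sup>2) has_derivative (\<lambda>v. 0)) (at 0)"
    by (auto intro!: derivative_eq_intros)
  have "((\<lambda>s :: real. s\<^sup>2 *\<^sub>R (central t :: (real, 'n) heis)) has_derivative (\<lambda>v. 0)) (at 0)"
    using bounded_linear.has_derivative[OF lin sq] by simp
  moreover have "(f has_derivative frechet_derivative f (at 0)) (at ((0::real)\<^sup>2 *\<^sub>R (central t :: (real, 'n) heis)))"
    using assms(1) by (simp add: frechet_derivative_works)
  ultimately have "((\<lambda>s. f (s\<^sup>2 *\<^sub>R central t)) has_derivative (\<lambda>v. frechet_derivative f (at 0) 0)) (at (0 :: real))"
    by (rule has_derivative_compose)
  moreover have "frechet_derivative f (at 0) 0 = 0"
    using assms(1) by (simp add: linear_0 linear_frechet_derivative)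
  ultimately have 1: "((\<lambda>s. s *\<^sub>R a) has_derivative (\<lambda>v. 0)) (at (0 :: real))"
    using assms(2) by (simp add: central_simps)
  have 2: "((\<lambda>s. s *\<^sub>R a) has_derivative (\<lambda>v. v *\<^sub>R a)) (at (0 :: real))"
    by (auto intro!: derivative_eq_intros)
  have "(\<lambda>v. v *\<^sub>R a) = (\<lambda>v :: real. 0)" by (rule has_derivative_unique[OF 2 1])
  from fun_cong[OF this, of 1] show ?thesis by simp
qed

text \<open>The differential at the origin of the co-exponential parametrization is
  \<open>(a, w) \<mapsto> a + \<Sum> w\<^sub>i W\<^sub>i\<close>; as the inverse is differentiable, it is injective.\<close>

lemma coexponential_basis_complement:
  fixes h :: "(real, 'n::finite) heis set"
  assumes h: "subspace h" and W: "coexponential_basis h W" and len: "length W = DIM((real, 'n) heis) - dim h"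
  shows "h \<inter> span (set W) = {0}" "\<exists>a\<in>h. \<exists>w\<in>span (set W). u = a + w" "dim (span (set W)) = length W"
proof -
  obtain \<eta> \<omega> where \<eta>: "smooth_on \<eta> UNIV" and \<omega>: "\<And>i. i < length W \<Longrightarrow> smooth_on (\<lambda>g. \<omega> g ! i) UNIV"
    and inv: "\<And>a w. a \<in> h \<Longrightarrow> length w = length W \<Longrightarrow> \<eta> (coexp_map W a w) = a \<and> \<omega> (coexp_map W a w) = w"
    using W unfolding coexponential_basis_def by blast
  have inj: "a = 0 \<and> (\<forall>i<length W. w ! i = 0)"
    if a: "a \<in> h" and w: "length w = length W" and z: "a + (\<Sum>i<length W. w ! i *\<^sub>R W ! i) = 0" for a w
  proof -
    obtain t where t: "\<forall>s. foldl (\<star>) (s *\<^sub>R a) (map ((*\<^sub>R) s) (map2 (*\<^sub>R) w W))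
        = s *\<^sub>R (a + sum_list (map2 (*\<^sub>R) w W)) + central (s\<^sup>2 * t)"
      using foldl_hmult_scale[of a "map2 (*\<^sub>R) w W"] by blast
    have "map2 (*\<^sub>R) (map ((*) s) w) W = map ((*\<^sub>R) s) (map2 (*\<^sub>R) w W)" for s
      using w by (intro nth_equalityI) auto
    hence e: "coexp_map W (s *\<^sub>R a) (map ((*) s) w) = central (s\<^sup>2 * t)" for s
      using t[THEN spec, of s] z w by (simp add: coexp_map_def sum_list_map2_scaleR)
    have i: "\<eta> (central (s\<^sup>2 * t)) = s *\<^sub>R a" "\<omega> (central (s\<^sup>2 * t)) = map ((*) s) w" for s
      using inv[of "s *\<^sub>R a" "map ((*) s) w"] a w h by (simp_all add: e subspace_scale)
    have "a = 0" by (rule no_square_root_speed[OF smooth_on_differentiable[OF \<eta>] i(1)])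
    moreover have "w ! j = 0" if "j < length W" for j
      by (rule no_square_root_speed[OF smooth_on_differentiable[OF \<omega>[OF that]], of t])
        (use that w in \<open>simp add: i(2)\<close>)
    ultimately show ?thesis by blast
  qed
  have dist: "distinct W"
    unfolding distinct_conv_nth
  proof (intro allI impI)
    fix i j assume ij: "i < length W" "j < length W" "i \<noteq> j"
    show "W ! i \<noteq> W ! j"
    proof
      assume e: "W ! i = W ! j"
      define w where "w = map (\<lambda>k. if k = i then 1 else if k = j then -1 else 0 :: real) [0..<length W]"
      have "(\<Sum>k<length W. w ! k *\<^sub>R W ! k) = (\<Sum>k<length W. (if k = i then W ! k else 0) + (if k = j then - W ! k else 0))"
        using ij by (intro sum.cong) (auto simp: w_def)
      also have "\<dots> = 0" using ij e by (simp add: sum.distrib)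
      finally have "\<forall>k<length W. w ! k = 0" using inj[of 0 w] subspace_0[OF h] by (simp add: w_def)
      hence "w ! i = 0" using ij(1) by blast
      thus False using ij by (simp add: w_def)
    qed
  qed
  have sum_u: "(\<Sum>v\<in>set W. u v *\<^sub>R v) = (\<Sum>i<length W. map u W ! i *\<^sub>R W ! i)" for u
  proof -
    have "(\<Sum>v\<in>set W. u v *\<^sub>R v) = sum_list (map (\<lambda>v. u v *\<^sub>R v) W)"
      using dist by (simp add: sum_list_distinct_conv_sum_set)
    thus ?thesis by (simp add: sum_list_sum_nth atLeast0LessThan)
  qed
  have ind: "independent (set W)"
  proof
    assume "dependent (set W)"
    then obtain u v where u: "v \<in> set W" "u v \<noteq> 0" "(\<Sum>v\<in>set W. u v *\<^sub>R v) = 0"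
      by (auto simp: dependent_finite)
    obtain i where "i < length W" "v = W ! i" using u(1) by (auto simp: in_set_conv_nth)
    moreover have "\<forall>i<length W. map u W ! i = 0" using inj[of 0 "map u W"] u(3) h sum_u[of u] by (simp add: subspace_0)
    ultimately show False using u(2) by simp
  qed
  show dq: "dim (span (set W)) = length W"
    using ind dist by (simp add: dim_span dim_eq_card_independent distinct_card)
  show int: "h \<inter> span (set W) = {0}"
  proof (intro equalityI subsetI)
    fix v assume v: "v \<in> h \<inter> span (set W)"
    then obtain u where "v = (\<Sum>v\<in>set W. u v *\<^sub>R v)" by (auto simp: span_finite)
    hence "- v + (\<Sum>i<length W. map u W ! i *\<^sub>R W ! i) = 0" by (simp add: sum_u)
    hence "- v = 0" using inj[of "- v" "map u W"] v h by (simp add: subspace_neg)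
    thus "v \<in> {0}" by simp
  qed (use h in \<open>auto simp: subspace_0 span_zero\<close>)
  have "dim {x + y |x y. x \<in> h \<and> y \<in> span (set W)} + dim (h \<inter> span (set W)) = dim h + dim (span (set W))"
    using h by (intro dim_sums_Int) auto
  hence full: "dim {x + y |x y. x \<in> h \<and> y \<in> span (set W)} = DIM((real, 'n) heis)"
    using int dq len dim_subset_UNIV[of h] by simp
  have "span {x + y |x y. x \<in> h \<and> y \<in> span (set W)} = {x + y |x y. x \<in> h \<and> y \<in> span (set W)}"
    unfolding span_eq_iff using h by (intro subspace_sums) auto
  hence "{x + y |x y. x \<in> h \<and> y \<in> span (set W)} = UNIV" using full[unfolded dim_eq_full] by argo
  thus "\<exists>a\<in>h. \<exists>w\<in>span (set W). u = a + w" by blast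
qed

section \<open>Complexification\<close>

definition hre :: "(complex, 'n::finite) heis \<Rightarrow> (real, 'n) heis" where
  "hre g = (\<chi> i. Re (fst g $ i), \<chi> i. Re (fst (snd g) $ i), Re (snd (snd g)))"

definition him :: "(complex, 'n::finite) heis \<Rightarrow> (real, 'n) heis" where
  "him g = (\<chi> i. Im (fst g $ i), \<chi> i. Im (fst (snd g) $ i), Im (snd (snd g)))"

definition hcx :: "(real, 'n::finite) heis \<Rightarrow> (real, 'n) heis \<Rightarrow> (complex, 'n) heis" where
  "hcx u v = heis_of_real u + cscale \<i> (heis_of_real v)"

lemma hre_hcx [simp]: "hre (hcx u v) = u" and him_hcx [simp]: "him (hcx u v) = v"
  by (simp_all add: hre_def him_def hcx_def heis_of_real_def cscale_def vec_eq_iff prod_eq_iff case_prod_beta)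

lemma hcx_eta [simp]: "hcx (hre g) (him g) = g"
  by (simp add: hre_def him_def hcx_def heis_of_real_def cscale_def vec_eq_iff prod_eq_iff complex_eq_iff)

lemma heis_eqI: "hre g = hre g' \<Longrightarrow> him g = him g' \<Longrightarrow> g = g'"
  using hcx_eta by metis

lemma heis_of_real_hcx: "heis_of_real u = hcx u 0"
  by (rule heis_eqI) (simp_all add: hre_def him_def hcx_def heis_of_real_def cscale_def vec_eq_iff prod_eq_iff case_prod_beta)

lemma linear_hre: "linear hre" and linear_him: "linear him"
  by (rule linearI; simp add: hre_def him_def vec_eq_iff prod_eq_iff)+

lemmas hre_simps = linear_add[OF linear_hre] linear_diff[OF linear_hre] linear_cmul[OF linear_hre]
  linear_neg[OF linear_hre] linear_0[OF linear_hre]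
lemmas him_simps = linear_add[OF linear_him] linear_diff[OF linear_him] linear_cmul[OF linear_him]
  linear_neg[OF linear_him] linear_0[OF linear_him]

lemma bounded_linear_hre: "bounded_linear hre" and bounded_linear_him: "bounded_linear him"
  using linear_hre linear_him by (simp_all add: linear_conv_bounded_linear)

lemma hre_cscale [simp]: "hre (cscale \<i> g) = - him g" and him_cscale [simp]: "him (cscale \<i> g) = hre g"
  by (simp_all add: hre_def him_def cscale_def vec_eq_iff prod_eq_iff case_prod_beta)

lemma hre_central [simp]: "hre (central t) = central (Re t)" and him_central [simp]: "him (central t) = central (Im t)"
  by (simp_all add: hre_def him_def central_def vec_eq_iff prod_eq_iff)

lemma hre_of_real [simp]: "hre (heis_of_real u) = u" and him_of_real [simp]: "him (heis_of_real u) = 0"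
  by (simp_all add: heis_of_real_hcx)

lemma linear_hcx: "linear (\<lambda>p. hcx (fst p) (snd p))"
  by (intro linearI heis_eqI) (simp_all add: hre_simps him_simps)

lemma linear_heis_of_real: "linear heis_of_real"
  by (intro linearI heis_eqI) (simp_all add: hre_simps him_simps)

lemmas heis_of_real_simps = linear_add[OF linear_heis_of_real] linear_cmul[OF linear_heis_of_real] linear_0[OF linear_heis_of_real]

lemma mem_complexify: "g \<in> complexify h \<longleftrightarrow> hre g \<in> h \<and> him g \<in> h"
proof
  assume "g \<in> complexify h"
  then obtain u v where "u \<in> h" "v \<in> h" "g = hcx u v" unfolding complexify_def hcx_def by blast
  thus "hre g \<in> h \<and> him g \<in> h" by simp
next
  assume "hre g \<in> h \<and> him g \<in> h"
  moreover have "g = heis_of_real (hre g) + cscale \<i> (heis_of_real (him g))" using hcx_eta[of g] by (simp add: hcx_def)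
  ultimately show "g \<in> complexify h" unfolding complexify_def by blast
qed

lemma symp_complex:
  "symp g g' = Complex (symp (hre g) (hre g') - symp (him g) (him g')) (symp (hre g) (him g') + symp (him g) (hre g'))"
  by (rule complex_eqI) (simp_all add: symp_def hre_def him_def algebra_simps sum.distrib sum_subtractf)

lemma dim_complexify:
  fixes h :: "(real, 'n::finite) heis set"
  assumes "subspace h"
  shows "dim (complexify h) = 2 * dim h"
proof -
  have im: "complexify h = (\<lambda>p. hcx (fst p) (snd p)) ` (h \<times> h)"
  proof (intro equalityI subsetI)
    fix g assume "g \<in> complexify h"
    hence "(hre g, him g) \<in> h \<times> h" by (simp add: mem_complexify)
    thus "g \<in> (\<lambda>p. hcx (fst p) (snd p)) ` (h \<times> h)" by (rule rev_image_eqI) simp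
  next
    fix g assume "g \<in> (\<lambda>p. hcx (fst p) (snd p)) ` (h \<times> h)"
    then obtain p where "p \<in> h \<times> h" "g = hcx (fst p) (snd p)" by blast
    thus "g \<in> complexify h" by (simp add: mem_complexify mem_Times_iff)
  qed
  have "inj (\<lambda>p. hcx (fst p) (snd p) :: (complex, 'n) heis)"
  proof (rule injI)
    fix p p' :: "(real, 'n) heis \<times> (real, 'n) heis" assume e: "hcx (fst p) (snd p) = hcx (fst p') (snd p')"
    show "p = p'" using arg_cong[OF e, of hre] arg_cong[OF e, of him] by (simp add: prod_eq_iff)
  qed
  note inj = this
  have "dim (complexify h) = dim (h \<times> h)" unfolding im
    by (rule dim_image_eq[OF linear_hcx inj_on_subset[OF inj subset_UNIV]])
  also have "\<dots> = 2 * dim h" using dim_Times[OF assms assms] by simp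
  finally show ?thesis .
qed

lemma rdim_eq:
  fixes h :: "(real, 'n::finite) heis set"
  assumes "subspace h"
  shows "rdim h = 2 * (DIM((real, 'n) heis) - dim h)"
  by (simp add: rdim_def dim_complexify[OF assms])

definition cext :: "((real, 'n::finite) heis \<Rightarrow> (real, 'n) heis) \<Rightarrow> (complex, 'n) heis \<Rightarrow> (complex, 'n) heis" where
  "cext P g = hcx (P (hre g)) (P (him g))"

lemma hre_cext [simp]: "hre (cext P g) = P (hre g)" and him_cext [simp]: "him (cext P g) = P (him g)"
  by (simp_all add: cext_def)

lemma subspace_complexify: "subspace h \<Longrightarrow> subspace (complexify h)"
  by (auto simp: subspace_def mem_complexify hre_simps him_simps)

lemma splitting_complexify:
  fixes h c :: "(real, 'n::finite) heis set"
  assumes "splitting h c P"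
  shows "splitting (complexify h) (complexify c) (cext P)"
proof -
  interpret splitting h c P by (rule assms)
  show ?thesis
  proof (rule splitting.intro)
    have "linear (cext P)" by (intro linearI heis_eqI) (simp_all add: hre_simps him_simps P_simps)
    thus "bounded_linear (cext P)" by (simp add: linear_conv_bounded_linear)
    show "central (symp a b) \<in> complexify h" if "a \<in> complexify h" "b \<in> complexify h" for a b
    proof -
      have "central (symp (hre a) (hre b)) - central (symp (him a) (him b)) \<in> h"
        using that by (intro subspace_diff[OF subspace_h] h_bracket) (simp_all add: mem_complexify)
      moreover have "central (symp (hre a) (him b)) + central (symp (him a) (hre b)) \<in> h"
        using that by (intro subspace_add[OF subspace_h] h_bracket) (simp_all add: mem_complexify)
      ultimately show ?thesis by (simp add: mem_complexify symp_complex central_simps)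
    qed
    show "(\<forall>t. central t \<in> complexify h) \<or> (\<forall>t. central t \<in> complexify c)"
      using center by (auto simp: mem_complexify)
    show "cext P v = v" if "v \<in> complexify c" for v
      using that by (intro heis_eqI) (simp_all add: mem_complexify P_id)
    show "cext P a = 0" if "a \<in> complexify h" for a
      using that by (intro heis_eqI) (simp_all add: mem_complexify P_0 hre_simps him_simps)
  qed (simp_all add: subspace_complexify subspace_h subspace_c mem_complexify P_in P_diff hre_simps him_simps)
qed

lemma (in splitting) lcoset_mem_iff:
  assumes "V \<subseteq> lcosets h"
  shows "lcoset h x \<in> V \<longleftrightarrow> x \<in> \<Union>V"
proof
  assume "lcoset h x \<in> V"
  thus "x \<in> \<Union>V" using mem_lcoset[of x x] by blast
next
  assume "x \<in> \<Union>V"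
  then obtain C where C: "C \<in> V" "x \<in> C" by blast
  then obtain g where g: "C = lcoset h g" using assms by (auto simp only: lcosets_def)
  hence "lcoset h x = lcoset h g" using C(2) by (simp add: mem_lcoset lcoset_eq_iff)
  thus "lcoset h x \<in> V" using C g by simp
qed

lemma directional_derivative_unique:
  fixes f :: "'a::real_normed_vector \<Rightarrow> 'b::real_normed_vector"
  assumes "(f has_derivative f') (at x)" "\<forall>\<^sub>F s in nhds 0. f (x + s *\<^sub>R v) = f x + s *\<^sub>R a"
  shows "f' v = a"
proof -
  have 1: "((\<lambda>s :: real. x + s *\<^sub>R v) has_derivative (\<lambda>s. s *\<^sub>R v)) (at 0)"
    by (auto intro!: derivative_eq_intros)
  have "(f has_derivative f') (at (x + 0 *\<^sub>R v))" using assms(1) by simp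
  from has_derivative_compose[OF 1 this]
  have d: "((\<lambda>s. f (x + s *\<^sub>R v)) has_derivative (\<lambda>s. f' (s *\<^sub>R v))) (at 0)" .
  have 2: "((\<lambda>s. f x + s *\<^sub>R a) has_derivative (\<lambda>s. s *\<^sub>R a)) (at 0)"
    by (auto intro!: derivative_eq_intros)
  have "((\<lambda>s. f (x + s *\<^sub>R v)) has_derivative (\<lambda>s. s *\<^sub>R a)) (at 0)"
    using 2 by (rule has_derivative_transform_eventually)
      (use assms(2) in \<open>auto simp: eventually_at_filter eq_commute elim: eventually_mono\<close>)
  from has_derivative_unique[OF d this] have "(\<lambda>s. f' (s *\<^sub>R v)) = (\<lambda>s. s *\<^sub>R a)" .
  from fun_cong[OF this, of 1] show ?thesis by simp
qed


section \<open>Slices from orbits described by imaginary parts\<close>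

text \<open>The negative of complex conjugation: unlike conjugation itself, it fixes the imaginary points.\<close>

definition reflect :: "(complex, 'n::finite) heis \<Rightarrow> (complex, 'n) heis" where
  "reflect g = hcx (- hre g) (him g)"

lemma hre_reflect [simp]: "hre (reflect g) = - hre g" and him_reflect [simp]: "him (reflect g) = him g"
  by (simp_all add: reflect_def)

lemma reflect_cscale: "reflect (cscale \<i> g) = - cscale \<i> (reflect g)"
  by (rule heis_eqI) (simp_all add: hre_simps him_simps)

lemma bounded_linear_reflect: "bounded_linear reflect"
proof -
  have "linear reflect" by (intro linearI heis_eqI) (simp_all add: hre_simps him_simps)
  thus ?thesis by (simp add: linear_conv_bounded_linear)
qed

context
  fixes h c :: "(real, 'n::finite) heis set" and P
  assumes split: "splitting h c P"
begin

interpretation splitting h c P by (rule split)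
interpretation C: splitting "complexify h" "complexify c" "cext P" by (rule splitting_complexify[OF split])

lemma K_complex_derivative:
  "\<exists>D. (C.K has_derivative D) (at g) \<and> (\<forall>v. D (cscale \<i> v) = cscale \<i> (D v))"
proof -
  define D where "D v = cext P (v - (1/2) *\<^sub>R (hbracket (cext P g) v + hbracket (cext P v) g))" for v
  have "((\<lambda>g. cext P (g - (1/2) *\<^sub>R hbracket (cext P g) g)) has_derivative D) (at g)"
    unfolding D_def
    by (intro bounded_linear.has_derivative[OF C.P_linear] has_derivative_diff has_derivative_ident
        has_derivative_scaleR_right bounded_bilinear.FDERIV[OF bounded_bilinear_hbracket])
  hence 1: "(C.K has_derivative D) (at g)" by (simp add: C.K_def[abs_def])
  have P_i: "cext P (cscale \<i> v) = cscale \<i> (cext P v)" for v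
    by (rule heis_eqI) (simp_all add: P_simps)
  have b: "hbracket u (cscale \<i> v) = cscale \<i> (hbracket u v)" "hbracket (cscale \<i> u) v = cscale \<i> (hbracket u v)"
    for u v :: "(complex, 'n) heis"
    by (rule heis_eqI; simp add: hbracket_symp symp_complex symp_simps central_simps)+
  have lin: "cscale \<i> (u + v) = cscale \<i> u + cscale \<i> v" "cscale \<i> (u - v) = cscale \<i> u - cscale \<i> v"
    "cscale \<i> (r *\<^sub>R u) = r *\<^sub>R cscale \<i> u" for u v :: "(complex, 'n) heis" and r
    by (rule heis_eqI; simp add: hre_simps him_simps)+
  have "D (cscale \<i> v) = cscale \<i> (D v)" for v
    unfolding D_def P_i b by (simp only: P_i flip: lin)
  thus ?thesis using 1 by blast
qed

text \<open>\<open>\<sigma>\<close> is induced by \<open>reflect \<circ> K\<close>, where \<open>K\<close> is holomorphic and \<open>reflect\<close> is conjugate linear, so pulling back a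
  holomorphic function and conjugating it gives a holomorphic function. It is its own inverse.\<close>

lemma antiholomorphic_reflection:
  defines "\<sigma> \<equiv> \<lambda>A. lcoset (complexify h) (reflect (C.KC A))"
  shows "antiholomorphic_diffeo h \<sigma>" "\<And>A. A \<in> cspace h \<Longrightarrow> \<sigma> A \<in> cspace h \<and> C.KC (\<sigma> A) = reflect (C.KC A) \<and> \<sigma> (\<sigma> A) = A"
proof -
  let ?H = "complexify h"
  have K_reflect: "C.K (reflect (C.K g)) = reflect (C.K g)" for g
  proof (rule C.K_id)
    have "hre (C.K g) \<in> c" "him (C.K g) \<in> c" using C.K_in[of g] by (simp_all add: mem_complexify)
    thus "reflect (C.K g) \<in> complexify c" using subspace_neg[OF subspace_c] by (simp add: mem_complexify)
  qed
  have reflect_reflect: "reflect (reflect g) = g" for g :: "(complex, 'n) heis" by (rule heis_eqI) simp_all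
  show \<sigma>: "\<sigma> A \<in> cspace h \<and> C.KC (\<sigma> A) = reflect (C.KC A) \<and> \<sigma> (\<sigma> A) = A" if A: "A \<in> cspace h" for A
  proof -
    obtain g where "A = lcoset ?H g" using A unfolding lcosets_def by (rule imageE)
    thus ?thesis by (simp add: \<sigma>_def K_reflect reflect_reflect) (simp add: lcosets_def)
  qed
  have anti: "antiholomorphic_map h \<sigma>"
    unfolding antiholomorphic_map_def
  proof (intro conjI allI impI)
    show "\<sigma> ` cspace h \<subseteq> cspace h" using \<sigma> by (intro image_subsetI) simp
    fix V and f :: "(complex, 'n) heis set \<Rightarrow> complex" assume hol: "holomorphic_fun h V f"
    let ?W = "{A \<in> cspace h. \<sigma> A \<in> V}"
    have V: "V \<subseteq> cspace h" "open (\<Union>V)" using hol by (auto simp: holomorphic_fun_def qopen_def)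
    have mem: "reflect (C.K g) \<in> \<Union>V \<longleftrightarrow> \<sigma> (lcoset ?H g) \<in> V" for g
      using C.lcoset_mem_iff[OF V(1), of "reflect (C.K g)"] by (simp add: \<sigma>_def)
    have UW: "\<Union>?W = {g. reflect (C.K g) \<in> \<Union>V}"
    proof -
      have "\<Union>?W = \<Union>{A \<in> cspace h. reflect (C.KC A) \<in> \<Union>V}"
        using C.lcoset_mem_iff[OF V(1)] by (simp add: \<sigma>_def)
      also have "\<dots> = {g. reflect (C.K g) \<in> \<Union>V}" by (rule C.Union_lcosets_vimage)
      finally show ?thesis .
    qed
    have "continuous_on UNIV (\<lambda>g. reflect (C.K g))"
      by (intro bounded_linear.continuous_on[OF bounded_linear_reflect] C.isCont_K)
    hence "open ((\<lambda>g. reflect (C.K g)) -` \<Union>V)" using V(2) by (rule open_vimage[rotated])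
    hence "qopen ?H ?W" unfolding qopen_def UW vimage_def by auto
    moreover have "holomorphic_heis (\<lambda>g. cnj (f (\<sigma> (lcoset ?H g)))) (\<Union>?W)"
      unfolding holomorphic_heis_def
    proof
      fix g assume "g \<in> \<Union>?W"
      hence "reflect (C.K g) \<in> \<Union>V" unfolding UW by blast
      then obtain A where A: "((\<lambda>g. f (lcoset ?H g)) has_derivative A) (at (reflect (C.K g)))" "\<And>v. A (cscale \<i> v) = \<i> * A v"
        using hol unfolding holomorphic_fun_def holomorphic_heis_def by blast
      obtain D where D: "(C.K has_derivative D) (at g)" "\<And>v. D (cscale \<i> v) = cscale \<i> (D v)"
        using K_complex_derivative[of g] by blast
      have lin: "linear A" using A(1) has_derivative_linear by blast
      have "((\<lambda>g. cnj (f (lcoset ?H (reflect (C.K g))))) has_derivative (\<lambda>v. cnj (A (reflect (D v))))) (at g)"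
        by (intro bounded_linear.has_derivative[OF bounded_linear_cnj]
            has_derivative_compose[OF bounded_linear.has_derivative[OF bounded_linear_reflect D(1)] A(1)])
      moreover have "cnj (A (reflect (D (cscale \<i> v)))) = \<i> * cnj (A (reflect (D v)))" for v
        by (simp add: D(2) reflect_cscale linear_neg[OF lin] A(2))
      ultimately show "\<exists>A. ((\<lambda>g. cnj (f (\<sigma> (lcoset ?H g)))) has_derivative A) (at g) \<and> (\<forall>v. A (cscale \<i> v) = \<i> * A v)"
        by (intro exI[of _ "\<lambda>v. cnj (A (reflect (D v)))"]) (simp add: \<sigma>_def)
    qed
    ultimately show "holomorphic_fun h ?W (\<lambda>A. cnj (f (\<sigma> A)))" by (simp add: holomorphic_fun_def)
  qed
  have bij: "bij_betw \<sigma> (cspace h) (cspace h)"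
    by (rule bij_betw_byWitness[of _ \<sigma>]) (use \<sigma> in \<open>auto simp del: split_paired_All\<close>)
  have inv: "inv_into (cspace h) \<sigma> A = \<sigma> A" if "A \<in> cspace h" for A
    using inv_into_f_f[OF bij_betw_imp_inj_on[OF bij], of "\<sigma> A"] \<sigma>[OF that] by simp
  have inv': "inv_into (cspace h) \<sigma> (lcoset ?H g) = \<sigma> (lcoset ?H g)" for g
    by (rule inv) (simp add: lcosets_def)
  have "antiholomorphic_map h (inv_into (cspace h) \<sigma>)"
    unfolding antiholomorphic_map_def
  proof (intro conjI allI impI)
    show "inv_into (cspace h) \<sigma> ` cspace h \<subseteq> cspace h" using \<sigma> inv by (intro image_subsetI) simp
    fix V and f :: "(complex, 'n) heis set \<Rightarrow> complex" assume "holomorphic_fun h V f"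
    hence "holomorphic_fun h {A \<in> cspace h. \<sigma> A \<in> V} (\<lambda>A. cnj (f (\<sigma> A)))"
      using anti unfolding antiholomorphic_map_def by blast
    moreover have "{A \<in> cspace h. inv_into (cspace h) \<sigma> A \<in> V} = {A \<in> cspace h. \<sigma> A \<in> V}" using inv by (intro Collect_cong) metis
    ultimately show "holomorphic_fun h {A \<in> cspace h. inv_into (cspace h) \<sigma> A \<in> V} (\<lambda>A. cnj (f (inv_into (cspace h) \<sigma> A)))"
      unfolding holomorphic_fun_def by (simp add: inv')
  qed
  thus "antiholomorphic_diffeo h \<sigma>" using anti bij by (simp add: antiholomorphic_diffeo_def)
qed

lemma commutative_complexify:
  assumes "(\<forall>t. central t \<in> h) \<or> (\<forall>u\<in>c. \<forall>v\<in>c. symp u v = 0)"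
  shows "(\<forall>t. central t \<in> complexify h) \<or> (\<forall>u\<in>complexify c. \<forall>v\<in>complexify c. symp u v = 0)"
  using assms
proof
  assume "\<forall>u\<in>c. \<forall>v\<in>c. symp u v = 0"
  hence "symp u v = 0" if "u \<in> complexify c" "v \<in> complexify c" for u v :: "(complex, 'n) heis"
    using that by (simp add: symp_complex mem_complexify complex_eq_iff)
  thus ?thesis by blast
qed (simp add: mem_complexify)

lemma qopen_him_KC:
  assumes "open \<Omega>"
  shows "qopen (complexify h) {A \<in> cspace h. him (C.KC A) \<in> \<Omega>}"
proof -
  have "continuous_on UNIV (\<lambda>g. him (C.K g))"
    by (intro bounded_linear.continuous_on[OF bounded_linear_him] C.isCont_K)
  hence "open ((\<lambda>g. him (C.K g)) -` \<Omega>)" using assms by (rule open_vimage[rotated])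
  moreover have "\<Union>{A \<in> cspace h. him (C.KC A) \<in> \<Omega>} = (\<lambda>g. him (C.K g)) -` \<Omega>"
    unfolding vimage_def by (rule C.Union_lcosets_vimage)
  ultimately show ?thesis unfolding qopen_def by auto
qed

text \<open>If \<open>c\<close> is commutative modulo \<open>h\<close>, the real part of \<open>K\<close> can be moved arbitrarily by left translations
  with \<open>c\<close>, so the equations \<open>Re K = 0\<close> are independent.\<close>

lemma submanifold_imaginary:
  assumes ab: "(\<forall>t. central t \<in> h) \<or> (\<forall>u\<in>c. \<forall>v\<in>c. symp u v = 0)"
    and \<Omega>: "open \<Omega>"
  shows "submanifold h {A \<in> cspace h. hre (C.KC A) = 0 \<and> him (C.KC A) \<in> \<Omega>} (DIM((real, 'n) heis) - dim h)"
proof -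
  let ?H = "complexify h" and ?d = "DIM((real, 'n) heis) - dim h"
  let ?S = "{A \<in> cspace h. hre (C.KC A) = 0 \<and> him (C.KC A) \<in> \<Omega>}"
  let ?V = "{A \<in> cspace h. him (C.KC A) \<in> \<Omega>}"
  have dimc: "dim c = ?d" by (rule dim_complement[OF split])
  obtain W where len: "length W = dim c" and Wc: "set W \<subseteq> c"
    and on: "\<forall>i<length W. \<forall>j<length W. W ! i \<bullet> W ! j = (if i = j then 1 else 0)"
    and coord: "\<forall>v\<in>c. (\<Sum>i<length W. (v \<bullet> W ! i) *\<^sub>R W ! i) = v"
    using orthonormal_list_exists[OF subspace_c] by blast
  have trans: "C.K (heis_of_real l \<star> g) = heis_of_real l + C.K g" if "l \<in> c" for l g
  proof (rule C.K_translate)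
    show "(\<forall>t. central t \<in> ?H) \<or> (\<forall>u\<in>complexify c. \<forall>v\<in>complexify c. symp u v = 0)"
      by (rule commutative_complexify[OF ab])
    show "heis_of_real l \<in> complexify c" using that subspace_0[OF subspace_c] by (simp add: mem_complexify)
  qed
  define f where "f i A = hre (C.KC A) \<bullet> W ! i" for i A
  have f_eq: "(\<lambda>g. f i (lcoset ?H g)) = (\<lambda>g. hre (C.K g) \<bullet> W ! i)" for i by (simp add: f_def)
  have smooth: "smooth_on (\<lambda>g. f i (lcoset ?H g)) UNIV" for i
    unfolding f_eq
    by (intro smooth_on_linear[OF bounded_linear_inner_left] smooth_on_linear[OF bounded_linear_hre] C.smooth_on_K)
  have qV: "qopen ?H ?V" by (rule qopen_him_KC[OF \<Omega>])
  \<comment> \<open>The direction is the velocity of \<open>s \<mapsto> exp (s W\<^sub>j) \<star> g\<close>, along which \<open>K\<close> moves by \<open>s W\<^sub>j\<close>.\<close>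
  have deriv: "frechet_derivative (\<lambda>g. f i (lcoset ?H g)) (at g) (heis_of_real (W ! j) + central ((1/2) *\<^sub>R symp (heis_of_real (W ! j)) g))
      = (if i = j then 1 else 0)" if "i < ?d" "j < ?d" for i j g
  proof -
    have 1: "((\<lambda>g. f i (lcoset ?H g)) has_derivative frechet_derivative (\<lambda>g. f i (lcoset ?H g)) (at g)) (at g)"
      using smooth_on_differentiable[OF smooth] frechet_derivative_works by blast
    have "f i (lcoset ?H (g + s *\<^sub>R (heis_of_real (W ! j) + central ((1/2) *\<^sub>R symp (heis_of_real (W ! j)) g))))
      = f i (lcoset ?H g) + s *\<^sub>R (if i = j then 1 else 0)" for s
    proof -
      have e: "g + s *\<^sub>R (heis_of_real (W ! j) + central ((1/2) *\<^sub>R symp (heis_of_real (W ! j)) g)) = heis_of_real (s *\<^sub>R W ! j) \<star> g"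
        by (simp add: hmult_symp heis_of_real_simps symp_simps central_simps scaleR_add_right)
      have "s *\<^sub>R W ! j \<in> c" using Wc that len dimc by (intro subspace_scale[OF subspace_c]) auto
      thus ?thesis using on that len dimc by (simp add: e f_def trans hre_simps inner_add_left)
    qed
    hence 2: "\<forall>\<^sub>F s in nhds 0. f i (lcoset ?H (g + s *\<^sub>R (heis_of_real (W ! j) + central ((1/2) *\<^sub>R symp (heis_of_real (W ! j)) g))))
      = f i (lcoset ?H g) + s *\<^sub>R (if i = j then 1 else 0)" by simp
    show ?thesis by (rule directional_derivative_unique[OF 1 2])
  qed
  have rd: "rdim h = 2 * ?d" by (rule rdim_eq[OF subspace_h])
  hence rd': "rdim h - ?d = ?d" by simp
  have "\<exists>V (f :: nat \<Rightarrow> (complex, 'n) heis set \<Rightarrow> real).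
        qopen ?H V \<and> p \<in> V \<and> (\<forall>i<rdim h - ?d. smooth_fun h V (f i)) \<and>
        (\<forall>g\<in>\<Union>V. \<forall>a :: nat \<Rightarrow> real.
            (\<forall>v. (\<Sum>i<rdim h - ?d. a i * frechet_derivative (\<lambda>g. f i (lcoset ?H g)) (at g) v) = 0) \<longrightarrow>
            (\<forall>i<rdim h - ?d. a i = 0)) \<and>
        ?S \<inter> V = {A \<in> V. \<forall>i<rdim h - ?d. f i A = 0}" if p: "p \<in> ?S" for p
  proof (rule exI[of _ ?V], rule exI[of _ f], intro conjI)
    show "qopen ?H ?V" by (rule qV)
    show "p \<in> ?V" using p by simp
    show "\<forall>i<rdim h - ?d. smooth_fun h ?V (f i)"
      using qV smooth_on_subset[OF smooth] by (simp add: smooth_fun_def)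
    show "\<forall>g\<in>\<Union>?V. \<forall>a :: nat \<Rightarrow> real.
            (\<forall>v. (\<Sum>i<rdim h - ?d. a i * frechet_derivative (\<lambda>g. f i (lcoset ?H g)) (at g) v) = 0) \<longrightarrow>
            (\<forall>i<rdim h - ?d. a i = 0)"
    proof (intro ballI allI impI)
      fix g and a :: "nat \<Rightarrow> real" and j
      assume z: "\<forall>v. (\<Sum>i<rdim h - ?d. a i * frechet_derivative (\<lambda>g. f i (lcoset ?H g)) (at g) v) = 0"
        and j: "j < rdim h - ?d"
      have "(\<Sum>i<?d. a i * frechet_derivative (\<lambda>g. f i (lcoset ?H g)) (at g)
          (heis_of_real (W ! j) + central ((1/2) *\<^sub>R symp (heis_of_real (W ! j)) g))) = (\<Sum>i<?d. if i = j then a i else 0)"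
        using j rd deriv by (intro sum.cong) auto
      moreover have "(\<Sum>i<?d. a i * frechet_derivative (\<lambda>g. f i (lcoset ?H g)) (at g)
          (heis_of_real (W ! j) + central ((1/2) *\<^sub>R symp (heis_of_real (W ! j)) g))) = 0"
        by (rule z[unfolded rd', THEN spec])
      ultimately show "a j = 0" using j rd by simp
    qed
    have "hre (C.KC A) = 0 \<longleftrightarrow> (\<forall>i<?d. f i A = 0)" if "A \<in> cspace h" for A
    proof
      assume "\<forall>i<?d. f i A = 0"
      hence "\<forall>i<length W. hre (C.KC A) \<bullet> W ! i = 0" using len dimc by (simp add: f_def)
      moreover have "hre (C.KC A) \<in> c" using C.K_in by (simp add: C.KC_def mem_complexify)
      ultimately show "hre (C.KC A) = 0" using coord by force
    qed (simp add: f_def)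
    thus "?S \<inter> ?V = {A \<in> ?V. \<forall>i<rdim h - ?d. f i A = 0}" using rd by auto
  qed
  thus ?thesis unfolding submanifold_def using rd by (intro conjI ballI) auto
qed

text \<open>The slice consists of the imaginary points over \<open>\<Omega>\<close>. Each orbit over \<open>\<Omega>\<close> meets it, because \<open>b \<in> T b\<close>; and the
  reflection changes only real parts, so it preserves every orbit that is described by imaginary parts.\<close>

lemma slice_of_orbits:
  assumes ab: "(\<forall>t. central t \<in> h) \<or> (\<forall>u\<in>c. \<forall>v\<in>c. symp u v = 0)"
    and \<Omega>: "open \<Omega>" "b0 \<in> c" "b0 \<in> \<Omega>"
    and T: "\<And>b. b \<in> \<Omega> \<Longrightarrow> b \<in> T b" "\<And>b. b \<in> \<Omega> \<Longrightarrow> T b \<subseteq> \<Omega>"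
    and orb: "\<And>A. A \<in> cspace h \<Longrightarrow> him (C.KC A) \<in> \<Omega> \<Longrightarrow>
      orbit L A = {A' \<in> cspace h. him (C.KC A') \<in> T (him (C.KC A))}"
  shows "\<exists>S. slice h L S \<and> submanifold h S (DIM((real, 'n) heis) - dim h)"
proof -
  let ?H = "complexify h"
  let ?S = "{A \<in> cspace h. hre (C.KC A) = 0 \<and> him (C.KC A) \<in> \<Omega>}"
  let ?D = "{A \<in> cspace h. him (C.KC A) \<in> \<Omega>}"
  define \<sigma> where "\<sigma> A = lcoset ?H (reflect (C.KC A))" for A
  have anti1: "antiholomorphic_diffeo h \<sigma>"
    using antiholomorphic_reflection(1) by (simp add: \<sigma>_def[abs_def])
  have anti2: "\<sigma> A \<in> cspace h \<and> C.KC (\<sigma> A) = reflect (C.KC A) \<and> \<sigma> (\<sigma> A) = A" if "A \<in> cspace h" for A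
    unfolding \<sigma>_def by (rule antiholomorphic_reflection(2)[OF that])
  have at_i: "lcoset ?H (hcx 0 b) \<in> cspace h \<and> C.KC (lcoset ?H (hcx 0 b)) = hcx 0 b" if "b \<in> c" for b
  proof -
    have "C.K (hcx 0 b) = hcx 0 b" using that subspace_0[OF subspace_c] by (intro C.K_id) (simp add: mem_complexify)
    thus ?thesis by (simp add: lcosets_def)
  qed
  have D: "(\<Union>s\<in>?S. orbit L s) = ?D"
  proof (intro equalityI subsetI)
    fix A assume "A \<in> (\<Union>s\<in>?S. orbit L s)"
    then obtain s where s: "s \<in> ?S" "A \<in> orbit L s" by blast
    thus "A \<in> ?D" using orb[of s] T(2)[of "him (C.KC s)"] by blast
  next
    fix A assume A: "A \<in> ?D"
    have b: "him (C.KC A) \<in> c" using C.K_in by (simp add: C.KC_def mem_complexify)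
    let ?s = "lcoset ?H (hcx 0 (him (C.KC A)))"
    have "?s \<in> ?S" using at_i[OF b] A by simp
    moreover have "A \<in> orbit L ?s" using at_i[OF b] A orb[of ?s] T(1) by simp
    ultimately show "A \<in> (\<Union>s\<in>?S. orbit L s)" by blast
  qed
  have qD: "qopen ?H ?D" by (rule qopen_him_KC[OF \<Omega>(1)])
  have sub: "submanifold h ?S (DIM((real, 'n) heis) - dim h)" by (rule submanifold_imaginary[OF ab \<Omega>(1)])
  have "slice h L ?S"
    unfolding slice_def D
  proof (intro conjI exI[of _ \<sigma>] exI[of _ "DIM((real, 'n) heis) - dim h"] ballI)
    show "submanifold h ?S (DIM((real, 'n) heis) - dim h)" by (rule sub)
    show "antiholomorphic_diffeo h \<sigma>" by (rule anti1)
    show "?D \<noteq> {}" using at_i[OF \<Omega>(2)] \<Omega>(3) by (intro notI) (metis (mono_tags, lifting) empty_iff him_hcx mem_Collect_eq)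
    show "qopen ?H ?D" by (rule qD)
  next
    fix s assume s: "s \<in> ?S"
    have "reflect (C.KC s) = C.KC s" using s by (intro heis_eqI) simp_all
    thus "\<sigma> s = s" using s C.lcoset_KC by (simp add: \<sigma>_def)
  next
    fix A assume A: "A \<in> ?D"
    let ?O = "{A' \<in> cspace h. him (C.KC A') \<in> T (him (C.KC A))}"
    have sub: "\<sigma> ` ?O \<subseteq> ?O" using anti2 by (intro image_subsetI) simp
    have "A' \<in> \<sigma> ` ?O" if "A' \<in> ?O" for A'
    proof -
      have "\<sigma> A' \<in> ?O" using that sub by blast
      moreover have "A' = \<sigma> (\<sigma> A')" using anti2 that by simp
      ultimately show ?thesis by blast
    qed
    hence "\<sigma> ` ?O = ?O" using sub by blast
    thus "\<sigma> ` orbit L A = orbit L A" using orb[of A] A by simp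
  qed
  thus ?thesis using sub by blast
qed

lemma cspaceE: assumes "A \<in> cspace h" obtains g where "A = lcoset (complexify h) g" "C.KC A = C.K g"
  using assms unfolding lcosets_def by (metis C.KC_lcoset imageE)

text \<open>Here \<open>T b = {b}\<close>: the elements of \<open>L\<close> move only the real part of \<open>K\<close>, and \<open>c \<subseteq> L\<close> moves it arbitrarily.\<close>

lemma slice_translations:
  assumes "(\<forall>t. central t \<in> h) \<and> c \<subseteq> L \<or> L = c \<and> (\<forall>u\<in>c. \<forall>v\<in>c. symp u v = 0)"
  shows "\<exists>S. slice h L S \<and> submanifold h S (DIM((real, 'n) heis) - dim h)"
proof (rule slice_of_orbits[where \<Omega> = UNIV and T = "\<lambda>b. {b}" and ?b0.0 = 0])
  let ?H = "complexify h"
  show ab: "(\<forall>t. central t \<in> h) \<or> (\<forall>u\<in>c. \<forall>v\<in>c. symp u v = 0)" using assms by blast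
  have cL: "c \<subseteq> L" using assms by blast
  note abC = commutative_complexify[OF ab]
  have of_c: "heis_of_real l \<in> complexify c" if "l \<in> c" for l
    using that subspace_0[OF subspace_c] by (simp add: mem_complexify)
  have him_K: "him (C.K (heis_of_real l \<star> g)) = him (C.K g)" if "l \<in> L" for l g
    using assms
  proof
    assume z: "(\<forall>t. central t \<in> h) \<and> c \<subseteq> L"
    hence "cext P (central t) = 0" for t by (intro C.P_0) (simp add: mem_complexify)
    thus ?thesis by (simp add: C.K_eq C.P_simps hmult_symp him_simps P_simps linear_0[OF bounded_linear.linear[OF P_linear]])
  next
    assume "L = c \<and> (\<forall>u\<in>c. \<forall>v\<in>c. symp u v = 0)"
    thus ?thesis using C.K_translate[OF abC of_c[of l], of g] that by (simp add: him_simps)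
  qed
  fix A assume A: "A \<in> cspace h"
  then obtain g where g: "A = lcoset ?H g" "C.KC A = C.K g" by (rule cspaceE)
  show "orbit L A = {A' \<in> cspace h. him (C.KC A') \<in> {him (C.KC A)}}"
  proof (intro equalityI subsetI)
    fix A' assume "A' \<in> orbit L A"
    then obtain l where l: "l \<in> L" "A' = act (heis_of_real l) A" unfolding orbit_def by blast
    hence "A' = lcoset ?H (heis_of_real l \<star> g)" using g by (simp add: C.act_lcoset)
    thus "A' \<in> {A' \<in> cspace h. him (C.KC A') \<in> {him (C.KC A)}}"
      using him_K[OF l(1)] g by (simp add: lcosets_def)
  next
    fix A' assume A': "A' \<in> {A' \<in> cspace h. him (C.KC A') \<in> {him (C.KC A)}}"
    then obtain g' where g': "A' = lcoset ?H g'" "C.KC A' = C.K g'" using cspaceE by blast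
    define l where "l = hre (C.K g') - hre (C.K g)"
    have l: "l \<in> c" unfolding l_def using C.K_in by (intro subspace_diff[OF subspace_c]) (simp_all add: mem_complexify)
    have "C.K (heis_of_real l \<star> g) = heis_of_real l + C.K g" by (rule C.K_translate[OF abC of_c[OF l]])
    also have "\<dots> = C.K g'" using A' g g' by (intro heis_eqI) (simp_all add: l_def hre_simps him_simps)
    finally have "lcoset ?H (heis_of_real l \<star> g) = A'" using g' by (simp add: C.lcoset_eq_iff)
    hence "A' = act (heis_of_real l) A" using g by (simp add: C.act_lcoset)
    thus "A' \<in> orbit L A" using l cL unfolding orbit_def by blast
  qed
qed (simp_all add: subspace_0[OF subspace_c])

end

section \<open>Orbits of sheared translations\<close>

lemma heis_of_real_hmult: "heis_of_real (u \<star> v) = heis_of_real u \<star> heis_of_real v"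
  by (rule heis_eqI) (simp_all add: hmult_symp hre_simps him_simps symp_complex central_simps)

context
  fixes h c :: "(real, 'n::finite) heis set" and P
  assumes split: "splitting h c P"
    and Zc: "\<forall>t. central t \<in> c" and ab: "\<forall>u\<in>c. \<forall>v\<in>c. symp u v = 0"
begin

interpretation splitting h c P by (rule split)
interpretation C: splitting "complexify h" "complexify c" "cext P" by (rule splitting_complexify[OF split])

lemma P_central: "P (central t) = central t"
  using Zc P_id by blast

text \<open>Write \<open>l = K l \<star> a\<close> with \<open>a \<in> h\<close>. Moving \<open>a\<close> to the right past a point of \<open>c\<close> costs the commutator \<open>symp a\<close>, and
  \<open>symp a = symp (l - P l)\<close>.\<close>

lemma K_shear:
  "hre (C.K (heis_of_real l \<star> g)) = K l + hre (C.K g) + central (symp (l - P l) (hre (C.K g)))"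
  "him (C.K (heis_of_real l \<star> g)) = him (C.K g) + central (symp (l - P l) (him (C.K g)))"
proof -
  define a where "a = - K l \<star> l"
  define w where "w = C.K g"
  define s where "s = symp (heis_of_real a) w"
  have a: "a \<in> h" "l = K l \<star> a" unfolding a_def using K_cofactor by simp_all
  have symp_a: "symp a u = symp (l - P l) u" for u
    unfolding a_def by (simp add: hmult_symp symp_simps K_eq P_central)
  have ac: "heis_of_real a \<in> complexify h" using a(1) subspace_0[OF subspace_h] by (simp add: mem_complexify)
  have Kl: "heis_of_real (K l) \<in> complexify c" using K_in subspace_0[OF subspace_c] by (simp add: mem_complexify)
  have wc: "w + central s \<in> complexify c" unfolding w_def using C.K_in Zc
    by (intro subspace_add[OF C.subspace_c]) (simp_all add: mem_complexify)
  have abC: "(\<forall>t. central t \<in> complexify h) \<or> (\<forall>u\<in>complexify c. \<forall>v\<in>complexify c. symp u v = 0)"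
    using ab by (intro commutative_complexify[OF split]) blast
  have "heis_of_real l \<star> w = heis_of_real (K l) \<star> (heis_of_real a \<star> w)"
    by (subst a(2)) (simp only: heis_of_real_hmult hmult_assoc)
  also have "heis_of_real a \<star> w = (w + central s) \<star> heis_of_real a"
  proof -
    have "heis_of_real a \<star> w = central s \<star> (w \<star> heis_of_real a)"
      unfolding s_def hmult_central by (rule hmult_swap)
    thus ?thesis by (simp only: hmult_central(2)[of s w, symmetric] hmult_assoc)
  qed
  finally have "C.K (heis_of_real l \<star> g) = C.K ((heis_of_real (K l) \<star> (w + central s)) \<star> heis_of_real a)"
    using C.K_K_mult[of "heis_of_real l" g] by (simp add: w_def hmult_assoc)
  also have "\<dots> = heis_of_real (K l) + (w + central s)"
    using C.K_mult_h[OF ac] C.K_translate[OF abC Kl] C.K_id[OF wc] by simp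
  finally have e: "C.K (heis_of_real l \<star> g) = heis_of_real (K l) + (w + central s)" .
  show "hre (C.K (heis_of_real l \<star> g)) = K l + hre (C.K g) + central (symp (l - P l) (hre (C.K g)))"
    "him (C.K (heis_of_real l \<star> g)) = him (C.K g) + central (symp (l - P l) (him (C.K g)))"
    unfolding e by (simp_all add: w_def s_def hre_simps him_simps symp_complex symp_a)
qed

text \<open>If the group contains, besides lifts of \<open>c\<close>, a nonzero \<open>x0 \<in> h\<close>, then that element moves the central
  coordinate of the imaginary part freely wherever \<open>symp x0\<close> does not vanish.\<close>

lemma slice_shear:
  assumes q: "subspace q" "q \<subseteq> L" "central 1 \<in> q" and lift: "\<And>m. m \<in> c \<Longrightarrow> \<exists>l\<in>q. P l = m"
    and x0: "x0 \<in> q" "x0 \<in> h" and b0: "b0 \<in> c" "symp x0 b0 \<noteq> 0"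
  shows "\<exists>S. slice h L S \<and> submanifold h S (DIM((real, 'n) heis) - dim h)"
proof (rule slice_of_orbits[OF split, where \<Omega> = "{b. symp x0 b \<noteq> 0}" and T = "\<lambda>b. {b + central r |r. True}" and ?b0.0 = b0])
  let ?H = "complexify h"
  show "(\<forall>t. central t \<in> h) \<or> (\<forall>u\<in>c. \<forall>v\<in>c. symp u v = 0)" using ab by blast
  have "linear (symp x0)" by (rule linearI) (simp_all add: symp_simps)
  hence "continuous_on UNIV (symp x0)" by (simp add: linear_continuous_on linear_conv_bounded_linear)
  moreover have "open (- {0 :: real})" by (intro open_Compl closed_singleton)
  ultimately have "open (symp x0 -` (- {0}))" by (rule open_vimage[rotated])
  thus "open {b. symp x0 b \<noteq> 0}" by (simp add: vimage_def)
  show "b \<in> {b + central r |r. True}" for b by (rule CollectI, rule exI[of _ 0]) (simp add: central_simps)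
  show "b0 \<in> {b. symp x0 b \<noteq> 0}" "b0 \<in> c" using b0 by simp_all
  show "{b + central r |r. True} \<subseteq> {b. symp x0 b \<noteq> 0}" if "b \<in> {b. symp x0 b \<noteq> 0}" for b
  proof
    fix u assume "u \<in> {b + central r |r. True}"
    then obtain r where "u = b + central r" by blast
    thus "u \<in> {b. symp x0 b \<noteq> 0}" using that by (simp add: symp_simps)
  qed
  fix A assume A: "A \<in> cspace h" "him (C.KC A) \<in> {b. symp x0 b \<noteq> 0}"
  obtain g where g: "A = lcoset ?H g" "C.KC A = C.K g" using A(1) cspaceE[OF split] by blast
  show "orbit L A = {A' \<in> cspace h. him (C.KC A') \<in> {him (C.KC A) + central r |r. True}}"
  proof (intro equalityI subsetI)
    fix A' assume "A' \<in> orbit L A"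
    then obtain l where l: "l \<in> L" "A' = act (heis_of_real l) A" unfolding orbit_def by blast
    hence "A' = lcoset ?H (heis_of_real l \<star> g)" using g by (simp add: C.act_lcoset)
    thus "A' \<in> {A' \<in> cspace h. him (C.KC A') \<in> {him (C.KC A) + central r |r. True}}"
      using K_shear(2)[of l g] g by (auto simp: lcosets_def)
  next
    fix A' assume "A' \<in> {A' \<in> cspace h. him (C.KC A') \<in> {him (C.KC A) + central r |r. True}}"
    then obtain r where A': "A' \<in> cspace h" "him (C.KC A') = him (C.K g) + central r" using g by auto
    obtain g' where g': "A' = lcoset ?H g'" "C.KC A' = C.K g'" using A'(1) cspaceE[OF split] by blast
    define m where "m = hre (C.K g') - hre (C.K g)"
    have m: "m \<in> c" unfolding m_def using C.K_in by (intro subspace_diff[OF subspace_c]) (simp_all add: mem_complexify)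
    obtain l0 where l0: "l0 \<in> q" "P l0 = m" using lift[OF m] by blast
    \<comment> \<open>Adjust the imaginary part by a multiple of \<open>x0\<close>, then the real part by a central element.\<close>
    define \<tau> where "\<tau> = (r - symp (l0 - m) (him (C.K g))) / symp x0 (him (C.K g))"
    define a where "a = l0 - m + \<tau> *\<^sub>R x0"
    define z where "z = (1/2) * symp m a - symp a (hre (C.K g))"
    define l where "l = l0 + \<tau> *\<^sub>R x0 + z *\<^sub>R central 1"
    have "l \<in> q" unfolding l_def using q(1,3) l0(1) x0(1) by (intro subspace_add subspace_scale)
    have Pl: "P l = m + central z" by (simp add: l_def P_simps l0(2) P_0[OF x0(2)] P_central central_simps)
    have la: "l - P l = a" by (simp add: Pl) (simp add: l_def a_def central_simps)
    have l_eq: "l = m + a + central z" by (simp add: l_def a_def central_simps)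
    have "K l = m + central z - central ((1/2) * symp m a)"
      by (simp add: K_eq Pl P_central) (simp add: l_eq symp_simps)
    also have "\<dots> = m - central (symp a (hre (C.K g)))"
      by (simp add: z_def central_simps)
    finally have re: "hre (C.K (heis_of_real l \<star> g)) = hre (C.K g')"
      by (simp add: K_shear la m_def)
    have "symp a (him (C.K g)) = r" using A(2) g by (simp add: a_def \<tau>_def symp_simps)
    hence im: "him (C.K (heis_of_real l \<star> g)) = him (C.K g')"
      using A'(2) g' by (simp add: K_shear la)
    have "lcoset ?H (heis_of_real l \<star> g) = A'"
      using heis_eqI[OF re im] g' by (simp add: C.lcoset_eq_iff)
    hence "A' = act (heis_of_real l) A" using g by (simp add: C.act_lcoset)
    thus "A' \<in> orbit L A" using \<open>l \<in> q\<close> q(2) unfolding orbit_def by blast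
  qed
qed

text \<open>Any complement of \<open>h\<close> that contains the center and acts with a slice is commutative. An anti-holomorphic
  map \<open>\<sigma>\<close> preserving the orbits is, up to a constant, minus the identity on the real parts of the coordinates
  modulo the center. The imaginary part of the central coordinate then shows that a certain holomorphic function
  has a real part with gradient \<open>m \<mapsto> 2 B(m, \<cdot>)\<close> plus a constant along \<open>c\<close>, and symmetry of the second
  derivative says that \<open>B\<close> is symmetric. But \<open>B\<close> is symmetric only if the complement is commutative.\<close>

lemma commutative_of_slice:
  assumes splitq: "splitting h q Pq" and Zq: "\<forall>t. central t \<in> q" and slice: "slice h q S"
    and uv: "u \<in> q" "v \<in> q"
  shows "symp u v = 0"
proof -
  interpret Q: splitting h q Pq by (rule splitq)
  let ?H = "complexify h"
  obtain \<sigma> where anti: "antiholomorphic_map h \<sigma>" and D: "(\<Union>s\<in>S. orbit q s) \<noteq> {}" "qopen ?H (\<Union>s\<in>S. orbit q s)"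
    and pres: "\<forall>A\<in>(\<Union>s\<in>S. orbit q s). \<sigma> ` orbit q A = orbit q A"
    using slice unfolding slice_def antiholomorphic_diffeo_def by metis
  define D where "D = (\<Union>s\<in>S. orbit q s)"
  note D = D[folded D_def] and pres = pres[folded D_def]
  have D_sub: "D \<subseteq> cspace h" and D_open: "open (\<Union>D)" using D(2) by (auto simp: qopen_def)
  \<comment> \<open>\<open>q\<close> is the graph of \<open>A\<close> over \<open>c\<close>.\<close>
  define A where "A m = Pq m - m" for m
  have A_in: "A m \<in> h" for m
    using subspace_neg[OF subspace_h Q.P_diff[of m]] by (simp add: A_def)
  have A_add: "A (m + m') = A m + A m'" "A (m - m') = A m - A m'" "A (r *\<^sub>R m) = r *\<^sub>R A m" for m m' r
    by (simp_all add: A_def Q.P_simps algebra_simps)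
  have A_central: "A (central t) = 0" for t using Zq Q.P_id by (simp add: A_def)
  have A_P: "l - P l = A (P l)" if "l \<in> q" for l
  proof -
    have "Pq (P l) = Pq l - Pq (l - P l)" by (simp add: Q.P_simps)
    also have "\<dots> = l" using Q.P_id[OF that] Q.P_0[OF P_diff] by simp
    finally show ?thesis by (simp add: A_def)
  qed
  define B where "B m b = symp (A m) b" for m b
  have B_simps: "B (m + m') b = B m b + B m' b" "B (m - m') b = B m b - B m' b" "B (r *\<^sub>R m) b = r * B m b"
    "B (central t) b = 0" "B m (b + b') = B m b + B m b'" "B m (r *\<^sub>R b) = r * B m b" for m m' b b' r t
    by (simp_all add: B_def A_add A_central symp_simps)
  define G where "G g = C.KC (\<sigma> (lcoset ?H g))" for g
  have rel: "him (G g) = him (C.K g) + central (B (hre (G g) - hre (C.K g)) (him (C.K g)))" if "g \<in> \<Union>D" for g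
  proof -
    have "lcoset ?H g \<in> D" using that C.lcoset_mem_iff[OF D_sub] by blast
    moreover have "lcoset ?H g \<in> orbit q (lcoset ?H g)"
    proof -
      have "act (heis_of_real 0) (lcoset ?H g) = lcoset ?H g" by (simp add: C.act_lcoset heis_of_real_simps)
      thus ?thesis unfolding orbit_def using subspace_0[OF Q.subspace_c] by force
    qed
    ultimately have "\<sigma> (lcoset ?H g) \<in> orbit q (lcoset ?H g)" using pres by blast
    then obtain l where l: "l \<in> q" "\<sigma> (lcoset ?H g) = act (heis_of_real l) (lcoset ?H g)"
      unfolding orbit_def by blast
    hence Gg: "G g = C.K (heis_of_real l \<star> g)" by (simp add: G_def C.act_lcoset)
    have "A (K l) = A (P l)" by (simp add: K_eq A_add A_central P_central)
    hence "A (hre (G g) - hre (C.K g)) = l - P l"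
      unfolding Gg using A_P[OF l(1)] by (simp add: K_shear A_add A_central)
    thus ?thesis unfolding B_def by (simp add: Gg K_shear)
  qed
  \<comment> \<open>\<open>\<Phi> \<phi>\<close> is the complex linear extension of \<open>\<phi>\<close>. As \<open>\<sigma>\<close> is anti-holomorphic, \<open>N \<phi>\<close> is holomorphic.\<close>
  define \<Phi> where "\<Phi> \<phi> g = Complex (\<phi> (hre g)) (\<phi> (him g))" for \<phi> :: "(real, 'n) heis \<Rightarrow> real" and g :: "(complex, 'n) heis"
  define N where "N \<phi> g = cnj (\<Phi> \<phi> (G g)) + \<Phi> \<phi> (C.K g)" for \<phi> g
  have ReN: "Re (N \<phi> g) = \<phi> (hre (G g)) + \<phi> (hre (C.K g))" and ImN: "Im (N \<phi> g) = \<phi> (him (C.K g)) - \<phi> (him (G g))" for \<phi> g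
    by (simp_all add: N_def \<Phi>_def)
  have N_hol: "\<exists>D. (N \<phi> has_derivative D) (at g) \<and> (\<forall>v. D (cscale \<i> v) = \<i> * D v)" if lin: "linear \<phi>" for \<phi> g
  proof -
    have "linear (\<Phi> \<phi>)"
      by (intro linearI complex_eqI) (simp_all add: \<Phi>_def hre_simps him_simps linear_add[OF lin] linear_cmul[OF lin])
    hence bl: "bounded_linear (\<Phi> \<phi>)" by (simp add: linear_conv_bounded_linear)
    have \<Phi>_i: "\<Phi> \<phi> (cscale \<i> v) = \<i> * \<Phi> \<phi> v" for v
      by (rule complex_eqI) (simp_all add: \<Phi>_def linear_neg[OF lin])
    have K_hol: "\<exists>D. ((\<lambda>g. \<Phi> \<phi> (C.K g)) has_derivative D) (at g) \<and> (\<forall>v. D (cscale \<i> v) = \<i> * D v)" for g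
    proof -
      obtain D where "(C.K has_derivative D) (at g)" "\<forall>v. D (cscale \<i> v) = cscale \<i> (D v)"
        using K_complex_derivative[OF split] by blast
      thus ?thesis using bounded_linear.has_derivative[OF bl, of C.K D "at g"] \<Phi>_i
        by (intro exI[of _ "\<lambda>v. \<Phi> \<phi> (D v)"]) simp
    qed
    have U: "\<Union>(cspace h) = UNIV"
    proof -
      have "g \<in> \<Union>(cspace h)" for g using C.mem_lcoset[of g g] unfolding lcosets_def by blast
      thus ?thesis by blast
    qed
    have "holomorphic_fun h (cspace h) (\<lambda>A. \<Phi> \<phi> (C.KC A))"
      using K_hol by (simp add: holomorphic_fun_def qopen_def U holomorphic_heis_def)
    hence "holomorphic_fun h {A \<in> cspace h. \<sigma> A \<in> cspace h} (\<lambda>A. cnj (\<Phi> \<phi> (C.KC (\<sigma> A))))"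
      using anti unfolding antiholomorphic_map_def by blast
    moreover have "{A \<in> cspace h. \<sigma> A \<in> cspace h} = cspace h"
      using anti unfolding antiholomorphic_map_def by blast
    ultimately have "holomorphic_fun h (cspace h) (\<lambda>A. cnj (\<Phi> \<phi> (C.KC (\<sigma> A))))" by (simp only:)
    hence "holomorphic_heis (\<lambda>g. cnj (\<Phi> \<phi> (G g))) UNIV"
      unfolding holomorphic_fun_def G_def U by (rule conjunct2)
    hence "\<exists>D. ((\<lambda>g. cnj (\<Phi> \<phi> (G g))) has_derivative D) (at g) \<and> (\<forall>v. D (cscale \<i> v) = \<i> * D v)"
      unfolding holomorphic_heis_def by (rule bspec) (rule UNIV_I)
    then obtain D1 where D1: "((\<lambda>g. cnj (\<Phi> \<phi> (G g))) has_derivative D1) (at g)" "\<And>v. D1 (cscale \<i> v) = \<i> * D1 v" by blast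
    obtain D2 where D2: "((\<lambda>g. \<Phi> \<phi> (C.K g)) has_derivative D2) (at g)" "\<And>v. D2 (cscale \<i> v) = \<i> * D2 v" using K_hol by blast
    have "(N \<phi> has_derivative (\<lambda>v. D1 v + D2 v)) (at g)"
      unfolding N_def[abs_def] by (rule has_derivative_add[OF D1(1) D2(1)])
    thus ?thesis by (intro exI[of _ "\<lambda>v. D1 v + D2 v"]) (simp add: D1(2) D2(2) distrib_left)
  qed
  obtain g0 where g0: "g0 \<in> \<Union>D"
  proof -
    obtain A0 where A0: "A0 \<in> D" using D(1) by blast
    hence "A0 \<in> cspace h" using D_sub by blast
    then obtain g where "A0 = lcoset ?H g" by (rule cspaceE[OF split])
    hence "g \<in> \<Union>D" using A0 C.lcoset_mem_iff[OF D_sub, of g] by simp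
    thus ?thesis by (rule that)
  qed
  define p0 where "p0 = C.K g0"
  have "p0 \<in> \<Union>D" using g0 C.lcoset_mem_iff[OF D_sub, of p0] C.lcoset_mem_iff[OF D_sub, of g0] by (simp add: p0_def)
  then obtain \<epsilon> where \<epsilon>: "\<epsilon> > 0" "ball p0 \<epsilon> \<subseteq> \<Union>D" using D_open open_contains_ball by blast
  have relb: "him (G g) = him (C.K g) + central (B (hre (G g) - hre (C.K g)) (him (C.K g)))"
    if "g \<in> ball p0 \<epsilon>" for g
    using rel[of g] that \<epsilon>(2) by blast
  have near: "\<forall>\<^sub>F s in nhds (0::real). p + s *\<^sub>R v \<in> ball p0 \<epsilon>" if "p \<in> ball p0 \<epsilon>" for p v
  proof -
    have "continuous_on UNIV (\<lambda>s :: real. p + s *\<^sub>R v)" by (intro continuous_intros)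
    hence "open ((\<lambda>s :: real. p + s *\<^sub>R v) -` ball p0 \<epsilon>)" by (rule open_vimage[rotated]) simp
    moreover have "0 \<in> (\<lambda>s :: real. p + s *\<^sub>R v) -` ball p0 \<epsilon>" using that by simp
    ultimately show ?thesis unfolding eventually_nhds by blast
  qed
  \<comment> \<open>Modulo the center \<open>\<sigma>\<close> preserves imaginary parts, so \<open>N \<phi>\<close> is real there and hence constant.\<close>
  have const: "\<phi> (hre (G p)) + \<phi> (hre (C.K p)) = \<phi> (hre (G p0)) + \<phi> (hre (C.K p0))"
    if lin: "linear \<phi>" and z: "\<phi> (central 1) = 0" and p: "p \<in> ball p0 \<epsilon>" for \<phi> :: "(real, 'n) heis \<Rightarrow> real" and p
  proof -
    have phiz: "\<phi> (central t) = 0" for t using linear_cmul[OF lin, of t "central 1"] z by (simp add: central_simps)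
    have Im0: "Im (N \<phi> g) = 0" if "g \<in> ball p0 \<epsilon>" for g
      unfolding ImN relb[OF that] by (simp add: linear_add[OF lin] phiz)
    have "(N \<phi> has_derivative (\<lambda>v. 0)) (at g)" if g: "g \<in> ball p0 \<epsilon>" for g
    proof -
      obtain D where D: "(N \<phi> has_derivative D) (at g)" "\<And>v. D (cscale \<i> v) = \<i> * D v" using N_hol[OF lin] by blast
      have "((\<lambda>x. Im (N \<phi> x)) has_derivative (\<lambda>v. Im (D v))) (at g)"
        by (rule bounded_linear.has_derivative[OF bounded_linear_Im D(1)])
      hence I: "Im (D v) = 0" for v
        by (rule directional_derivative_unique) (rule eventually_mono[OF near[OF g, of v]], simp add: Im0 Im0[OF g])
      have "Re (D v) = 0" for v using I[of "cscale \<i> v"] by (simp add: D(2))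
      hence "D = (\<lambda>v. 0)" using I by (auto simp: complex_eq_iff fun_eq_iff)
      thus ?thesis using D(1) by simp
    qed
    hence "\<exists>k. \<forall>g\<in>ball p0 \<epsilon>. N \<phi> g = k"
      by (intro has_derivative_zero_constant) (auto intro: has_derivative_at_withinI)
    then obtain k where "\<forall>g\<in>ball p0 \<epsilon>. N \<phi> g = k" by blast
    hence "N \<phi> p = N \<phi> p0" using p \<epsilon>(1) by simp
    from arg_cong[OF this, of Re] show ?thesis by (simp add: ReN)
  qed
  have p0c: "hre p0 \<in> c" "him p0 \<in> c" using C.K_in by (simp_all add: p0_def mem_complexify)
  have K_c: "C.K p = p" if "hre p \<in> c" "him p \<in> c" for p using that by (intro C.K_id) (simp add: mem_complexify)
  define \<kappa> where "\<kappa> = hre (G p0) - hre p0"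
  have ht_lin: "linear (ht :: (real, 'n) heis \<Rightarrow> real)" by (rule linearI) (simp_all add: ht_simps)
  \<comment> \<open>By the Cauchy-Riemann equations, the derivative of \<open>Re N\<close> along \<open>v\<close> is that of \<open>Im N\<close> along \<open>\<i> v\<close>.\<close>
  have grad: "\<exists>D. (N ht has_derivative D) (at (p0 + heis_of_real m)) \<and> Re (D (heis_of_real v)) = 2 * B m v - B \<kappa> v"
    if m: "m \<in> c" "p0 + heis_of_real m \<in> ball p0 \<epsilon>" and v: "v \<in> c" for m v
  proof -
    let ?p = "p0 + heis_of_real m"
    obtain D where D: "(N ht has_derivative D) (at ?p)" "\<And>v. D (cscale \<i> v) = \<i> * D v" using N_hol[OF ht_lin] by blast
    have Im_eq: "Im (N ht (?p + s *\<^sub>R cscale \<i> (heis_of_real v))) = - (B \<kappa> (him p0) - 2 * B m (him p0)) - s * (B \<kappa> v - 2 * B m v)"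
      if s: "?p + s *\<^sub>R cscale \<i> (heis_of_real v) \<in> ball p0 \<epsilon>" for s
    proof -
      let ?q = "?p + s *\<^sub>R cscale \<i> (heis_of_real v)"
      have q: "hre ?q = hre p0 + m" "him ?q = him p0 + s *\<^sub>R v" by (simp_all add: hre_simps him_simps)
      have Kq: "C.K ?q = ?q" unfolding q
        by (rule K_c) (unfold q, use p0c m(1) v in \<open>auto intro!: subspace_add[OF subspace_c] subspace_scale[OF subspace_c]\<close>)
      have lin: "linear (\<lambda>u. B u b)" for b by (rule linearI) (simp_all add: B_simps)
      have "B (hre (G ?q)) b + B (hre p0 + m) b = B (hre (G p0)) b + B (hre p0) b" for b
        using const[OF lin _ s, of b] Kq q(1) K_c[OF p0c] by (simp add: B_simps)
      hence b1: "B (hre (G ?q) - hre ?q) b = B \<kappa> b - 2 * B m b" for b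
        unfolding q \<kappa>_def by (simp add: B_simps algebra_simps)
      have "Im (N ht ?q) = - B (hre (G ?q) - hre ?q) (him ?q)"
        unfolding ImN relb[OF s] Kq by (simp add: ht_simps)
      also have "\<dots> = - (B \<kappa> (him p0 + s *\<^sub>R v) - 2 * B m (him p0 + s *\<^sub>R v))"
        by (simp only: b1 q(2))
      also have "\<dots> = - (B \<kappa> (him p0) - 2 * B m (him p0)) - s * (B \<kappa> v - 2 * B m v)"
        by (simp add: B_simps algebra_simps)
      finally show ?thesis .
    qed
    have "((\<lambda>x. Im (N ht x)) has_derivative (\<lambda>v. Im (D v))) (at ?p)"
      by (rule bounded_linear.has_derivative[OF bounded_linear_Im D(1)])
    hence "Im (D (cscale \<i> (heis_of_real v))) = - (B \<kappa> v - 2 * B m v)"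
    proof (rule directional_derivative_unique)
      have 0: "Im (N ht ?p) = - (B \<kappa> (him p0) - 2 * B m (him p0))" using Im_eq[of 0] m(2) by simp
      show "\<forall>\<^sub>F s in nhds 0. Im (N ht (?p + s *\<^sub>R cscale \<i> (heis_of_real v))) = Im (N ht ?p) + s *\<^sub>R - (B \<kappa> v - 2 * B m v)"
      proof (rule eventually_mono[OF near[OF m(2), of "cscale \<i> (heis_of_real v)"]])
        fix s :: real assume "?p + s *\<^sub>R cscale \<i> (heis_of_real v) \<in> ball p0 \<epsilon>"
        from Im_eq[OF this] show "Im (N ht (?p + s *\<^sub>R cscale \<i> (heis_of_real v)))
          = Im (N ht ?p) + s *\<^sub>R - (B \<kappa> v - 2 * B m v)"
            unfolding 0 real_scaleR_def mult_minus_right by linarith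
      qed
    qed
    thus ?thesis using D by auto
  qed
  define \<rho> where "\<rho> m = Re (N ht (p0 + heis_of_real m))" for m
  have incr: "\<rho> (m + \<delta> *\<^sub>R v) - \<rho> m = \<delta> * (2 * B m v - B \<kappa> v) + \<delta>\<^sup>2 * B v v"
    if \<delta>: "\<delta> > 0" and m: "m \<in> c" and v: "v \<in> c"
      and b: "\<And>s. 0 \<le> s \<Longrightarrow> s \<le> \<delta> \<Longrightarrow> p0 + heis_of_real (m + s *\<^sub>R v) \<in> ball p0 \<epsilon>" for \<delta> m v
  proof -
    let ?f = "\<lambda>s. \<rho> (m + s *\<^sub>R v) - s * (2 * B m v - B \<kappa> v) - s\<^sup>2 * B v v"
    have d: "(?f has_real_derivative 0) (at s)" if s: "0 \<le> s" "s \<le> \<delta>" for s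
    proof -
      have "m + s *\<^sub>R v \<in> c" using m v by (intro subspace_add[OF subspace_c] subspace_scale[OF subspace_c])
      then obtain D where D: "(N ht has_derivative D) (at (p0 + heis_of_real (m + s *\<^sub>R v)))"
        "Re (D (heis_of_real v)) = 2 * B (m + s *\<^sub>R v) v - B \<kappa> v"
        using grad[OF _ b[OF s] v] by blast
      have "((\<lambda>s. p0 + heis_of_real m + s *\<^sub>R heis_of_real v) has_derivative (\<lambda>t. t *\<^sub>R heis_of_real v)) (at s)"
        by (auto intro!: derivative_eq_intros)
      hence 1: "((\<lambda>s. p0 + heis_of_real (m + s *\<^sub>R v)) has_derivative (\<lambda>t. t *\<^sub>R heis_of_real v)) (at s)"
        by (simp add: heis_of_real_simps add.assoc)
      have "((\<lambda>s. \<rho> (m + s *\<^sub>R v)) has_derivative (\<lambda>t. Re (D (t *\<^sub>R heis_of_real v)))) (at s)"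
        unfolding \<rho>_def by (rule bounded_linear.has_derivative[OF bounded_linear_Re has_derivative_compose[OF 1 D(1)]])
      moreover have "Re (D (t *\<^sub>R heis_of_real v)) = (2 * B (m + s *\<^sub>R v) v - B \<kappa> v) * t" for t
        using linear_cmul[OF has_derivative_linear[OF D(1)]] D(2) by simp
      ultimately have "((\<lambda>s. \<rho> (m + s *\<^sub>R v)) has_real_derivative (2 * B (m + s *\<^sub>R v) v - B \<kappa> v)) (at s)"
        by (simp add: has_field_derivative_def)
      thus ?thesis by (auto intro!: derivative_eq_intros simp: B_simps algebra_simps)
    qed
    have "?f \<delta> = ?f 0"
    proof (rule DERIV_isconst_end[OF \<delta>])
      show "continuous_on {0..\<delta>} ?f"
        by (intro continuous_at_imp_continuous_on ballI) (use d in \<open>auto dest: DERIV_isCont\<close>)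
    qed (use d in auto)
    thus ?thesis by simp
  qed
  \<comment> \<open>Integrate the gradient along the two ways around a parallelogram with sides \<open>\<delta> v\<close> and \<open>\<delta> w\<close>.\<close>
  have sym: "B v w = B w v" if v: "v \<in> c" and w: "w \<in> c" for v w
  proof -
    let ?n = "1 + norm (heis_of_real v :: (complex, 'n) heis) + norm (heis_of_real w :: (complex, 'n) heis)"
    define \<delta> where "\<delta> = \<epsilon> / ?n"
    have n: "?n > 0" by (smt (verit) norm_ge_zero)
    hence \<delta>: "\<delta> > 0" using \<epsilon>(1) by (simp add: \<delta>_def)
    have bnd: "p0 + heis_of_real (s *\<^sub>R v + t *\<^sub>R w) \<in> ball p0 \<epsilon>" if "0 \<le> s" "s \<le> \<delta>" "0 \<le> t" "t \<le> \<delta>" for s t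
    proof -
      have "norm (heis_of_real (s *\<^sub>R v + t *\<^sub>R w) :: (complex, 'n) heis)
          \<le> s * norm (heis_of_real v :: (complex, 'n) heis) + t * norm (heis_of_real w :: (complex, 'n) heis)"
        using norm_triangle_ineq[of "s *\<^sub>R heis_of_real v" "t *\<^sub>R heis_of_real w :: (complex, 'n) heis"] that
        by (simp add: heis_of_real_simps)
      also have "\<dots> \<le> \<delta> * norm (heis_of_real v :: (complex, 'n) heis) + \<delta> * norm (heis_of_real w :: (complex, 'n) heis)"
        using that by (intro add_mono mult_right_mono) auto
      also have "\<dots> < \<delta> * ?n" using \<delta> by (simp add: algebra_simps)
      also have "\<dots> = \<epsilon>" using n by (simp add: \<delta>_def)
      finally show ?thesis by (simp add: dist_norm)
    qed
    have 0: "(0 :: (real, 'n) heis) \<in> c" by (rule subspace_0[OF subspace_c])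
    have vc: "\<delta> *\<^sub>R v \<in> c" "\<delta> *\<^sub>R w \<in> c" using v w by (auto intro: subspace_scale[OF subspace_c])
    have "\<rho> (0 + \<delta> *\<^sub>R v) - \<rho> 0 = \<delta> * (2 * B 0 v - B \<kappa> v) + \<delta>\<^sup>2 * B v v"
      by (rule incr[OF \<delta> 0 v]) (use bnd[of _ 0] \<delta> in simp)
    moreover have "\<rho> (\<delta> *\<^sub>R v + \<delta> *\<^sub>R w) - \<rho> (\<delta> *\<^sub>R v) = \<delta> * (2 * B (\<delta> *\<^sub>R v) w - B \<kappa> w) + \<delta>\<^sup>2 * B w w"
      by (rule incr[OF \<delta> vc(1) w]) (use bnd \<delta> in simp)
    moreover have "\<rho> (0 + \<delta> *\<^sub>R w) - \<rho> 0 = \<delta> * (2 * B 0 w - B \<kappa> w) + \<delta>\<^sup>2 * B w w"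
      by (rule incr[OF \<delta> 0 w]) (use bnd[of 0] \<delta> in simp)
    moreover have "\<rho> (\<delta> *\<^sub>R w + \<delta> *\<^sub>R v) - \<rho> (\<delta> *\<^sub>R w) = \<delta> * (2 * B (\<delta> *\<^sub>R w) v - B \<kappa> v) + \<delta>\<^sup>2 * B v v"
      by (rule incr[OF \<delta> vc(2) v]) (use bnd \<delta> in \<open>simp add: add.commute\<close>)
    moreover have "\<rho> (\<delta> *\<^sub>R w + \<delta> *\<^sub>R v) = \<rho> (\<delta> *\<^sub>R v + \<delta> *\<^sub>R w)" by (simp add: add.commute)
    moreover have B0: "B 0 b = 0" for b using B_simps(3)[of 0 0 b] by simp
    ultimately have "\<delta> * (2 * (\<delta> * B v w)) = \<delta> * (2 * (\<delta> * B w v))"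
      unfolding B_simps B0 right_diff_distrib add_0 mult_zero_right by linarith
    thus ?thesis using \<delta> by simp
  qed
  have iso: "symp a b = 0" if "a \<in> h" "b \<in> h" for a b
  proof -
    have "central (symp a b) = P (central (symp a b))" by (simp add: P_central)
    also have "\<dots> = 0" by (rule P_0[OF h_bracket[OF that]])
    finally show ?thesis using ht_central[of "symp a b"] ht_simps(5) by metis
  qed
  have dec: "l = P l + A (P l)" if "l \<in> q" for l using A_P[OF that] by (simp add: algebra_simps)
  have "symp u v = symp (P u + A (P u)) (P v + A (P v))" using dec uv by metis
  also have "\<dots> = symp (P u) (P v) + symp (A (P u)) (A (P v)) + (B (P u) (P v) - B (P v) (P u))"
    using symp_skew[of "P u" "A (P v)"] by (simp add: symp_simps B_def)
  also have "\<dots> = 0" using ab iso[OF A_in A_in] sym[OF P_in P_in] P_in by simp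
  finally show ?thesis .
qed

end

section \<open>Uniqueness of Fourier coefficients\<close>

lemma integrable_iexp_mult:
  fixes k :: "'a \<Rightarrow> complex"
  assumes "integrable M k" "X \<in> borel_measurable M"
  shows "integrable M (\<lambda>x. iexp (X x) * k x)"
proof (rule Bochner_Integration.integrable_bound[OF assms(1)])
  show "(\<lambda>x. iexp (X x) * k x) \<in> borel_measurable M"
    using assms by measurable
qed (simp add: norm_mult)

text \<open>The distributions of \<open>X\<close> under the normalized positive and negative parts of \<open>k\<close> have the same characteristic
  function, so they agree by the uniqueness theorem of Levy.\<close>

lemma fourier_uniqueness_real_density:
  fixes k :: "'a \<Rightarrow> real"
  assumes k: "integrable M k" and X[measurable]: "X \<in> borel_measurable M" and B: "B \<in> sets borel"
    and F: "\<And>s. (\<integral>x. iexp (s * X x) * complex_of_real (k x) \<partial>M) = 0"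
  shows "(\<integral>x. indicator B (X x) * k x \<partial>M) = 0"
proof -
  have k_meas[measurable]: "k \<in> borel_measurable M" using k by auto
  note B[measurable]
  define kp where "kp x = max 0 (k x)" for x
  define km where "km x = max 0 (- k x)" for x
  have kp: "integrable M kp" "\<And>x. 0 \<le> kp x" and km: "integrable M km" "\<And>x. 0 \<le> km x"
    using k by (auto simp: kp_def[abs_def] km_def[abs_def])
  have k_eq: "k x = kp x - km x" for x by (simp add: kp_def km_def)
  define a where "a = (\<integral>x. kp x \<partial>M)"
  have a_eq: "(\<integral>x. km x \<partial>M) = a"
  proof -
    have "(\<integral>x. complex_of_real (k x) \<partial>M) = 0" using F[of 0] by simp
    hence "(\<integral>x. k x \<partial>M) = 0" by (simp add: integral_complex_of_real)
    thus ?thesis unfolding k_eq a_def using kp km by (simp add: Bochner_Integration.integral_diff)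
  qed
  have a0: "0 \<le> a" unfolding a_def using kp by simp
  show ?thesis
  proof (cases "a = 0")
    case True
    have "AE x in M. kp x = 0" using integral_nonneg_eq_0_iff_AE[OF kp(1)] kp(2) True a_def by simp
    moreover have "AE x in M. km x = 0" using integral_nonneg_eq_0_iff_AE[OF km(1)] km(2) True a_eq by simp
    ultimately have "AE x in M. indicator B (X x) * k x = 0" by eventually_elim (simp add: k_eq)
    thus ?thesis by (rule integral_eq_zero_AE)
  next
    case False
    hence a: "a > 0" using a0 by simp
    define D where "D f = distr (density M (\<lambda>x. ennreal (f x / a))) borel X" for f :: "'a \<Rightarrow> real"
    have D: "real_distribution (D f)" "char (D f) s = (\<integral>x. iexp (s * X x) * complex_of_real (f x) \<partial>M) / a"
      "measure (D f) B = (\<integral>x. indicator B (X x) * f x \<partial>M) / a"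
      if f: "integrable M f" "\<And>x. 0 \<le> f x" "(\<integral>x. f x \<partial>M) = a" for f s
    proof -
      have fm[measurable]: "f \<in> borel_measurable M" using f(1) by auto
      have "emeasure (density M (\<lambda>x. ennreal (f x / a))) (space M) = (\<integral>\<^sup>+x. ennreal (f x / a) \<partial>M)"
        by (subst emeasure_density) (auto intro!: nn_integral_cong)
      also have "\<dots> = ennreal (\<integral>x. f x / a \<partial>M)"
        using f a by (intro nn_integral_eq_integral) auto
      also have "\<dots> = 1" using f a by simp
      finally have "prob_space (density M (\<lambda>x. ennreal (f x / a)))"
        by (intro prob_spaceI) simp
      thus "real_distribution (D f)" unfolding D_def
        by (intro prob_space.real_distribution_distr) auto
      show "char (D f) s = (\<integral>x. iexp (s * X x) * complex_of_real (f x) \<partial>M) / a"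
      proof -
        have "char (D f) s = (\<integral>x. (f x / a) *\<^sub>R iexp (s * X x) \<partial>M)"
          unfolding char_def D_def using f a
          by (subst integral_distr) (auto simp: integral_density)
        also have "\<dots> = (\<integral>x. iexp (s * X x) * complex_of_real (f x) / a \<partial>M)"
          by (intro Bochner_Integration.integral_cong) (auto simp: scaleR_conv_of_real)
        finally show ?thesis by simp
      qed
      show "measure (D f) B = (\<integral>x. indicator B (X x) * f x \<partial>M) / a"
      proof -
        interpret real_distribution "D f" by fact
        have "measure (D f) B = (\<integral>x. indicator B x \<partial>D f)" using B by simp
        also have "\<dots> = (\<integral>x. (f x / a) *\<^sub>R indicator B (X x) \<partial>M)"
          unfolding D_def using f a by (subst integral_distr) (auto simp: integral_density)
        also have "\<dots> = (\<integral>x. indicator B (X x) * f x / a \<partial>M)"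
          by (intro Bochner_Integration.integral_cong) auto
        finally show ?thesis by simp
      qed
    qed
    have "char (D kp) s = char (D km) s" for s
    proof -
      have I: "integrable M (\<lambda>x. iexp (s * X x) * complex_of_real (f x))"
        if "integrable M f" for f :: "'a \<Rightarrow> real"
        by (rule integrable_iexp_mult) (use that in \<open>auto simp del: of_real_mult\<close>)
      have "(\<integral>x. iexp (s * X x) * complex_of_real (kp x) \<partial>M)
          - (\<integral>x. iexp (s * X x) * complex_of_real (km x) \<partial>M)
          = (\<integral>x. iexp (s * X x) * complex_of_real (k x) \<partial>M)"
        by (subst Bochner_Integration.integral_diff[OF I[OF kp(1)] I[OF km(1)], symmetric])
          (simp add: k_eq right_diff_distrib)
      hence "(\<integral>x. iexp (s * X x) * complex_of_real (kp x) \<partial>M)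
          = (\<integral>x. iexp (s * X x) * complex_of_real (km x) \<partial>M)" using F[of s] by simp
      thus ?thesis using D(2)[OF kp a_def[symmetric]] D(2)[OF km a_eq] by simp
    qed
    hence "D kp = D km"
      using Levy_uniqueness D(1)[OF kp a_def[symmetric]] D(1)[OF km a_eq] by blast
    hence "(\<integral>x. indicator B (X x) * kp x \<partial>M) = (\<integral>x. indicator B (X x) * km x \<partial>M)"
      using D(3)[OF kp a_def[symmetric]] D(3)[OF km a_eq] a by simp
    moreover have "(\<integral>x. indicator B (X x) * k x \<partial>M) = (\<integral>x. indicator B (X x) * kp x \<partial>M) - (\<integral>x. indicator B (X x) * km x \<partial>M)"
    proof (subst Bochner_Integration.integral_diff[symmetric])
      show "integrable M (\<lambda>x. indicator B (X x) * kp x)" "integrable M (\<lambda>x. indicator B (X x) * km x)"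
        by (rule Bochner_Integration.integrable_bound[OF kp(1)] Bochner_Integration.integrable_bound[OF km(1)];
          use kp km in \<open>auto simp: indicator_def\<close>)+
    qed (simp add: k_eq algebra_simps)
    ultimately show ?thesis by simp
  qed
qed

text \<open>Conjugation replaces the frequency \<open>s\<close> by \<open>- s\<close>, so the coefficients of the real and imaginary parts vanish as well.\<close>

lemma fourier_uniqueness_1:
  fixes k :: "'a \<Rightarrow> complex"
  assumes k: "integrable M k" and X[measurable]: "X \<in> borel_measurable M" and B: "B \<in> sets borel"
    and F: "\<And>s. (\<integral>x. iexp (s * X x) * k x \<partial>M) = 0"
  shows "(\<integral>x. indicator B (X x) * k x \<partial>M) = 0"
proof -
  have k_meas[measurable]: "k \<in> borel_measurable M" using k by auto
  note B[measurable]
  have sX: "(\<lambda>x. s * X x) \<in> borel_measurable M" for s by measurable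
  have F': "(\<integral>x. iexp (s * X x) * cnj (k x) \<partial>M) = 0" for s
  proof -
    have "(\<integral>x. iexp (s * X x) * cnj (k x) \<partial>M)
        = (\<integral>x. cnj (iexp ((- s) * X x) * k x) \<partial>M)"
      by (intro Bochner_Integration.integral_cong) (auto simp: exp_cnj)
    also have "\<dots> = cnj (\<integral>x. iexp ((- s) * X x) * k x \<partial>M)" by (rule Bochner_Integration.integral_cnj)
    also have "\<dots> = 0" by (simp only: F) simp
    finally show ?thesis .
  qed
  have cnj_int: "integrable M (\<lambda>x. cnj (k x))" using k by simp
  note I = integrable_iexp_mult[OF k sX] integrable_iexp_mult[OF cnj_int sX]
  have "(\<integral>x. iexp (s * X x) * complex_of_real (Re (k x)) \<partial>M) = 0" for s
  proof -
    have "(\<integral>x. iexp (s * X x) * complex_of_real (Re (k x)) \<partial>M)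
      = (\<integral>x. (iexp (s * X x) * k x + iexp (s * X x) * cnj (k x)) / 2 \<partial>M)"
      by (intro Bochner_Integration.integral_cong) (auto simp: complex_add_cnj simp flip: distrib_left)
    thus ?thesis using I by (simp add: F F' del: of_real_mult)
  qed
  from fourier_uniqueness_real_density[OF _ X B this]
  have R: "(\<integral>x. indicator B (X x) * Re (k x) \<partial>M) = 0" using k by simp
  have "(\<integral>x. iexp (s * X x) * complex_of_real (Im (k x)) \<partial>M) = 0" for s
  proof -
    have "(\<integral>x. iexp (s * X x) * complex_of_real (Im (k x)) \<partial>M)
      = (\<integral>x. (iexp (s * X x) * k x - iexp (s * X x) * cnj (k x)) / (2 * \<i>) \<partial>M)"
    proof (intro Bochner_Integration.integral_cong refl)
      have "complex_of_real (Im z) = (z - cnj z) / (2 * \<i>)" for z by (rule complex_eqI) (simp_all add: Re_divide Im_divide power2_eq_square)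
      thus "iexp (s * X x) * complex_of_real (Im (k x))
        = (iexp (s * X x) * k x - iexp (s * X x) * cnj (k x)) / (2 * \<i>)" for x
        by (simp only: times_divide_eq_right right_diff_distrib)
    qed
    thus ?thesis using I by (simp add: F F' del: of_real_mult)
  qed
  from fourier_uniqueness_real_density[OF _ X B this]
  have Im0: "(\<integral>x. indicator B (X x) * Im (k x) \<partial>M) = 0" using k by simp
  have int: "integrable M (\<lambda>x. indicator B (X x) * k x)"
    by (rule Bochner_Integration.integrable_bound[OF k]) (auto simp: indicator_def)
  show ?thesis
  proof (rule complex_eqI)
    have e: "Re (indicator B (X x) * k x) = indicator B (X x) * Re (k x)"
      "Im (indicator B (X x) * k x) = indicator B (X x) * Im (k x)" for x
      by (auto split: split_indicator)
    show "Re (\<integral>x. indicator B (X x) * k x \<partial>M) = Re 0"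
      unfolding integral_Re[OF int, symmetric] e R by simp
    show "Im (\<integral>x. indicator B (X x) * k x \<partial>M) = Im 0"
      unfolding integral_Im[OF int, symmetric] e Im0 by simp
  qed
qed

text \<open>Several frequencies: localize one coordinate of \<open>Y\<close> after the other, keeping all frequencies in play.\<close>

lemma fourier_uniqueness_coordinates:
  fixes Y :: "'a \<Rightarrow> 'b::euclidean_space" and k :: "'a \<Rightarrow> complex"
  assumes k: "integrable M k" and Y[measurable]: "Y \<in> borel_measurable M"
    and F: "\<And>p. (\<integral>x. iexp (p \<bullet> Y x) * k x \<partial>M) = 0"
    and S: "finite S" "S \<subseteq> Basis" and I: "\<And>b. b \<in> S \<Longrightarrow> I b \<in> sets borel"
  shows "(\<integral>x. iexp (p \<bullet> Y x) * ((\<Prod>b\<in>S. indicator (I b) (Y x \<bullet> b)) * k x) \<partial>M) = 0"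
  using S I
proof (induction S arbitrary: p rule: finite_induct)
  case empty
  thus ?case using F by simp
next
  case (insert b S)
  have k_meas[measurable]: "k \<in> borel_measurable M" using k by auto
  have I_meas[measurable]: "I c \<in> sets borel" if "c \<in> S" for c using insert.prems that by auto
  have IH: "(\<integral>x. iexp (p \<bullet> Y x) * ((\<Prod>b\<in>S. indicator (I b) (Y x \<bullet> b)) * k x) \<partial>M) = 0" for p
    using insert by auto
  have prod_meas: "(\<lambda>x. (\<Prod>b\<in>S. indicator (I b) (Y x \<bullet> b)) :: complex) \<in> borel_measurable M"
    by (rule borel_measurable_prod) measurable
  have prod_le: "cmod (\<Prod>b\<in>S. indicator (I b) (Y x \<bullet> b)) \<le> 1" for x
    unfolding prod_norm[symmetric] by (rule prod_le_1) (auto simp: indicator_def)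
  have int: "integrable M (\<lambda>x. (\<Prod>b\<in>S. indicator (I b) (Y x \<bullet> b)) * k x)"
    using prod_meas prod_le
    by (intro Bochner_Integration.integrable_bound[OF k]) (auto simp: norm_mult intro!: mult_left_le_one_le)
  have int2: "integrable M (\<lambda>x. iexp (p \<bullet> Y x) * ((\<Prod>b\<in>S. indicator (I b) (Y x \<bullet> b)) * k x))"
    by (rule integrable_iexp_mult[OF int]) measurable
  have "(\<integral>x. indicator (I b) (Y x \<bullet> b) * (iexp (p \<bullet> Y x) * ((\<Prod>b\<in>S. indicator (I b) (Y x \<bullet> b)) * k x)) \<partial>M) = 0"
  proof (rule fourier_uniqueness_1[OF int2])
    show "(\<lambda>x. Y x \<bullet> b) \<in> borel_measurable M" by measurable
    show "I b \<in> sets borel" using insert.prems by auto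
    fix s
    have "(\<integral>x. iexp (s * (Y x \<bullet> b)) * (iexp (p \<bullet> Y x) * ((\<Prod>b\<in>S. indicator (I b) (Y x \<bullet> b)) * k x)) \<partial>M)
      = (\<integral>x. iexp ((p + s *\<^sub>R b) \<bullet> Y x) * ((\<Prod>b\<in>S. indicator (I b) (Y x \<bullet> b)) * k x) \<partial>M)"
    proof (intro Bochner_Integration.integral_cong refl)
      fix x
      have "iexp ((p + s *\<^sub>R b) \<bullet> Y x) = iexp (s * (Y x \<bullet> b)) * iexp (p \<bullet> Y x)"
        by (simp add: inner_add_left inner_commute[of b] distrib_left exp_add)
      thus "iexp (s * (Y x \<bullet> b)) * (iexp (p \<bullet> Y x) * ((\<Prod>b\<in>S. indicator (I b) (Y x \<bullet> b)) * k x))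
        = iexp ((p + s *\<^sub>R b) \<bullet> Y x) * ((\<Prod>b\<in>S. indicator (I b) (Y x \<bullet> b)) * k x)"
        by (simp add: mult.assoc)
    qed
    thus "(\<integral>x. iexp (s * (Y x \<bullet> b)) * (iexp (p \<bullet> Y x) * ((\<Prod>b\<in>S. indicator (I b) (Y x \<bullet> b)) * k x)) \<partial>M) = 0"
      using IH by simp
  qed
  moreover have e: "iexp (p \<bullet> Y x) * ((\<Prod>b\<in>insert b S. indicator (I b) (Y x \<bullet> b)) * k x)
    = indicator (I b) (Y x \<bullet> b) * (iexp (p \<bullet> Y x) * ((\<Prod>b\<in>S. indicator (I b) (Y x \<bullet> b)) * k x))" for x
    unfolding prod.insert[OF insert.hyps] by (simp only: mult_ac)
  ultimately show ?case by (simp only: e)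
qed

text \<open>Boxes are handled coordinate by coordinate, and they generate the Borel sets.\<close>

lemma fourier_uniqueness:
  fixes Y :: "'a \<Rightarrow> 'b::euclidean_space" and k :: "'a \<Rightarrow> complex"
  assumes k: "integrable M k" and Y[measurable]: "Y \<in> borel_measurable M"
    and F: "\<And>p. (\<integral>x. iexp (p \<bullet> Y x) * k x \<partial>M) = 0"
    and B: "B \<in> sets borel"
  shows "(\<integral>x. indicator B (Y x) * k x \<partial>M) = 0"
proof -
  let ?G = "range (\<lambda>(a, b). box a b :: 'b set)"
  have k_meas[measurable]: "k \<in> borel_measurable M" using k by auto
  have sB: "sigma_sets UNIV ?G = sets borel" by (simp add: borel_eq_box)
  have int: "integrable M (\<lambda>x. indicator A (Y x) * k x)" if [measurable]: "A \<in> sets borel" for A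
    by (rule Bochner_Integration.integrable_bound[OF k]) (auto simp: indicator_def)
  have "B \<in> sigma_sets UNIV ?G" using B sB by simp
  thus ?thesis
  proof (rule sigma_sets_induct_disjoint[rotated 2])
    show "Int_stable ?G"
      by (auto simp: Int_stable_def box_Int_box)
    show "?G \<subseteq> Pow UNIV" by simp
    show "(\<integral>x. indicator {} (Y x) * k x \<partial>M) = 0" by simp
  next
    fix A assume "A \<in> ?G"
    then obtain u v where A: "A = box u v" by auto
    have "(\<integral>x. iexp (0 \<bullet> Y x) * ((\<Prod>b\<in>Basis. indicator {u \<bullet> b<..<v \<bullet> b} (Y x \<bullet> b)) * k x) \<partial>M) = 0"
      by (rule fourier_uniqueness_coordinates[OF k Y F]) auto
    moreover have "(\<Prod>b\<in>Basis. indicator {u \<bullet> b<..<v \<bullet> b} (y \<bullet> b)) = (indicator A y :: complex)" for y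
      unfolding A by (auto simp: indicator_def mem_box intro!: prod.neutral)
    ultimately show "(\<integral>x. indicator A (Y x) * k x \<partial>M) = 0" by simp
  next
    fix A assume "A \<in> sigma_sets UNIV ?G" and z: "(\<integral>x. indicator A (Y x) * k x \<partial>M) = 0"
    hence A: "A \<in> sets borel" using sB by simp
    have "(\<integral>x. indicator (UNIV - A) (Y x) * k x \<partial>M) = (\<integral>x. k x - indicator A (Y x) * k x \<partial>M)"
      by (intro Bochner_Integration.integral_cong) (auto simp: indicator_def)
    also have "\<dots> = (\<integral>x. k x \<partial>M)" using z int[OF A] k by (subst Bochner_Integration.integral_diff) auto
    also have "\<dots> = 0" using F[of 0] by simp
    finally show "(\<integral>x. indicator (UNIV - A) (Y x) * k x \<partial>M) = 0" .
  next
    fix A :: "nat \<Rightarrow> 'b set" assume dis: "disjoint_family A" and A: "range A \<subseteq> sigma_sets UNIV ?G"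
      and z: "\<And>i. (\<integral>x. indicator (A i) (Y x) * k x \<partial>M) = 0"
    have Am[measurable]: "A i \<in> sets borel" for i using A sB by auto
    have ind: "indicator T (Y x) * k x = indicator (Y -` T \<inter> space M) x *\<^sub>R k x" if "x \<in> space M" for T x
      using that by (auto simp: indicator_def)
    have z': "(LINT x:(Y -` A i \<inter> space M)|M. k x) = 0" for i
      using z[of i] unfolding set_lebesgue_integral_def by (simp add: ind cong: Bochner_Integration.integral_cong)
    have "(LINT x:(\<Union>i. Y -` A i \<inter> space M)|M. k x) = (\<Sum>i. (LINT x:(Y -` A i \<inter> space M)|M. k x))"
    proof (rule lebesgue_integral_countable_add)
      show "Y -` A i \<inter> space M \<in> sets M" for i by measurable
      show "(Y -` A i \<inter> space M) \<inter> (Y -` A j \<inter> space M) = {}" if "i \<noteq> j" for i j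
        using dis that by (auto simp: disjoint_family_on_def)
      show "set_integrable M (\<Union>i. Y -` A i \<inter> space M) k"
        unfolding set_integrable_def by (rule integrable_mult_indicator[OF _ k]) measurable
    qed
    hence "(LINT x:(Y -` (\<Union>i. A i) \<inter> space M)|M. k x) = 0" by (simp add: z' vimage_UN)
    thus "(\<integral>x. indicator (\<Union>i. A i) (Y x) * k x \<partial>M) = 0"
      unfolding set_lebesgue_integral_def by (simp add: ind cong: Bochner_Integration.integral_cong)
  qed
qed


section \<open>Isometries between spaces of square integrable functions\<close>

lemma L2D: "f \<in> L2 M \<Longrightarrow> f \<in> borel_measurable M" "f \<in> L2 M \<Longrightarrow> sq_norm M f < \<infinity>"
  by (simp_all add: L2_def)

lemma borel_measurable_cnj [measurable (raw)]:
  assumes "f \<in> borel_measurable M"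
  shows "(\<lambda>x. cnj (f x)) \<in> borel_measurable M"
  by (rule measurable_compose[OF assms]) (intro borel_measurable_continuous_onI continuous_intros)

lemma L2_integrable_sq: assumes "f \<in> L2 M" shows "integrable M (\<lambda>x. (cmod (f x))\<^sup>2)"
  using L2D[OF assms] by (intro integrableI_nonneg) (auto simp: sq_norm_def)

lemma L2_sq_norm: assumes "f \<in> L2 M" shows "sq_norm M f = ennreal (\<integral>x. (cmod (f x))\<^sup>2 \<partial>M)"
  unfolding sq_norm_def using L2_integrable_sq[OF assms] by (intro nn_integral_eq_integral) auto

lemma L2_mult_integrable:
  assumes "f \<in> L2 M" "g \<in> L2 M"
  shows "integrable M (\<lambda>x. f x * cnj (g x))"
proof (rule Bochner_Integration.integrable_bound)
  show "integrable M (\<lambda>x. (cmod (f x))\<^sup>2 + (cmod (g x))\<^sup>2)"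
    using assms by (intro Bochner_Integration.integrable_add L2_integrable_sq)
  show "(\<lambda>x. f x * cnj (g x)) \<in> borel_measurable M" using L2D(1)[OF assms(1)] L2D(1)[OF assms(2)] by measurable
  have "a * b \<le> a\<^sup>2 + b\<^sup>2" if "0 \<le> a" "0 \<le> b" for a b :: real
    using sum_squares_bound[of a b] that mult_nonneg_nonneg[OF that] by linarith
  thus "AE x in M. norm (f x * cnj (g x)) \<le> norm ((cmod (f x))\<^sup>2 + (cmod (g x))\<^sup>2)"
    by (simp add: norm_mult)
qed

lemma sq_norm_cong_AE:
  assumes "AE x in M. f x = g x"
  shows "sq_norm M f = sq_norm M g"
  unfolding sq_norm_def by (intro nn_integral_cong_AE) (use assms in eventually_elim, simp)

lemma L2_add:
  assumes "f \<in> L2 M" "g \<in> L2 M"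
  shows "(\<lambda>x. f x + g x) \<in> L2 M"
    "(\<integral>x. (cmod (f x + g x))\<^sup>2 \<partial>M) = (\<integral>x. (cmod (f x))\<^sup>2 \<partial>M) + (\<integral>x. (cmod (g x))\<^sup>2 \<partial>M) + 2 * Re (\<integral>x. f x * cnj (g x) \<partial>M)"
proof -
  have e: "(cmod (f x + g x))\<^sup>2 = (cmod (f x))\<^sup>2 + (cmod (g x))\<^sup>2 + 2 * Re (f x * cnj (g x))" for x
    by (simp add: cmod_power2 power2_sum algebra_simps)
  have meas: "(\<lambda>x. f x + g x) \<in> borel_measurable M" using L2D(1)[OF assms(1)] L2D(1)[OF assms(2)] by measurable
  note int = L2_integrable_sq[OF assms(1)] L2_integrable_sq[OF assms(2)] L2_mult_integrable[OF assms]
  have re: "integrable M (\<lambda>x. 2 * Re (f x * cnj (g x)))"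
    by (intro integrable_mult_right integrable_Re int)
  have i: "integrable M (\<lambda>x. (cmod (f x + g x))\<^sup>2)" unfolding e
    by (intro Bochner_Integration.integrable_add re int)
  have "sq_norm M (\<lambda>x. f x + g x) = ennreal (\<integral>x. (cmod (f x + g x))\<^sup>2 \<partial>M)"
    unfolding sq_norm_def using i by (intro nn_integral_eq_integral) auto
  thus "(\<lambda>x. f x + g x) \<in> L2 M" using meas by (simp add: L2_def)
  show "(\<integral>x. (cmod (f x + g x))\<^sup>2 \<partial>M) = (\<integral>x. (cmod (f x))\<^sup>2 \<partial>M) + (\<integral>x. (cmod (g x))\<^sup>2 \<partial>M) + 2 * Re (\<integral>x. f x * cnj (g x) \<partial>M)"
    unfolding e using int re
    by (simp only: Bochner_Integration.integral_add Bochner_Integration.integrable_add integral_mult_right_zero integral_Re)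
qed

lemma L2_cmult:
  assumes "f \<in> L2 M"
  shows "(\<lambda>x. a * f x) \<in> L2 M"
proof -
  note [measurable] = L2D(1)[OF assms]
  have "sq_norm M (\<lambda>x. a * f x) = ennreal ((cmod a)\<^sup>2) * sq_norm M f"
    unfolding sq_norm_def by (subst nn_integral_cmult[symmetric]) (auto simp: norm_mult power_mult_distrib ennreal_mult')
  thus ?thesis using L2D[OF assms] by (auto simp: L2_def ennreal_mult_less_top)
qed

text \<open>Polarization: compare the norms of \<open>a f + g\<close> for \<open>a = 1\<close> and \<open>a = \<i>\<close>.\<close>

lemma isometry_preserves_inner:
  assumes J: "\<And>f. f \<in> L2 M \<Longrightarrow> J f \<in> borel_measurable N" "\<And>f. f \<in> L2 M \<Longrightarrow> sq_norm N (J f) = sq_norm M f"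
    and lin: "\<And>f g a. f \<in> L2 M \<Longrightarrow> g \<in> L2 M \<Longrightarrow> AE x in N. J (\<lambda>x. a * f x + g x) x = a * J f x + J g x"
    and f: "f \<in> L2 M" and g: "g \<in> L2 M"
  shows "(\<integral>x. J f x * cnj (J g x) \<partial>N) = (\<integral>x. f x * cnj (g x) \<partial>M)"
proof -
  have JL2: "J f \<in> L2 N" if "f \<in> L2 M" for f using J[OF that] L2D(2)[OF that] by (simp add: L2_def)
  have norm_eq: "(\<integral>x. (cmod (J f x))\<^sup>2 \<partial>N) = (\<integral>x. (cmod (f x))\<^sup>2 \<partial>M)" if "f \<in> L2 M" for f
    using J(2)[OF that] L2_sq_norm[OF that] L2_sq_norm[OF JL2[OF that]] by (simp add: integral_nonneg_AE)
  have re: "Re (a * (\<integral>x. J f x * cnj (J g x) \<partial>N)) = Re (a * (\<integral>x. f x * cnj (g x) \<partial>M))" if a: "cmod a = 1" for a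
  proof -
    have af: "(\<lambda>x. a * f x) \<in> L2 M" "(\<lambda>x. a * J f x) \<in> L2 N" using f JL2 L2_cmult by blast+
    note sum = L2_add(1)[OF af(1) g]
    have "sq_norm N (\<lambda>x. a * J f x + J g x) = sq_norm N (J (\<lambda>x. a * f x + g x))"
      by (rule sq_norm_cong_AE) (use lin[OF f g, of a] in eventually_elim, simp)
    also have "\<dots> = sq_norm M (\<lambda>x. a * f x + g x)" by (rule J(2)[OF sum])
    finally have "(\<integral>x. (cmod (a * J f x + J g x))\<^sup>2 \<partial>N) = (\<integral>x. (cmod (a * f x + g x))\<^sup>2 \<partial>M)"
      using L2_sq_norm[OF sum] L2_sq_norm[OF L2_add(1)[OF af(2) JL2[OF g]]] by (simp add: integral_nonneg_AE)
    thus ?thesis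
      using norm_eq[OF f] norm_eq[OF g] a
      by (simp add: L2_add(2)[OF af(1) g] L2_add(2)[OF af(2) JL2[OF g]] norm_mult mult.assoc)
  qed
  show ?thesis using re[of 1] re[of \<i>] by (intro complex_eqI) simp_all
qed

text \<open>The pointwise reason why multiplication operators commute: for \<open>z \<noteq> 0\<close> the hypotheses say that both sides are
  \<open>z\<close> times the unimodular factors \<open>z1 / z\<close> and \<open>z2 / z\<close>.\<close>

lemma unimodular_multipliers_commute:
  fixes z z1 z2 z12 z21 :: complex
  assumes "z1 * cnj z1 = z * cnj z" "z2 * cnj z2 = z * cnj z"
    and "z12 * cnj z1 = z2 * cnj z" "z21 * cnj z2 = z1 * cnj z"
    and "z12 * cnj z12 = z2 * cnj z2" "z21 * cnj z21 = z1 * cnj z1"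
  shows "z12 = z21"
proof (cases "z = 0")
  case True
  thus ?thesis using assms by simp
next
  case False
  have "z12 * (z * cnj z) = (z12 * cnj z1) * z1" unfolding assms(1)[symmetric] by (simp only: mult_ac)
  also have "\<dots> = (z1 * cnj z) * z2" unfolding assms(3) by (simp only: mult_ac)
  also have "\<dots> = z21 * (z2 * cnj z2)" unfolding assms(4)[symmetric] by (simp only: mult_ac)
  finally have "z12 * (z * cnj z) = z21 * (z * cnj z)" unfolding assms(2) .
  thus ?thesis using False by simp
qed

section \<open>Measure preserving maps\<close>

definition measure_preserving_map :: "'a measure \<Rightarrow> ('a \<Rightarrow> 'a) \<Rightarrow> bool" where
  "measure_preserving_map M R \<longleftrightarrow> R \<in> measurable M M \<and> distr M M R = M"

lemma measure_preserving_mapI: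
  assumes R: "R \<in> measurable M M"
    and nn: "\<And>f. f \<in> borel_measurable M \<Longrightarrow> (\<integral>\<^sup>+x. f (R x) \<partial>M) = (\<integral>\<^sup>+x. f x \<partial>M)"
  shows "measure_preserving_map M R"
proof -
  have "distr M M R = M"
  proof (rule measure_eqI)
    fix A assume "A \<in> sets (distr M M R)"
    hence A: "A \<in> sets M" by simp
    have "emeasure (distr M M R) A = (\<integral>\<^sup>+x. indicator A x \<partial>distr M M R)" using A by simp
    also have "\<dots> = (\<integral>\<^sup>+x. indicator A (R x) \<partial>M)" using A R by (intro nn_integral_distr) auto
    also have "\<dots> = (\<integral>\<^sup>+x. indicator A x \<partial>M)" using A by (intro nn) auto
    finally show "emeasure (distr M M R) A = emeasure M A" using A by simp
  qed simp
  thus ?thesis using R by (simp add: measure_preserving_map_def)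
qed

lemma nn_integral_measure_preserving:
  assumes "measure_preserving_map M R" "f \<in> borel_measurable M"
  shows "(\<integral>\<^sup>+x. f (R x) \<partial>M) = (\<integral>\<^sup>+x. f x \<partial>M)"
  using nn_integral_distr[of R M M f] assms by (simp add: measure_preserving_map_def)

lemma L2_measure_preserving:
  assumes R: "measure_preserving_map M R" and f: "f \<in> L2 M"
  shows "(\<lambda>x. f (R x)) \<in> L2 M"
proof -
  have m: "(\<lambda>x. f (R x)) \<in> borel_measurable M"
    using L2D(1)[OF f] R by (auto simp: measure_preserving_map_def intro: measurable_compose)
  have "(\<lambda>x. ennreal ((cmod (f x))\<^sup>2)) \<in> borel_measurable M" using L2D(1)[OF f] by measurable
  from nn_integral_measure_preserving[OF R this] have "sq_norm M (\<lambda>x. f (R x)) = sq_norm M f" by (simp add: sq_norm_def)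
  thus ?thesis using m L2D(2)[OF f] by (simp add: L2_def)
qed

lemma inner_measure_preserving:
  assumes R: "measure_preserving_map M R" and f: "f \<in> L2 M" and g: "g \<in> L2 M"
  shows "(\<integral>x. f (R x) * cnj (g (R x)) \<partial>M) = (\<integral>x. f x * cnj (g x) \<partial>M)"
proof -
  have "(\<lambda>x. f x * cnj (g x)) \<in> borel_measurable M" using L2D(1)[OF f] L2D(1)[OF g] by measurable
  thus ?thesis using integral_distr[of R M M "\<lambda>x. f x * cnj (g x)"] R by (simp add: measure_preserving_map_def)
qed


section \<open>Intertwining operators of a multiplicity-free representation commute\<close>

text \<open>A direct integral with multiplicities at most one is realized in one \<open>L\<^sup>2\<close> space over pairs \<open>(\<xi>, t)\<close>. Characters
  live on a single point; they are spread out over a unit cube, on which the section is taken to be constant.\<close>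

definition di_weight :: "((real, 'n::finite) heis \<Rightarrow> enat) \<Rightarrow> (real, 'n) heis \<times> (real ^ 'n) \<Rightarrow> ennreal" where
  "di_weight m p = (if 0 < m (fst p) then if ht (fst p) = 0 then indicator (cbox 0 One) (snd p) else 1 else 0)"

definition di_space :: "(real, 'n::finite) heis measure \<Rightarrow> ((real, 'n) heis \<Rightarrow> enat) \<Rightarrow> ((real, 'n) heis \<times> (real ^ 'n)) measure" where
  "di_space \<mu> m = density (\<mu> \<Otimes>\<^sub>M lborel) (di_weight m)"

definition di_fun :: "'n::finite hsection \<Rightarrow> (real, 'n) heis \<times> (real ^ 'n) \<Rightarrow> complex" where
  "di_fun F p = (if ht (fst p) = 0 then F (fst p) 0 0 else F (fst p) 0 (snd p))"

lemma ht_measurable [measurable]: "ht \<in> borel_measurable (borel :: (real, 'n::finite) heis measure)"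
  unfolding ht_def[abs_def] by (intro borel_measurable_continuous_onI continuous_intros)

lemma tau_base_ht: "tau_base \<xi> = (if ht \<xi> = 0 then return borel 0 else lborel)"
  by (simp add: tau_base_def ht_def case_prod_beta)

text \<open>The joint spectrum of the subgroup of the \<open>y\<close> and \<open>z\<close> directions.\<close>

definition di_frequency :: "(real, 'n::finite) heis \<times> (real ^ 'n) \<Rightarrow> real \<times> (real ^ 'n)" where
  "di_frequency p = (ht (fst p), if ht (fst p) = 0 then fst (snd (fst p)) else - ht (fst p) *\<^sub>R snd p)"

lemma di_fun_tau:
  "di_fun (\<lambda>\<xi> k. tau \<xi> (0, y, z) (F \<xi> k)) p = iexp ((z, y) \<bullet> di_frequency p) * di_fun F p"
  by (simp add: di_fun_def di_frequency_def tau_def ht_def case_prod_beta inner_commute[of y] algebra_simps)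

context
  fixes \<mu> :: "(real, 'n::finite) heis measure" and m :: "(real, 'n) heis \<Rightarrow> enat"
  assumes sets_mu: "sets \<mu> = sets borel" and sf: "sigma_finite_measure \<mu>"
    and m_meas: "m \<in> measurable \<mu> (count_space UNIV)" and m_le: "AE \<xi> in \<mu>. m \<xi> \<le> 1"
begin

interpretation mu: sigma_finite_measure \<mu> by (rule sf)
interpretation pair_sigma_finite \<mu> lborel ..

lemma sets_pair: "sets (\<mu> \<Otimes>\<^sub>M lborel) = sets (borel \<Otimes>\<^sub>M borel)"
  by (rule sets_pair_measure_cong[OF sets_mu sets_lborel])

lemma sets_di_space: "sets (di_space \<mu> m) = sets (borel \<Otimes>\<^sub>M borel)"
  unfolding di_space_def sets_density by (rule sets_pair)

lemma measurable_pair: "borel_measurable (\<mu> \<Otimes>\<^sub>M lborel) = borel_measurable (borel \<Otimes>\<^sub>M borel)"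
  by (rule measurable_cong_sets[OF sets_pair refl])

lemma measurable_di_space: "borel_measurable (di_space \<mu> m) = borel_measurable (borel \<Otimes>\<^sub>M borel)"
  by (rule measurable_cong_sets[OF sets_di_space refl])

lemma di_weight_measurable: "di_weight m \<in> borel_measurable (\<mu> \<Otimes>\<^sub>M lborel)"
proof -
  note m_meas[measurable]
  have ht[measurable]: "ht \<in> borel_measurable \<mu>" using ht_measurable measurable_cong_sets[OF sets_mu refl] by blast
  show ?thesis unfolding di_weight_def[abs_def] by measurable
qed

lemma di_fun_measurable:
  fixes F :: "'n hsection"
  assumes F: "(\<lambda>(\<xi>, k, t). F \<xi> k t) \<in> borel_measurable (borel \<Otimes>\<^sub>M count_space UNIV \<Otimes>\<^sub>M borel)"
  shows "di_fun F \<in> borel_measurable (borel \<Otimes>\<^sub>M borel)"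
proof -
  have 1: "(\<lambda>p. (fst p, 0 :: nat, g p)) \<in> measurable (borel \<Otimes>\<^sub>M borel) (borel \<Otimes>\<^sub>M count_space UNIV \<Otimes>\<^sub>M borel)"
    if "g \<in> measurable (borel \<Otimes>\<^sub>M borel) borel" for g :: "(real, 'n) heis \<times> (real ^ 'n) \<Rightarrow> real ^ 'n"
    using that by measurable
  have [measurable]: "(\<lambda>p. F (fst p) 0 0) \<in> borel_measurable (borel \<Otimes>\<^sub>M borel :: ((real, 'n) heis \<times> (real ^ 'n)) measure)"
    using measurable_compose[OF 1[of "\<lambda>p. 0"] F] by simp
  have [measurable]: "(\<lambda>p. F (fst p) 0 (snd p)) \<in> borel_measurable (borel \<Otimes>\<^sub>M borel)"
    using measurable_compose[OF 1[of snd] F] by simp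
  show ?thesis unfolding di_fun_def[abs_def] by measurable
qed

text \<open>The cube has volume one, so the constant extension of a section over it has the norm of the section at the point.\<close>

lemma sq_norm_di_fun:
  fixes F :: "'n hsection"
  assumes F: "(\<lambda>(\<xi>, k, t). F \<xi> k t) \<in> borel_measurable (borel \<Otimes>\<^sub>M count_space UNIV \<Otimes>\<^sub>M borel)"
  shows "sq_norm (di_space \<mu> m) (di_fun F) = di_sq_norm \<mu> m F"
proof -
  have meas: "di_fun F \<in> borel_measurable (\<mu> \<Otimes>\<^sub>M lborel)" using di_fun_measurable[OF F] by (simp only: measurable_pair)
  note [measurable] = meas di_weight_measurable
  have F0: "F \<xi> 0 \<in> borel_measurable borel" for \<xi>
  proof -
    have "(\<lambda>t. (\<xi>, 0 :: nat, t)) \<in> measurable borel (borel \<Otimes>\<^sub>M count_space UNIV \<Otimes>\<^sub>M borel)" by measurable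
    from measurable_compose[OF this F] show ?thesis by simp
  qed
  have "sq_norm (di_space \<mu> m) (di_fun F) = (\<integral>\<^sup>+p. di_weight m p * ennreal ((cmod (di_fun F p))\<^sup>2) \<partial>(\<mu> \<Otimes>\<^sub>M lborel))"
    unfolding sq_norm_def di_space_def by (rule nn_integral_density) measurable
  also have "\<dots> = (\<integral>\<^sup>+\<xi>. \<integral>\<^sup>+t. di_weight m (\<xi>, t) * ennreal ((cmod (di_fun F (\<xi>, t)))\<^sup>2) \<partial>lborel \<partial>\<mu>)"
    by (rule lborel.nn_integral_fst[symmetric]) measurable
  also have "\<dots> = di_sq_norm \<mu> m F"
    unfolding di_sq_norm_def
  proof (rule nn_integral_cong_AE)
    have "(\<integral>\<^sup>+t. di_weight m (\<xi>, t) * ennreal ((cmod (di_fun F (\<xi>, t)))\<^sup>2) \<partial>lborel)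
        = (\<Sum>k. if enat k < m \<xi> then sq_norm (tau_base \<xi>) (F \<xi> k) else 0)" if le: "m \<xi> \<le> 1" for \<xi>
    proof -
      have "\<not> enat k < m \<xi>" if "k \<noteq> 0" for k
      proof
        assume "enat k < m \<xi>"
        hence "enat k < 1" using le by (rule less_le_trans)
        thus False using that by (simp add: one_enat_def)
      qed
      hence "(\<Sum>k. if enat k < m \<xi> then sq_norm (tau_base \<xi>) (F \<xi> k) else 0)
          = (\<Sum>k\<in>{0}. if enat k < m \<xi> then sq_norm (tau_base \<xi>) (F \<xi> k) else 0)"
        by (intro suminf_finite) auto
      also have "\<dots> = (if 0 < m \<xi> then sq_norm (tau_base \<xi>) (F \<xi> 0) else 0)" by (simp add: zero_enat_def)
      also have "\<dots> = (\<integral>\<^sup>+t. di_weight m (\<xi>, t) * ennreal ((cmod (di_fun F (\<xi>, t)))\<^sup>2) \<partial>lborel)"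
      proof (cases "ht \<xi> = 0")
        case True
        have cube: "emeasure lborel (cbox 0 One :: (real ^ 'n) set) = 1"
          by (simp add: emeasure_lborel_cbox_eq)
        have "sq_norm (tau_base \<xi>) (F \<xi> 0) = ennreal ((cmod (F \<xi> 0 0))\<^sup>2)"
          using F0[of \<xi>] True unfolding sq_norm_def tau_base_ht
          by (simp add: nn_integral_return)
        also have "\<dots> = (\<integral>\<^sup>+t. indicator (cbox 0 One :: (real ^ 'n) set) t * ennreal ((cmod (F \<xi> 0 0))\<^sup>2) \<partial>lborel)"
          by (subst nn_integral_multc) (auto simp: cube)
        finally show ?thesis using True by (simp add: di_weight_def di_fun_def)
      next
        case False
        thus ?thesis by (simp add: di_weight_def di_fun_def sq_norm_def tau_base_ht)
      qed
      finally show ?thesis by simp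
    qed
    thus "AE \<xi> in \<mu>. (\<integral>\<^sup>+t. di_weight m (\<xi>, t) * ennreal ((cmod (di_fun F (\<xi>, t)))\<^sup>2) \<partial>lborel)
        = (\<Sum>k. if enat k < m \<xi> then sq_norm (tau_base \<xi>) (F \<xi> k) else 0)"
      using m_le by (auto elim!: eventually_mono)
  qed
  finally show ?thesis .
qed

lemma sigma_finite_di_space: "sigma_finite_measure (di_space \<mu> m)"
proof -
  have "AE p in \<mu> \<Otimes>\<^sub>M lborel. di_weight m p \<noteq> \<infinity>"
    by (rule AE_I2) (simp add: di_weight_def indicator_def)
  thus ?thesis unfolding di_space_def
    using sigma_finite_measure.sigma_finite_iff_density_finite[OF _ di_weight_measurable] sigma_finite_measure_axioms by blast
qed

lemma di_frequency_measurable: "di_frequency \<in> borel_measurable (di_space \<mu> m)"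
proof -
  have h: "(\<lambda>p. ht (fst p)) \<in> borel_measurable (borel \<Otimes>\<^sub>M borel :: ((real, 'n) heis \<times> (real ^ 'n)) measure)"
    by (rule measurable_compose[OF measurable_fst ht_measurable])
  have y: "(\<lambda>p. fst (snd (fst p))) \<in> borel_measurable (borel \<Otimes>\<^sub>M borel :: ((real, 'n) heis \<times> (real ^ 'n)) measure)"
    by (rule measurable_compose[OF measurable_fst]) (intro borel_measurable_continuous_onI continuous_intros)
  have "{p \<in> space (borel \<Otimes>\<^sub>M borel :: ((real, 'n) heis \<times> (real ^ 'n)) measure). ht (fst p) = 0} \<in> sets (borel \<Otimes>\<^sub>M borel)"
    using h by measurable
  hence "(di_frequency :: (real, 'n) heis \<times> (real ^ 'n) \<Rightarrow> _) \<in> borel_measurable (borel \<Otimes>\<^sub>M borel)"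
    unfolding di_frequency_def[abs_def]
    by (intro borel_measurable_Pair measurable_If borel_measurable_scaleR borel_measurable_uminus h y measurable_snd)
  thus ?thesis by (simp only: measurable_di_space)
qed

text \<open>On the infinite-dimensional part the frequencies separate points, so vanishing Fourier coefficients force a
  density to vanish there.\<close>

lemma vanishing_of_fourier:
  assumes cross: "AE \<xi> in \<mu>. \<xi> \<in> cross_section" and k: "integrable (di_space \<mu> m) k"
    and F: "\<And>y z. (\<integral>p. iexp ((z, y) \<bullet> di_frequency p) * k p \<partial>di_space \<mu> m) = 0"
  shows "AE p in di_space \<mu> m. ht (fst p) \<noteq> 0 \<longrightarrow> k p = 0"
proof -
  let ?N = "di_space \<mu> m"
  interpret N: sigma_finite_measure ?N by (rule sigma_finite_di_space)
  have ht_m: "(\<lambda>p. ht (fst p)) \<in> borel_measurable ?N"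
    unfolding measurable_di_space by measurable
  note [measurable] = ht_m di_frequency_measurable
  have k_meas[measurable]: "k \<in> borel_measurable ?N" using k by auto
  have crossN: "AE p in ?N. fst p \<in> cross_section"
  proof -
    have cs: "(cross_section :: (real, 'n) heis set) = {\<xi>. ht \<xi> = 0 \<or> \<xi> = central (ht \<xi>)}"
      by (auto simp: cross_section_def ht_def central_def)
    have c1: "(\<lambda>\<xi>. central (ht \<xi>) :: (real, 'n) heis) \<in> borel_measurable borel"
    proof -
      have "(\<lambda>\<xi>. ht \<xi> *\<^sub>R central 1 :: (real, 'n) heis) \<in> borel_measurable borel" by measurable
      thus ?thesis by (simp add: central_simps)
    qed
    have "{p \<in> space (\<mu> \<Otimes>\<^sub>M lborel). fst p \<in> cross_section} \<in> sets (borel \<Otimes>\<^sub>M borel :: ((real, 'n) heis \<times> (real ^ 'n)) measure)"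
    proof -
      have "(cross_section :: (real, 'n) heis set) \<in> sets borel"
        unfolding cs using c1 by measurable
      hence "fst -` cross_section \<inter> space (borel \<Otimes>\<^sub>M borel) \<in> sets (borel \<Otimes>\<^sub>M borel :: ((real, 'n) heis \<times> (real ^ 'n)) measure)"
        by (rule measurable_sets[OF measurable_fst])
      thus ?thesis unfolding sets_eq_imp_space_eq[OF sets_pair] by (simp add: vimage_def Int_def conj_commute)
    qed
    hence "AE p in \<mu> \<Otimes>\<^sub>M (lborel :: (real ^ 'n) measure). fst p \<in> cross_section"
    proof (intro AE_pair_measure)
      assume "{p \<in> space (\<mu> \<Otimes>\<^sub>M lborel). fst p \<in> cross_section} \<in> sets (borel \<Otimes>\<^sub>M borel :: ((real, 'n) heis \<times> (real ^ 'n)) measure)"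
      thus "{p \<in> space (\<mu> \<Otimes>\<^sub>M lborel). fst p \<in> cross_section} \<in> sets (\<mu> \<Otimes>\<^sub>M (lborel :: (real ^ 'n) measure))" unfolding sets_pair .
      show "AE \<xi> in \<mu>. AE t in lborel. fst (\<xi>, t :: real ^ 'n) \<in> cross_section" using cross by (rule eventually_mono) simp
    qed
    thus ?thesis unfolding di_space_def by (subst AE_density[OF di_weight_measurable]) (auto elim: eventually_mono)
  qed
  define k' where "k' p = (if ht (fst p) = 0 then 0 else k p)" for p
  have k'_int: "integrable ?N k'"
    by (rule Bochner_Integration.integrable_bound[OF k]) (auto simp: k'_def[abs_def])
  have "AE p in ?N. k' p = 0"
  proof (rule N.density_zero[OF k'_int])
    fix A assume A: "A \<in> sets ?N"
    define T where "T q = (central (fst q) :: (real, 'n) heis, (- 1 / fst q) *\<^sub>R snd q)" for q :: "real \<times> (real ^ 'n)"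
    define B where "B = {q. fst q \<noteq> 0 \<and> T q \<in> A}"
    have B: "B \<in> sets borel"
    proof -
      have "(\<lambda>q :: real \<times> (real ^ 'n). (fst q *\<^sub>R central 1 :: (real, 'n) heis, (- 1 / fst q) *\<^sub>R snd q)) \<in> measurable (borel \<Otimes>\<^sub>M borel) (borel \<Otimes>\<^sub>M borel)"
        by measurable
      hence "T \<in> measurable borel (borel \<Otimes>\<^sub>M borel)" by (simp add: T_def[abs_def] central_simps borel_prod)
      hence "T -` A \<inter> space borel \<in> sets borel" using A unfolding sets_di_space by (rule measurable_sets)
      moreover have "{q :: real \<times> (real ^ 'n). fst q \<noteq> 0} \<in> sets borel"
        by (intro borel_open open_Collect_neq continuous_intros)
      ultimately have "(T -` A \<inter> space borel) \<inter> {q. fst q \<noteq> 0} \<in> sets borel" by (rule sets.Int)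
      thus ?thesis by (simp add: B_def vimage_def Int_def conj_commute)
    qed
    have "AE p in ?N. indicator A p *\<^sub>R k' p = indicator B (di_frequency p) * k p"
      using crossN
    proof eventually_elim
      case (elim p)
      show ?case
      proof (cases "ht (fst p) = 0")
        case True
        thus ?thesis by (simp add: k'_def B_def di_frequency_def indicator_def)
      next
        case False
        hence "central (ht (fst p)) = fst p" using elim by (auto simp: cross_section_def ht_def central_def)
        hence "T (di_frequency p) = p" using False by (simp add: T_def di_frequency_def prod_eq_iff)
        thus ?thesis using False by (simp add: k'_def B_def di_frequency_def indicator_def)
      qed
    qed
    hence "set_lebesgue_integral ?N A k' = (\<integral>p. indicator B (di_frequency p) * k p \<partial>?N)"
      unfolding set_lebesgue_integral_def
    proof (rule integral_cong_AE[rotated 2])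
      show "(\<lambda>p. indicat_real A p *\<^sub>R k' p) \<in> borel_measurable ?N" using A k'_int by measurable
      show "(\<lambda>p. indicator B (di_frequency p) * k p) \<in> borel_measurable ?N" using B by measurable
    qed
    also have "\<dots> = 0"
    proof (rule fourier_uniqueness[OF k di_frequency_measurable _ B])
      fix q :: "real \<times> (real ^ 'n)"
      show "(\<integral>p. iexp (q \<bullet> di_frequency p) * k p \<partial>?N) = 0"
        using F[of "fst q" "snd q"] by simp
    qed
    finally show "set_lebesgue_integral ?N A k' = 0" .
  qed
  thus ?thesis by eventually_elim (auto simp: k'_def)
qed

end

text \<open>If \<open>T\<close> is unitary and commutes with the \<open>y\<close> and \<open>z\<close> directions, then \<open>T a\<close> and \<open>T b\<close> have the same matrix
  coefficients as \<open>a\<close> and \<open>b\<close>, so \<open>T a \<cdot> cnj (T b) = a \<cdot> cnj b\<close> pointwise: \<open>T\<close> is multiplication by a unimodular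
  function. Two such operators commute. On the part where the center acts trivially, this argument is replaced by the
  assumption that the commutator of the two operators is a central translation.\<close>

lemma multiplicity_free_commute:
  fixes M :: "(real, 'n::finite) heis set measure"
  assumes dec: "direct_integral_decomposition M \<mu> m" and mf: "AE \<xi> in \<mu>. m \<xi> \<le> 1"
    and act: "\<And>g. measure_preserving_map M (act g)"
    and R: "measure_preserving_map M R1" "measure_preserving_map M R2"
    and eqv: "\<And>g A. A \<in> space M \<Longrightarrow> R1 (act g A) = act g (R1 A)" "\<And>g A. A \<in> space M \<Longrightarrow> R2 (act g A) = act g (R2 A)"
    and comm: "\<And>A. A \<in> space M \<Longrightarrow> R1 (R2 A) = act (- central 1) (R2 (R1 A))"
    and f: "f \<in> L2 M"
  shows "sq_norm M (\<lambda>A. f (R2 (R1 A)) - f (act (- central 1) (R2 (R1 A)))) = 0"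
proof -
  have sets_mu: "sets \<mu> = sets borel" and sf: "sigma_finite_measure \<mu>" and cross: "AE \<xi> in \<mu>. \<xi> \<in> cross_section"
    and m_meas: "m \<in> measurable \<mu> (count_space UNIV)"
    using dec unfolding direct_integral_decomposition_def by blast+
  obtain U where U1: "\<forall>f\<in>L2 M. U f \<in> direct_integral \<mu> m \<and> di_sq_norm \<mu> m (U f) = sq_norm M f"
    and U2: "\<forall>f\<in>L2 M. \<forall>f'\<in>L2 M. \<forall>a. di_eq \<mu> m (U (\<lambda>c. a * f c + f' c)) (\<lambda>\<xi> k t. a * U f \<xi> k t + U f' \<xi> k t)"
    and U3: "\<forall>g. \<forall>f\<in>L2 M. di_eq \<mu> m (U (quasi_regular g f)) (\<lambda>\<xi> k. tau \<xi> g (U f \<xi> k))"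
    using dec unfolding direct_integral_decomposition_def by blast
  note base = sets_mu sf m_meas mf
  let ?N = "di_space \<mu> m"
  let ?B = "borel \<Otimes>\<^sub>M count_space UNIV \<Otimes>\<^sub>M borel :: ((real, 'n) heis \<times> nat \<times> (real ^ 'n)) measure"
  define J where "J f = di_fun (U f)" for f
  have U_meas: "(\<lambda>(\<xi>, k, t). U f \<xi> k t) \<in> borel_measurable ?B" if "f \<in> L2 M" for f
    using U1 that by (simp add: direct_integral_def)
  have eq_AE: "AE p in ?N. di_fun F p = di_fun F' p"
    if e: "di_eq \<mu> m F F'" and F: "(\<lambda>(\<xi>, k, t). F \<xi> k t) \<in> borel_measurable ?B" and F': "(\<lambda>(\<xi>, k, t). F' \<xi> k t) \<in> borel_measurable ?B"
    for F F' :: "'n hsection"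
  proof -
    let ?D = "\<lambda>\<xi> k t. F \<xi> k t - F' \<xi> k t"
    have D: "(\<lambda>(\<xi>, k, t). ?D \<xi> k t) \<in> borel_measurable ?B"
      using borel_measurable_diff[OF F F'] by (simp add: case_prod_beta)
    have "sq_norm ?N (di_fun ?D) = 0"
      using sq_norm_di_fun[OF base D] e by (simp add: di_eq_def)
    moreover have "di_fun ?D \<in> borel_measurable ?N"
      unfolding measurable_di_space[OF base] by (rule di_fun_measurable[OF base D])
    ultimately have "AE p in ?N. ennreal ((cmod (di_fun ?D p))\<^sup>2) = 0"
      unfolding sq_norm_def by (subst (asm) nn_integral_0_iff_AE) auto
    thus ?thesis by eventually_elim (auto simp: di_fun_def split: if_splits)
  qed
  have J1: "J f \<in> borel_measurable ?N" if "f \<in> L2 M" for f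
    unfolding J_def measurable_di_space[OF base] by (rule di_fun_measurable[OF base U_meas[OF that]])
  have J2: "sq_norm ?N (J f) = sq_norm M f" if "f \<in> L2 M" for f
    unfolding J_def sq_norm_di_fun[OF base U_meas[OF that]] using U1 that by blast
  have J3: "AE p in ?N. J (\<lambda>x. a * f x + g x) p = a * J f p + J g p" if f: "f \<in> L2 M" and g: "g \<in> L2 M" for f g a
  proof -
    have s: "(\<lambda>x. a * f x + g x) \<in> L2 M" using f g by (intro L2_add L2_cmult)
    have "(\<lambda>(\<xi>, k, t). a * U f \<xi> k t + U g \<xi> k t) \<in> borel_measurable ?B"
      using borel_measurable_add[OF borel_measurable_times[OF borel_measurable_const U_meas[OF f]] U_meas[OF g]]
      by (simp add: case_prod_beta)
    from eq_AE[OF U2[THEN bspec, OF f, THEN bspec, OF g, THEN spec] U_meas[OF s] this]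
    show ?thesis by eventually_elim (simp add: J_def di_fun_def split: if_splits)
  qed
  have JL2: "J f \<in> L2 ?N" if "f \<in> L2 M" for f using J1[OF that] J2[OF that] L2D(2)[OF that] by (simp add: L2_def)
  have J_cong: "AE p in ?N. J f p = J g p" if f: "f \<in> L2 M" and g: "g \<in> L2 M" and e: "\<forall>A\<in>space M. f A = g A" for f g
  proof -
    have s: "(\<lambda>x. - 1 * f x + g x) \<in> L2 M" using f g by (intro L2_add L2_cmult)
    have "sq_norm M (\<lambda>x. - 1 * f x + g x) = (\<integral>\<^sup>+x. 0 \<partial>M)"
      unfolding sq_norm_def by (rule nn_integral_cong) (simp add: e)
    hence "sq_norm ?N (J (\<lambda>x. - 1 * f x + g x)) = 0" using J2[OF s] by simp
    hence "AE p in ?N. ennreal ((cmod (J (\<lambda>x. - 1 * f x + g x) p))\<^sup>2) = 0"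
      unfolding sq_norm_def using J1[OF s] by (subst (asm) nn_integral_0_iff_AE) auto
    thus ?thesis using J3[OF f g, of "- 1"] by eventually_elim simp
  qed
  have inner: "(\<integral>p. J f p * cnj (J g p) \<partial>?N) = (\<integral>x. f x * cnj (g x) \<partial>M)" if "f \<in> L2 M" "g \<in> L2 M" for f g
    by (rule isometry_preserves_inner[where J = J]) (use J1 J2 J3 that in auto)
  have qr: "quasi_regular g f \<in> L2 M" if "f \<in> L2 M" for f g
    unfolding quasi_regular_def by (rule L2_measure_preserving[OF act that])
  have J4: "AE p in ?N. J (quasi_regular (0, y, z) f) p = iexp ((z, y) \<bullet> di_frequency p) * J f p"
    if f: "f \<in> L2 M" for f y z
  proof -
    let ?T = "\<lambda>\<xi> k. tau \<xi> (0, y, z) (U f \<xi> k)"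
    have "(\<lambda>(\<xi>, k, t). ?T \<xi> k t) = (\<lambda>q. iexp (if ht (fst q) = 0 then fst (snd (fst q)) \<bullet> y
        else ht (fst q) * (z - y \<bullet> snd (snd q))) * (\<lambda>(\<xi>, k, t). U f \<xi> k t) q)"
      by (auto simp: fun_eq_iff tau_def ht_def)
    moreover have "\<dots> \<in> borel_measurable ?B"
    proof -
      have [measurable]: "(\<lambda>\<xi>. fst (snd \<xi>)) \<in> borel_measurable (borel :: (real, 'n) heis measure)"
        by (intro borel_measurable_continuous_onI continuous_intros)
      have [measurable]: "(\<lambda>(\<xi>, k, t). U f \<xi> k t) \<in> borel_measurable ?B" by (rule U_meas[OF f])
      show ?thesis by measurable
    qed
    ultimately have T: "(\<lambda>(\<xi>, k, t). ?T \<xi> k t) \<in> borel_measurable ?B" by simp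
    from eq_AE[OF U3[THEN spec, THEN bspec, OF f] U_meas[OF qr[OF f]] T]
    show ?thesis unfolding J_def by eventually_elim (simp only: di_fun_tau)
  qed
  have multiplier: "AE p in ?N. ht (fst p) \<noteq> 0 \<longrightarrow> J (\<lambda>A. a (R A)) p * cnj (J (\<lambda>A. b (R A)) p) = J a p * cnj (J b p)"
    if Rm: "measure_preserving_map M R" and Re: "\<forall>g A. A \<in> space M \<longrightarrow> R (act g A) = act g (R A)"
      and a: "a \<in> L2 M" and b: "b \<in> L2 M" for R a b
  proof -
    let ?Ta = "\<lambda>A. a (R A)" and ?Tb = "\<lambda>A. b (R A)"
    have Ta: "?Ta \<in> L2 M" and Tb: "?Tb \<in> L2 M" using L2_measure_preserving[OF Rm] a b by auto
    let ?k = "\<lambda>p. J ?Ta p * cnj (J ?Tb p) - J a p * cnj (J b p)"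
    have int: "integrable ?N (\<lambda>p. J ?Ta p * cnj (J ?Tb p))" "integrable ?N (\<lambda>p. J a p * cnj (J b p))"
      using JL2[OF Ta] JL2[OF Tb] JL2[OF a] JL2[OF b] by (auto intro: L2_mult_integrable)
    have coeff: "(\<integral>p. iexp ((z, y) \<bullet> di_frequency p) * (J u p * cnj (J v p)) \<partial>?N)
      = (\<integral>x. quasi_regular (0, y, z) u x * cnj (v x) \<partial>M)" if u: "u \<in> L2 M" and v: "v \<in> L2 M" for u v y z
    proof -
      have fm: "(\<lambda>p. (z, y) \<bullet> di_frequency p) \<in> borel_measurable ?N"
        using di_frequency_measurable[OF base] by measurable
      have "(\<integral>p. iexp ((z, y) \<bullet> di_frequency p) * (J u p * cnj (J v p)) \<partial>?N)
          = (\<integral>p. J (quasi_regular (0, y, z) u) p * cnj (J v p) \<partial>?N)"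
      proof (rule integral_cong_AE)
        show "(\<lambda>p. iexp ((z, y) \<bullet> di_frequency p) * (J u p * cnj (J v p))) \<in> borel_measurable ?N"
          using J1[OF u] J1[OF v] fm by measurable
        show "(\<lambda>p. J (quasi_regular (0, y, z) u) p * cnj (J v p)) \<in> borel_measurable ?N"
          using J1[OF qr[OF u]] J1[OF v] by measurable
      qed (use J4[OF u, of y z] in eventually_elim, simp add: mult.assoc)
      thus ?thesis using inner[OF qr[OF u] v] by simp
    qed
    have "(\<integral>p. iexp ((z, y) \<bullet> di_frequency p) * ?k p \<partial>?N) = 0" for y z
    proof -
      have fm: "(\<lambda>p. (z, y) \<bullet> di_frequency p) \<in> borel_measurable ?N"
        using di_frequency_measurable[OF base] by measurable
      have "(\<integral>p. iexp ((z, y) \<bullet> di_frequency p) * ?k p \<partial>?N)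
        = (\<integral>x. quasi_regular (0, y, z) ?Ta x * cnj (?Tb x) \<partial>M) - (\<integral>x. quasi_regular (0, y, z) a x * cnj (b x) \<partial>M)"
        unfolding right_diff_distrib coeff[OF Ta Tb, symmetric] coeff[OF a b, symmetric]
        by (rule Bochner_Integration.integral_diff) (rule integrable_iexp_mult[OF _ fm], rule int)+
      also have "(\<integral>x. quasi_regular (0, y, z) ?Ta x * cnj (?Tb x) \<partial>M)
        = (\<integral>x. quasi_regular (0, y, z) a (R x) * cnj (b (R x)) \<partial>M)"
        by (rule Bochner_Integration.integral_cong) (simp_all add: quasi_regular_def Re)
      also have "\<dots> = (\<integral>x. quasi_regular (0, y, z) a x * cnj (b x) \<partial>M)"
        by (rule inner_measure_preserving[OF Rm qr[OF a] b])
      finally show ?thesis by simp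
    qed
    from vanishing_of_fourier[OF base cross Bochner_Integration.integrable_diff[OF int] this]
    show ?thesis by eventually_elim simp
  qed
  let ?f1 = "\<lambda>A. f (R1 A)" and ?f2 = "\<lambda>A. f (R2 A)"
  let ?f12 = "\<lambda>A. f (R2 (R1 A))" and ?f21 = "\<lambda>A. f (R1 (R2 A))"
  have f1: "?f1 \<in> L2 M" and f2: "?f2 \<in> L2 M" using L2_measure_preserving R f by auto
  have f12: "?f12 \<in> L2 M" using L2_measure_preserving[OF R(1) f2] .
  have f21: "?f21 \<in> L2 M" using L2_measure_preserving[OF R(2) f1] .
  have pi: "\<forall>A\<in>space M. quasi_regular (central 1) ?f12 A = ?f21 A"
  proof
    fix A assume A: "A \<in> space M"
    have "R1 A \<in> space M" using R(1) A by (auto simp: measure_preserving_map_def dest: measurable_space)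
    thus "quasi_regular (central 1) ?f12 A = ?f21 A" using A by (simp add: quasi_regular_def eqv comm)
  qed
  have eqv1: "\<forall>g A. A \<in> space M \<longrightarrow> R1 (act g A) = act g (R1 A)"
    and eqv2: "\<forall>g A. A \<in> space M \<longrightarrow> R2 (act g A) = act g (R2 A)" using eqv by blast+
  have "AE p in ?N. J ?f12 p = J ?f21 p"
    using multiplier[OF R(1) eqv1 f f] multiplier[OF R(2) eqv2 f f]
      multiplier[OF R(1) eqv1 f2 f] multiplier[OF R(2) eqv2 f1 f]
      multiplier[OF R(1) eqv1 f2 f2] multiplier[OF R(2) eqv2 f1 f1]
      J_cong[OF qr[OF f12, of "central 1"] f21 pi] J4[OF f12, of 0 1]
  proof eventually_elim
    case (elim p)
    show ?case
    proof (cases "ht (fst p) = 0")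
      case True
      hence "(1, 0) \<bullet> di_frequency p = 0" by (simp add: di_frequency_def)
      thus ?thesis using elim(7,8) by (simp add: central_def)
    next
      case False
      show ?thesis
        by (rule unimodular_multipliers_commute[of "J ?f1 p" "J f p" "J ?f2 p"]) (use elim False in auto)
    qed
  qed
  hence z: "AE p in ?N. J (\<lambda>x. - 1 * ?f21 x + ?f12 x) p = 0"
    using J3[OF f21 f12, of "- 1"] by eventually_elim simp
  have s: "(\<lambda>x. - 1 * ?f21 x + ?f12 x) \<in> L2 M" using f12 f21 by (intro L2_add L2_cmult)
  have "sq_norm ?N (J (\<lambda>x. - 1 * ?f21 x + ?f12 x)) = sq_norm ?N (\<lambda>p. 0)" using z by (rule sq_norm_cong_AE)
  hence "sq_norm M (\<lambda>x. - 1 * ?f21 x + ?f12 x) = 0" using J2[OF s] by (simp add: sq_norm_def)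
  moreover have "sq_norm M (\<lambda>A. f (R2 (R1 A)) - f (act (- central 1) (R2 (R1 A)))) = sq_norm M (\<lambda>x. - 1 * ?f21 x + ?f12 x)"
    unfolding sq_norm_def by (rule nn_integral_cong) (simp add: comm)
  ultimately show ?thesis by simp
qed

section \<open>The invariant measure of the homogeneous space\<close>

lemma central_scaleR: "(central t :: (real, 'n::finite) heis) = t *\<^sub>R central 1"
  by (simp add: central_simps)

lemma central_measurable [measurable (raw)]:
  assumes "f \<in> borel_measurable M"
  shows "(\<lambda>x. central (f x) :: (real, 'n::finite) heis) \<in> borel_measurable M"
  unfolding central_scaleR[of "f _"] using assms by measurable

lemma continuous_on_hmult:
  assumes "continuous_on S f" "continuous_on S g"
  shows "continuous_on S (\<lambda>x. f x \<star> g x)"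
  unfolding hmult_def using assms
  by (intro continuous_intros bounded_bilinear.continuous_on[OF bounded_bilinear_hbracket])

lemma act_act: "act g (act g' A) = act (g \<star> g') A"
  by (simp add: act_def image_image hmult_assoc)

locale homogeneous_measure = splitting h c P
  for h c :: "(real, 'n::finite) heis set" and P +
  fixes M :: "(real, 'n) heis set measure"
  assumes inv: "invariant_measure h M" and Zc: "\<forall>t. central t \<in> c"
begin

lemma space_M: "space M = lcosets h" and sets_M: "sets M = sigma_sets (lcosets h) {V. qopen h V}"
  and M_nonzero: "emeasure M (space M) \<noteq> 0"
  and M_compact: "\<And>C. compact C \<Longrightarrow> emeasure M (lcoset h ` C) < \<infinity>"
  and M_act: "\<And>g A. A \<in> sets M \<Longrightarrow> emeasure M (act g ` A) = emeasure M A"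
  using inv unfolding invariant_measure_def by blast+

lemma lcoset_in_space [simp]: "lcoset h g \<in> space M"
  by (simp add: space_M lcosets_def)

lemma spaceE: assumes "A \<in> space M" obtains g where "A = lcoset h g"
  using assms unfolding space_M lcosets_def by (rule imageE)

lemma KC_measurable [measurable]: "KC \<in> borel_measurable M"
proof (rule borel_measurableI)
  fix S :: "(real, 'n) heis set" assume S: "open S"
  have "open (K -` S)" using isCont_K S by (rule open_vimage[rotated])
  moreover have "\<Union>{A \<in> lcosets h. KC A \<in> S} = K -` S"
    unfolding vimage_def by (rule Union_lcosets_vimage)
  ultimately have "qopen h {A \<in> lcosets h. KC A \<in> S}" unfolding qopen_def by auto
  hence "{A \<in> lcosets h. KC A \<in> S} \<in> sets M" unfolding sets_M by (intro sigma_sets.Basic) simp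
  moreover have "KC -` S \<inter> space M = {A \<in> lcosets h. KC A \<in> S}" by (auto simp: space_M)
  ultimately show "KC -` S \<inter> space M \<in> sets M" by simp
qed

lemma lcoset_measurable: "lcoset h \<in> measurable borel M"
proof (rule measurable_sigma_sets[OF sets_M])
  show "{V. qopen h V} \<subseteq> Pow (lcosets h)" by (auto simp: qopen_def)
  show "lcoset h \<in> space borel \<rightarrow> lcosets h" by (simp add: lcosets_def)
  fix V assume "V \<in> {V. qopen h V}"
  hence V: "V \<subseteq> lcosets h" "open (\<Union>V)" by (auto simp: qopen_def)
  have "lcoset h -` V \<inter> space borel = \<Union>V" by (simp only: vimage_def space_borel Int_UNIV_right lcoset_mem_iff[OF V(1)] Collect_mem_eq)
  thus "lcoset h -` V \<inter> space borel \<in> sets borel" using V(2) by simp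
qed

lemma lcoset_comp_measurable:
  "f \<in> borel_measurable N \<Longrightarrow> (\<lambda>x. lcoset h (f x)) \<in> measurable N M"
  by (rule measurable_compose[OF _ lcoset_measurable])

lemma measurable_from_coset_map:
  assumes "continuous_on UNIV f" and R: "\<And>A. A \<in> space M \<Longrightarrow> R A = lcoset h (f (KC A))"
  shows "R \<in> measurable M M"
proof -
  have "f \<in> borel_measurable borel" using assms(1) by (rule borel_measurable_continuous_onI)
  hence "(\<lambda>A. lcoset h (f (KC A))) \<in> measurable M M"
    by (intro lcoset_comp_measurable measurable_compose[OF KC_measurable])
  thus ?thesis using R by (simp cong: measurable_cong)
qed

lemma act_eq: "A \<in> space M \<Longrightarrow> act g A = lcoset h (g \<star> KC A)"
  by (metis act_lcoset lcoset_KC space_M)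

lemma act_in_space: "A \<in> space M \<Longrightarrow> act g A \<in> space M"
  by (simp add: act_eq)

lemma act_measure_preserving: "measure_preserving_map M (act g)"
proof -
  have m: "act g \<in> measurable M M" for g
    by (rule measurable_from_coset_map[of "\<lambda>x. g \<star> x"]) (auto intro!: continuous_on_hmult continuous_intros act_eq)
  have "distr M M (act g) = M"
  proof (rule measure_eqI)
    fix A assume "A \<in> sets (distr M M (act g))"
    hence A: "A \<in> sets M" by simp
    have id: "act 0 B = B" if "B \<in> space M" for B using that by (elim spaceE) (simp add: act_lcoset)
    have "act g -` A \<inter> space M = act (- g) ` A"
    proof (intro equalityI subsetI)
      fix B assume B: "B \<in> act g -` A \<inter> space M"
      have "B = act (- g) (act g B)" using B id by (simp add: act_act)
      thus "B \<in> act (- g) ` A" using B by blast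
    next
      fix B assume "B \<in> act (- g) ` A"
      then obtain B' where B': "B' \<in> A" "B = act (- g) B'" by blast
      hence "B' \<in> space M" using A sets.sets_into_space by blast
      thus "B \<in> act g -` A \<inter> space M" using B' id act_in_space by (simp add: act_act)
    qed
    thus "emeasure (distr M M (act g)) A = emeasure M A"
      using A m M_act[OF A, of "- g"] by (simp add: emeasure_distr)
  qed simp
  thus ?thesis using m by (simp add: measure_preserving_map_def)
qed

lemma KC_in: "KC A \<in> c"
  unfolding KC_def by (rule K_in)

lemma emeasure_bounded: "emeasure M {A \<in> space M. norm (KC A) \<le> r} < \<infinity>"
proof -
  have "compact (cball 0 r \<inter> c)"
    using closed_subspace[OF subspace_c] by (intro compact_Int_closed) auto
  moreover have "{A \<in> space M. norm (KC A) \<le> r} = lcoset h ` (cball 0 r \<inter> c)"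
  proof (intro equalityI subsetI)
    fix A assume A: "A \<in> {A \<in> space M. norm (KC A) \<le> r}"
    hence "KC A \<in> cball 0 r \<inter> c" using KC_in by simp
    moreover have "A = lcoset h (KC A)" using A lcoset_KC by (simp add: space_M)
    ultimately show "A \<in> lcoset h ` (cball 0 r \<inter> c)" by (rule rev_image_eqI)
  qed (auto simp: K_id)
  ultimately show ?thesis using M_compact by simp
qed

lemma sigma_finite_M: "sigma_finite_measure M"
proof
  let ?E = "\<lambda>r :: nat. {A \<in> space M. norm (KC A) \<le> real r}"
  have fin: "emeasure M (?E r) \<noteq> \<infinity>" for r using emeasure_bounded by (simp add: less_top)
  have E: "?E r \<in> sets M" for r by measurable
  show "\<exists>A. countable A \<and> A \<subseteq> sets M \<and> \<Union>A = space M \<and> (\<forall>a\<in>A. emeasure M a \<noteq> \<infinity>)"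
  proof (intro exI[of _ "range ?E"] conjI)
    show "countable (range ?E)" by simp
    show "range ?E \<subseteq> sets M" using E by blast
    show "\<Union>(range ?E) = space M" using real_arch_simple by blast
    show "\<forall>a\<in>range ?E. emeasure M a \<noteq> \<infinity>" using fin by blast
  qed
qed

definition shift :: "real \<Rightarrow> (real, 'n) heis set \<Rightarrow> (real, 'n) heis set" where
  "shift s A = lcoset h (KC A + central s)"

lemma shift_act: "A \<in> space M \<Longrightarrow> act (central s) A = shift s A"
  by (simp add: act_eq shift_def hmult_central)

lemma KC_shift: "KC (shift s A) = KC A + central s"
proof -
  have "KC A + central s \<in> c" using Zc KC_in subspace_add[OF subspace_c] by blast
  thus ?thesis by (simp add: shift_def K_id)
qed

lemma shift_shift: "shift s (shift t A) = shift (s + t) A"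
  by (simp only: shift_def[of s "shift t A"] shift_def[of "s + t" A] KC_shift central_simps add_ac)

lemma shift_0: "A \<in> space M \<Longrightarrow> shift 0 A = A"
  using lcoset_KC by (simp add: shift_def central_simps space_M)

lemma shift_measurable:
  assumes "f \<in> borel_measurable N" "g \<in> measurable N M"
  shows "(\<lambda>x. shift (f x) (g x)) \<in> measurable N M"
proof -
  have "(\<lambda>x. KC (g x)) \<in> borel_measurable N" using assms(2) by (rule measurable_compose) (rule KC_measurable)
  thus ?thesis unfolding shift_def
    by (intro lcoset_comp_measurable borel_measurable_add central_measurable assms(1))
qed

lemma nn_integral_unit_interval: "(\<integral>\<^sup>+s. indicator {0..<1} (a + s) \<partial>lborel) = (1 :: ennreal)" for a :: real
  using nn_integral_real_affine[of "indicator {0..<1 :: real}" 1 a] by simp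

text \<open>Integrate first over the orbits of the center, each of which is met by \<open>{0 \<le> ht < 1}\<close> in a unit interval.\<close>

lemma nn_integral_central_fibres:
  assumes F[measurable]: "F \<in> borel_measurable M"
  shows "(\<integral>\<^sup>+A. F A \<partial>M) = (\<integral>\<^sup>+A. indicator {0..<1} (ht (KC A)) * (\<integral>\<^sup>+s. F (shift s A) \<partial>lborel) \<partial>M)"
proof -
  interpret M: sigma_finite_measure M by (rule sigma_finite_M)
  interpret pair_sigma_finite lborel M ..
  let ?I = "indicator {0..<1 :: real} :: real \<Rightarrow> ennreal"
  have Fs: "(\<lambda>x. F (shift (f x) (g x))) \<in> borel_measurable N" if "f \<in> borel_measurable N" "g \<in> measurable N M"
    for N :: "'b measure" and f g
    by (rule measurable_compose[OF shift_measurable[OF that] F])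
  have "(\<integral>\<^sup>+A. F A \<partial>M) = (\<integral>\<^sup>+A. (\<integral>\<^sup>+s. F A * ?I (ht (KC A) + s) \<partial>lborel) \<partial>M)"
    by (intro nn_integral_cong) (simp add: nn_integral_cmult nn_integral_unit_interval)
  also have "\<dots> = (\<integral>\<^sup>+s. (\<integral>\<^sup>+A. F A * ?I (ht (KC A) + s) \<partial>M) \<partial>lborel)"
    by (rule Fubini') measurable
  also have "\<dots> = (\<integral>\<^sup>+s. (\<integral>\<^sup>+A. F (shift (- s) A) * ?I (ht (KC A)) \<partial>M) \<partial>lborel)"
  proof (rule nn_integral_cong)
    fix s
    have "(\<lambda>A. F (shift (- s) A) * ?I (ht (KC A))) \<in> borel_measurable M"
      using Fs[of "\<lambda>A. - s" M "\<lambda>A. A"] by measurable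
    from nn_integral_measure_preserving[OF act_measure_preserving this, of "central s"]
    have "(\<integral>\<^sup>+A. F (shift (- s) A) * ?I (ht (KC A)) \<partial>M)
      = (\<integral>\<^sup>+A. F (shift (- s) (act (central s) A)) * ?I (ht (KC (act (central s) A))) \<partial>M)" by simp
    also have "\<dots> = (\<integral>\<^sup>+A. F A * ?I (ht (KC A) + s) \<partial>M)"
      by (intro nn_integral_cong) (simp add: shift_act shift_shift shift_0 KC_shift ht_simps)
    finally show "(\<integral>\<^sup>+A. F A * ?I (ht (KC A) + s) \<partial>M) = (\<integral>\<^sup>+A. F (shift (- s) A) * ?I (ht (KC A)) \<partial>M)" by simp
  qed
  also have "\<dots> = (\<integral>\<^sup>+A. (\<integral>\<^sup>+s. F (shift (- s) A) * ?I (ht (KC A)) \<partial>lborel) \<partial>M)"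
  proof (rule Fubini'[symmetric])
    have "(\<lambda>p. F (shift (- fst p) (snd p))) \<in> borel_measurable (lborel \<Otimes>\<^sub>M M)"
      by (rule Fs) measurable
    thus "(\<lambda>(s, A). F (shift (- s) A) * ?I (ht (KC A))) \<in> borel_measurable (lborel \<Otimes>\<^sub>M M)"
      unfolding case_prod_beta by measurable
  qed
  also have "\<dots> = (\<integral>\<^sup>+A. ?I (ht (KC A)) * (\<integral>\<^sup>+s. F (shift s A) \<partial>lborel) \<partial>M)"
  proof (rule nn_integral_cong)
    fix A assume A: "A \<in> space M"
    have m: "(\<lambda>s. F (shift s A)) \<in> borel_measurable borel" using A by (intro Fs) auto
    have m': "(\<lambda>s. F (shift (- s) A)) \<in> borel_measurable borel" using A by (intro Fs) auto
    have "(\<integral>\<^sup>+s. F (shift s A) \<partial>lborel) = (\<integral>\<^sup>+s. F (shift (- s) A) \<partial>lborel)"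
      using nn_integral_real_affine[OF m, of "- 1" 0] by simp
    thus "(\<integral>\<^sup>+s. F (shift (- s) A) * ?I (ht (KC A)) \<partial>lborel) = ?I (ht (KC A)) * (\<integral>\<^sup>+s. F (shift s A) \<partial>lborel)"
      using m' by (simp add: nn_integral_multc mult.commute)
  qed
  finally show ?thesis .
qed

lemma nn_integral_shear:
  assumes F: "F \<in> borel_measurable M" and \<phi>: "\<phi> \<in> borel_measurable M"
    and \<phi>_inv: "\<And>A s. A \<in> space M \<Longrightarrow> \<phi> (shift s A) = \<phi> A"
  shows "(\<integral>\<^sup>+A. F (shift (\<phi> A) A) \<partial>M) = (\<integral>\<^sup>+A. F A \<partial>M)"
proof -
  have Fs: "(\<lambda>x. F (shift (f x) (g x))) \<in> borel_measurable N" if "f \<in> borel_measurable N" "g \<in> measurable N M"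
    for N :: "'b measure" and f g
    by (rule measurable_compose[OF shift_measurable[OF that] F])
  have "(\<integral>\<^sup>+A. F (shift (\<phi> A) A) \<partial>M)
    = (\<integral>\<^sup>+A. indicator {0..<1} (ht (KC A)) * (\<integral>\<^sup>+s. F (shift (\<phi> (shift s A)) (shift s A)) \<partial>lborel) \<partial>M)"
    by (rule nn_integral_central_fibres) (rule Fs[OF \<phi>], simp)
  also have "\<dots> = (\<integral>\<^sup>+A. indicator {0..<1} (ht (KC A)) * (\<integral>\<^sup>+s. F (shift s A) \<partial>lborel) \<partial>M)"
  proof (rule nn_integral_cong)
    fix A assume A: "A \<in> space M"
    have "(\<lambda>s. F (shift s A)) \<in> borel_measurable borel" using A by (intro Fs) auto
    from nn_integral_real_affine[OF this, of 1 "\<phi> A"]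
    show "indicator {0..<1} (ht (KC A)) * (\<integral>\<^sup>+s. F (shift (\<phi> (shift s A)) (shift s A)) \<partial>lborel)
      = indicator {0..<1} (ht (KC A)) * (\<integral>\<^sup>+s. F (shift s A) \<partial>lborel)"
      using A by (simp add: \<phi>_inv shift_shift)
  qed
  also have "\<dots> = (\<integral>\<^sup>+A. F A \<partial>M)" by (rule nn_integral_central_fibres[symmetric, OF F])
  finally show ?thesis .
qed

text \<open>Right translation by an element \<open>v\<close> that commutes with \<open>h\<close>. It preserves the invariant measure, since it
  differs from left translation by \<open>v\<close> only by a shear along the center.\<close>

definition right_translation :: "(real, 'n) heis \<Rightarrow> (real, 'n) heis set \<Rightarrow> (real, 'n) heis set" where
  "right_translation v A = lcoset h (KC A \<star> v)"

lemma right_translation_lcoset: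
  assumes "\<And>a. a \<in> h \<Longrightarrow> symp v a = 0"
  shows "right_translation v (lcoset h g) = lcoset h (g \<star> v)"
proof -
  obtain a where a: "a \<in> h" "g = K g \<star> a" by (rule K_decomp)
  have "a \<star> v = v \<star> a"
    using hmult_swap[of a v] symp_skew[of a v] assms[OF a(1)] by (simp add: central_simps)
  hence "g \<star> v = (K g \<star> v) \<star> a" using a(2) by (metis hmult_assoc)
  hence "K (g \<star> v) = K (K g \<star> v)" using K_mult_h[OF a(1), of "K g \<star> v"] by simp
  thus ?thesis by (simp add: right_translation_def lcoset_eq_iff)
qed

lemma right_translation_act:
  assumes "\<And>a. a \<in> h \<Longrightarrow> symp v a = 0" "A \<in> space M"
  shows "right_translation v (act g A) = act g (right_translation v A)"
  using assms(2) by (elim spaceE) (simp add: act_lcoset right_translation_lcoset[OF assms(1)] hmult_assoc)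

lemma right_translation_measure_preserving:
  assumes v: "\<And>a. a \<in> h \<Longrightarrow> symp v a = 0"
  shows "measure_preserving_map M (right_translation v)"
proof (rule measure_preserving_mapI)
  show "right_translation v \<in> measurable M M"
    by (rule measurable_from_coset_map[of "\<lambda>x. x \<star> v"])
      (auto intro!: continuous_on_hmult continuous_intros simp: right_translation_def)
  fix F :: "(real, 'n) heis set \<Rightarrow> ennreal" assume F: "F \<in> borel_measurable M"
  define \<phi> where "\<phi> A = symp (KC A) v" for A
  have "linear (\<lambda>u. symp u v)" by (rule linearI) (simp_all add: symp_simps)
  hence "(\<lambda>u. symp u v) \<in> borel_measurable borel"
    by (intro borel_measurable_continuous_onI linear_continuous_on) (simp add: linear_conv_bounded_linear)
  hence \<phi>: "\<phi> \<in> borel_measurable M" unfolding \<phi>_def[abs_def] by (rule measurable_compose[OF KC_measurable])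
  have \<phi>_inv: "\<phi> (shift s A) = \<phi> A" if "A \<in> space M" for A s
    using that by (simp add: \<phi>_def KC_shift symp_simps)
  have eq: "right_translation v A = shift (\<phi> (act v A)) (act v A)" if A: "A \<in> space M" for A
  proof -
    obtain g where g: "A = lcoset h g" using A by (rule spaceE)
    obtain a where a: "a \<in> h" "v \<star> g = K (v \<star> g) \<star> a" by (rule K_decomp)
    have av: "symp a v = 0" using v[OF a(1)] symp_skew[of a v] by simp
    have "symp (v \<star> g) v = symp (K (v \<star> g) \<star> a) v" using a(2) by simp
    hence "symp (K (v \<star> g)) v = symp g v" by (simp add: hmult_symp symp_simps av)
    hence "shift (\<phi> (act v A)) (act v A) = lcoset h (K (v \<star> g) + central (symp g v))"
      by (simp add: g act_lcoset \<phi>_def shift_def)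
    also have "\<dots> = act (central (symp g v)) (lcoset h (v \<star> g))"
      by (simp add: act_eq hmult_central)
    also have "\<dots> = lcoset h (g \<star> v)"
      by (simp add: act_lcoset hmult_central hmult_swap[of g v])
    finally show ?thesis using right_translation_lcoset[OF v] by (simp add: g)
  qed
  have m: "(\<lambda>A. F (shift (\<phi> A) A)) \<in> borel_measurable M"
    by (rule measurable_compose[OF shift_measurable[OF \<phi>] F]) simp
  have "(\<integral>\<^sup>+A. F (right_translation v A) \<partial>M) = (\<integral>\<^sup>+A. F (shift (\<phi> (act v A)) (act v A)) \<partial>M)"
    by (intro nn_integral_cong) (simp add: eq)
  also have "\<dots> = (\<integral>\<^sup>+A. F (shift (\<phi> A) A) \<partial>M)"
    by (rule nn_integral_measure_preserving[OF act_measure_preserving m])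
  also have "\<dots> = (\<integral>\<^sup>+A. F A \<partial>M)" using F \<phi> \<phi>_inv by (rule nn_integral_shear)
  finally show "(\<integral>\<^sup>+A. F (right_translation v A) \<partial>M) = (\<integral>\<^sup>+A. F A \<partial>M)" .
qed

text \<open>The center acts freely with wandering sets of finite positive measure, so it does not act trivially.\<close>

lemma center_moves_L2:
  obtains f where "f \<in> L2 M" "sq_norm M (\<lambda>A. f A - f (act (- central 1) A)) \<noteq> 0"
proof -
  interpret M: sigma_finite_measure M by (rule sigma_finite_M)
  define E where "E k r = {A \<in> space M. real_of_int k \<le> ht (KC A) \<and> ht (KC A) < real_of_int k + 1 \<and> norm (KC A) \<le> real r}"
    for k :: int and r :: nat
  have E_sets[measurable]: "E k r \<in> sets M" for k r unfolding E_def by measurable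
  have cover: "space M \<subseteq> (\<Union>k. \<Union>r. E k r)"
  proof
    fix A assume A: "A \<in> space M"
    obtain r :: nat where "norm (KC A) \<le> real r" using real_arch_simple by blast
    moreover have "real_of_int \<lfloor>ht (KC A)\<rfloor> \<le> ht (KC A)" "ht (KC A) < real_of_int \<lfloor>ht (KC A)\<rfloor> + 1" by linarith+
    ultimately have "A \<in> E \<lfloor>ht (KC A)\<rfloor> r" using A by (simp add: E_def)
    thus "A \<in> (\<Union>k. \<Union>r. E k r)" by blast
  qed
  have "\<exists>k r. emeasure M (E k r) \<noteq> 0"
  proof (rule ccontr)
    assume "\<not> (\<exists>k r. emeasure M (E k r) \<noteq> 0)"
    hence "E k r \<in> null_sets M" for k r by (intro null_setsI) auto
    hence "(\<Union>k. \<Union>r. E k r) \<in> null_sets M" by (intro null_sets_UN') auto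
    hence "space M \<in> null_sets M" by (rule null_sets_subset[OF _ sets.top cover])
    thus False using M_nonzero by auto
  qed
  then obtain k r where kr: "emeasure M (E k r) \<noteq> 0" by blast
  have fin: "emeasure M (E k r) < \<infinity>"
  proof -
    have "emeasure M (E k r) \<le> emeasure M {A \<in> space M. norm (KC A) \<le> real r}"
      by (rule emeasure_mono) (auto simp: E_def)
    thus ?thesis using emeasure_bounded by (rule le_less_trans)
  qed
  define f where "f = (indicator (E k r) :: _ \<Rightarrow> complex)"
  have "sq_norm M f = (\<integral>\<^sup>+A. indicator (E k r) A \<partial>M)"
    unfolding sq_norm_def f_def by (intro nn_integral_cong) (auto simp: indicator_def)
  hence "f \<in> L2 M" using fin by (simp add: L2_def f_def)
  moreover have "sq_norm M (\<lambda>A. f A - f (act (- central 1) A)) \<noteq> 0"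
  proof
    assume z: "sq_norm M (\<lambda>A. f A - f (act (- central 1) A)) = 0"
    have "emeasure M (E k r) = (\<integral>\<^sup>+A. indicator (E k r) A \<partial>M)" by simp
    also have "\<dots> \<le> sq_norm M (\<lambda>A. f A - f (act (- central 1) A))"
      unfolding sq_norm_def
    proof (rule nn_integral_mono)
      fix A assume A: "A \<in> space M"
      show "indicator (E k r) A \<le> ennreal ((cmod (f A - f (act (- central 1) A)))\<^sup>2)"
      proof (cases "A \<in> E k r")
        case True
        have "act (- central 1) A = shift (- 1) A" using shift_act[OF A, of "- 1"] by (simp add: central_simps)
        hence "ht (KC (act (- central 1) A)) = ht (KC A) - 1" using A by (simp add: KC_shift ht_simps)
        hence "act (- central 1) A \<notin> E k r" using True by (auto simp: E_def)
        thus ?thesis using True by (simp add: f_def)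
      qed simp
    qed
    finally show False using z kr by simp
  qed
  ultimately show ?thesis by (rule that)
qed

text \<open>A hyperbolic pair centralizing \<open>h\<close> yields two intertwining operators with a nontrivial central commutator.\<close>

lemma not_multiplicity_free:
  assumes v: "\<And>a. a \<in> h \<Longrightarrow> symp v a = 0" and w: "\<And>a. a \<in> h \<Longrightarrow> symp w a = 0" and vw: "symp v w = 1"
  shows "\<not> multiplicity_free M"
proof
  assume "multiplicity_free M"
  then obtain \<mu> m where dec: "direct_integral_decomposition M \<mu> m" and mf: "AE \<xi> in \<mu>. m \<xi> \<le> 1"
    unfolding multiplicity_free_def by blast
  let ?R1 = "right_translation v" and ?R2 = "right_translation w"
  have comm: "?R1 (?R2 A) = act (- central 1) (?R2 (?R1 A))" if A: "A \<in> space M" for A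
  proof -
    obtain g where g: "A = lcoset h g" using A by (rule spaceE)
    have wv: "w \<star> v = central (- 1) \<star> (v \<star> w)"
      using hmult_swap[of w v] symp_skew[of w v] vw by (simp add: hmult_central)
    have "(g \<star> w) \<star> v = (g \<star> central (- 1)) \<star> (v \<star> w)" by (simp only: hmult_assoc wv)
    also have "g \<star> central (- 1) = central (- 1) \<star> g" by (simp only: hmult_central)
    finally have "(g \<star> w) \<star> v = central (- 1) \<star> ((g \<star> v) \<star> w)" by (simp only: hmult_assoc)
    thus ?thesis by (simp add: g right_translation_lcoset[OF v] right_translation_lcoset[OF w] act_lcoset central_simps)
  qed
  obtain f where f: "f \<in> L2 M" "sq_norm M (\<lambda>A. f A - f (act (- central 1) A)) \<noteq> 0" by (rule center_moves_L2)
  note mp1 = right_translation_measure_preserving[OF v] and mp2 = right_translation_measure_preserving[OF w]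
  have "sq_norm M (\<lambda>A. f (?R2 (?R1 A)) - f (act (- central 1) (?R2 (?R1 A)))) = 0"
    by (rule multiplicity_free_commute[OF dec mf act_measure_preserving mp1 mp2 _ _ comm f(1)])
      (simp_all add: right_translation_act v w)
  moreover have "sq_norm M (\<lambda>A. f (?R2 (?R1 A)) - f (act (- central 1) (?R2 (?R1 A))))
    = sq_norm M (\<lambda>A. f A - f (act (- central 1) A))"
  proof -
    let ?F = "\<lambda>A. ennreal ((cmod (f A - f (act (- central 1) A)))\<^sup>2)"
    have "(\<lambda>A. f (act (- central 1) A)) \<in> borel_measurable M"
      using L2D(1)[OF L2_measure_preserving[OF act_measure_preserving f(1)]] .
    hence F: "?F \<in> borel_measurable M" using L2D(1)[OF f(1)] by measurable
    have "(\<lambda>A. ?F (?R2 A)) \<in> borel_measurable M"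
      using mp2 F by (auto simp: measure_preserving_map_def intro: measurable_compose)
    from nn_integral_measure_preserving[OF mp1 this] nn_integral_measure_preserving[OF mp2 F]
    show ?thesis by (simp add: sq_norm_def)
  qed
  ultimately show False using f(2) by simp
qed

end

section \<open>Complements\<close>

lemma orthogonal_complement_decomposition:
  fixes S :: "'a::euclidean_space set"
  assumes "subspace S"
  shows "\<exists>y\<in>S. \<exists>z. (\<forall>w\<in>S. z \<bullet> w = 0) \<and> x = y + z"
proof -
  have "\<exists>y z. y \<in> span S \<and> (\<forall>w\<in>span S. orthogonal z w) \<and> x = y + z"
    by (rule orthogonal_subspace_decomp_exists[of S x]) blast
  moreover have "span S = S" using assms by simp
  ultimately show ?thesis by (auto simp only: orthogonal_def)
qed

lemma splitting_of_center_mem: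
  fixes h :: "(real, 'n::finite) heis set"
  assumes h: "lie_subalgebra h" and z: "central 1 \<in> h"
  obtains c P where "splitting h c P"
proof -
  have sh: "subspace h" using h by (simp add: lie_subalgebra_def)
  define c where "c = {y. \<forall>x\<in>h. y \<bullet> x = 0}"
  have "subspace c" by (simp add: subspace_def c_def inner_add_left)
  moreover have "h \<inter> c = {0}"
  proof (intro equalityI subsetI)
    fix x assume "x \<in> h \<inter> c"
    hence "x \<bullet> x = 0" by (simp add: c_def)
    thus "x \<in> {0}" by simp
  qed (simp add: c_def subspace_0[OF sh])
  moreover have "\<exists>a\<in>h. \<exists>w\<in>c. u = a + w" for u
  proof -
    obtain y z where "y \<in> h" "\<forall>w\<in>h. z \<bullet> w = 0" "u = y + z"
      using orthogonal_complement_decomposition[OF sh, of u] by blast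
    thus ?thesis unfolding c_def by blast
  qed
  ultimately obtain P where "splitting h c P" using splitting_exists[OF h] z by blast
  thus ?thesis by (rule that)
qed

lemma central_mem_imp_zero:
  fixes h :: "(real, 'n::finite) heis set"
  assumes "subspace h" "central 1 \<notin> h" "central t \<in> h"
  shows "t = 0"
proof (rule ccontr)
  assume "t \<noteq> 0"
  hence "(1 / t) *\<^sub>R central t = (central 1 :: (real, 'n) heis)" by (simp add: central_simps)
  thus False using subspace_scale[OF assms(1,3), of "1 / t"] assms(2) by simp
qed

text \<open>The orthogonal complement of the projection of \<open>h\<close> to height zero contains the center, and it is still a complement
  of \<open>h\<close>, because \<open>h\<close> misses the center.\<close>

lemma splitting_of_center_not_mem:
  fixes h :: "(real, 'n::finite) heis set"
  assumes h: "lie_subalgebra h" and z: "central 1 \<notin> h"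
  obtains c P where "splitting h c P" "central 1 \<in> c"
proof -
  have sh: "subspace h" using h by (simp add: lie_subalgebra_def)
  define pr where "pr u = u - central (ht u)" for u :: "(real, 'n) heis"
  have lin: "linear pr" by (rule linearI) (simp_all add: pr_def ht_simps central_simps scaleR_diff_right)
  have central_inner: "central t \<bullet> u = t * ht u" for t and u :: "(real, 'n) heis"
    by (simp add: central_def ht_def inner_prod_def)
  define c where "c = {y. \<forall>x\<in>h. y \<bullet> pr x = 0}"
  have zc: "central t \<in> c" for t by (simp add: c_def central_inner pr_def ht_simps)
  have sc: "subspace c" by (simp add: subspace_def c_def inner_add_left)
  moreover have "h \<inter> c = {0}"
  proof (intro equalityI subsetI)
    fix x assume x: "x \<in> h \<inter> c"
    hence "x \<bullet> pr x = 0" by (simp add: c_def)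
    moreover have "x \<bullet> pr x = pr x \<bullet> pr x"
    proof -
      have "central (ht x) \<bullet> pr x = 0" by (simp add: central_inner pr_def ht_simps)
      thus ?thesis by (simp add: pr_def inner_diff_left)
    qed
    ultimately have "x = central (ht x)" by (simp add: pr_def)
    thus "x \<in> {0}" using x central_mem_imp_zero[OF sh z] by (metis IntD1 central_simps(4) singletonI)
  qed (simp add: c_def subspace_0[OF sh])
  moreover have "\<exists>a\<in>h. \<exists>w\<in>c. u = a + w" for u
  proof -
    obtain y z where yz: "y \<in> pr ` h" "\<forall>w\<in>pr ` h. z \<bullet> w = 0" "u = y + z"
      using orthogonal_complement_decomposition[OF linear_subspace_image[OF lin sh], of u] by blast
    then obtain a where a: "a \<in> h" "y = pr a" by blast
    have "z \<in> c" using yz(2) by (simp add: c_def)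
    hence "z - central (ht a) \<in> c" using zc sc by (intro subspace_diff)
    moreover have "u = a + (z - central (ht a))" using yz(3) a(2) by (simp add: pr_def)
    ultimately show ?thesis using a(1) by blast
  qed
  ultimately obtain P where "splitting h c P" using splitting_exists[OF h] zc[of 1] by blast
  thus ?thesis using zc[of 1] by (rule that)
qed

lemma symp_span_zero:
  fixes S T :: "(real, 'n::finite) heis set"
  assumes "\<And>u v. u \<in> S \<Longrightarrow> v \<in> T \<Longrightarrow> symp u v = 0" "u \<in> span S" "v \<in> span T"
  shows "symp u v = 0"
proof -
  have "span T \<subseteq> {v. symp s v = 0}" if "s \<in> S" for s
    by (rule span_minimal[OF _ subspace_symp_perp]) (use assms(1) that in blast)
  hence "S \<subseteq> {u. symp u v = 0}" using assms(3) by blast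
  moreover have "subspace {u. symp u v = 0}" by (simp add: subspace_def symp_simps)
  ultimately have "span S \<subseteq> {u. symp u v = 0}" by (intro span_minimal)
  thus ?thesis using assms(2) by blast
qed

text \<open>The complement is spanned by the other half of the Heisenberg basis and the center.\<close>

lemma splitting_lagrangian:
  fixes h :: "(real, 'n::finite) heis set"
  assumes h: "lie_subalgebra h" and z: "central 1 \<notin> h"
    and fam: "symplectic_family (CARD('n)) X Y" and bas: "heisenberg_basis X Y (central 1)"
    and hX: "h = span (X ` {1..CARD('n)})"
  obtains c P where "splitting h c P" "\<forall>t. central t \<in> c" "\<forall>u\<in>c. \<forall>v\<in>c. symp u v = 0"
proof -
  let ?n = "CARD('n)"
  have sh: "subspace h" using h by (simp add: lie_subalgebra_def)
  define c where "c = span (Y ` {1..?n} \<union> {central 1})"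
  have sc: "subspace c" by (simp add: c_def)
  have c1: "central 1 \<in> c" unfolding c_def by (rule span_base) simp
  hence zc: "\<forall>t. central t \<in> c" using subspace_scale[OF sc] central_scaleR by metis
  have ab: "symp u v = 0" if "u \<in> c" "v \<in> c" for u v
    using that unfolding c_def by (rule symp_span_zero[rotated]) (use fam in \<open>auto simp: symplectic_family_def\<close>)
  have iso: "symp u v = 0" if "u \<in> h" "v \<in> h" for u v
    using that unfolding hX by (rule symp_span_zero[rotated]) (use fam in \<open>auto simp: symplectic_family_def\<close>)
  have UN: "span (X ` {1..?n} \<union> (Y ` {1..?n} \<union> {central 1})) = UNIV"
    using bas unfolding heisenberg_basis_def by (simp only: Un_assoc)
  have "\<exists>a\<in>h. \<exists>w\<in>c. u = a + w" for u
  proof -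
    have "u \<in> span (X ` {1..?n} \<union> (Y ` {1..?n} \<union> {central 1}))" using UN by blast
    thus ?thesis unfolding span_Un hX c_def by blast
  qed
  moreover have "h \<inter> c = {0}"
  proof (intro equalityI subsetI)
    fix x assume x: "x \<in> h \<inter> c"
    have "symp x v = 0" for v
    proof (rule symp_span_zero[of "{x}" "X ` {1..?n} \<union> (Y ` {1..?n} \<union> {central 1})"])
      show "v \<in> span (X ` {1..?n} \<union> (Y ` {1..?n} \<union> {central 1}))" using UN by blast
      fix u w assume "u \<in> {x}" and w: "w \<in> X ` {1..?n} \<union> (Y ` {1..?n} \<union> {central 1})"
      have "X ` {1..?n} \<subseteq> h" "Y ` {1..?n} \<union> {central 1} \<subseteq> c" unfolding hX c_def by (rule span_superset)+
      hence "w \<in> h \<or> w \<in> c" using w by blast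
      thus "symp u w = 0" using x iso ab \<open>u \<in> {x}\<close> by blast
    qed (simp add: span_base)
    hence "x = central (ht x)" by (intro symp_nondegenerate)
    thus "x \<in> {0}" using x central_mem_imp_zero[OF sh z] by (metis IntD1 central_simps(4) singletonI)
  qed (simp add: subspace_0[OF sh] subspace_0[OF sc])
  ultimately obtain P where "splitting h c P" using splitting_exists[OF h sc] c1 by blast
  thus ?thesis using zc ab by (intro that) blast+
qed


section \<open>The group generated by a complement\<close>

lemma closed_subgroup_generated_superset: "A \<subseteq> closed_subgroup_generated A"
  by (auto simp: closed_subgroup_generated_def)

lemma closed_subgroup_generated_hmult:
  "u \<in> closed_subgroup_generated A \<Longrightarrow> v \<in> closed_subgroup_generated A \<Longrightarrow> u \<star> v \<in> closed_subgroup_generated A"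
  unfolding closed_subgroup_generated_def closed_subgroup_def by blast

lemma closed_subgroup_generated_eq:
  fixes q :: "(real, 'n::finite) heis set"
  assumes q: "subspace q" and "\<And>u v. u \<in> q \<Longrightarrow> v \<in> q \<Longrightarrow> central (symp u v) \<in> q"
  shows "closed_subgroup_generated q = q"
proof -
  have "u \<star> v \<in> q" if "u \<in> q" "v \<in> q" for u v
  proof -
    have "(1/2) *\<^sub>R central (symp u v) \<in> q" using assms that by (intro subspace_scale)
    thus ?thesis using q that by (simp add: hmult_symp central_simps subspace_add)
  qed
  hence "closed_subgroup q"
    using q by (simp add: closed_subgroup_def closed_subspace subspace_0 subspace_neg)
  thus ?thesis using closed_subgroup_generated_superset[of q] by (auto simp: closed_subgroup_generated_def)
qed

text \<open>Commutators of the group supply the center as soon as the complement is not commutative.\<close>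

lemma center_in_closed_subgroup_generated:
  fixes q :: "(real, 'n::finite) heis set"
  assumes q: "subspace q" and uv: "u \<in> q" "v \<in> q" "symp u v \<noteq> 0" and w: "w \<in> q"
  shows "w + central t \<in> closed_subgroup_generated q"
proof -
  let ?s = "t / symp u v"
  note in_Q = closed_subgroup_generated_superset[THEN subsetD]
  have "((?s *\<^sub>R u) \<star> v) \<star> ((- (?s *\<^sub>R u)) \<star> (- v)) \<in> closed_subgroup_generated q"
    using q uv by (intro closed_subgroup_generated_hmult in_Q subspace_neg subspace_scale)
  moreover have "((?s *\<^sub>R u) \<star> v) \<star> ((- (?s *\<^sub>R u)) \<star> (- v)) = central t"
  proof -
    have "(?s *\<^sub>R u) \<star> v = (v \<star> (?s *\<^sub>R u)) \<star> central t"
      using hmult_swap[of "?s *\<^sub>R u" v] uv(3) by (simp add: hmult_central symp_simps)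
    also have "\<dots> = central t \<star> (v \<star> (?s *\<^sub>R u))" by (simp add: hmult_central)
    finally show ?thesis by (simp add: hmult_assoc)
  qed
  ultimately have "central t \<in> closed_subgroup_generated q" by simp
  from closed_subgroup_generated_hmult[OF in_Q[OF w] this] show ?thesis by (simp add: hmult_central)
qed


section \<open>Slices for co-exponential bases\<close>

text \<open>Modulo \<open>h\<close> the group is commutative, so every group that contains a complement acts by all real translations.\<close>

lemma slice_of_center_mem:
  fixes h :: "(real, 'n::finite) heis set"
  assumes h: "lie_subalgebra h" and z: "central 1 \<in> h"
    and W: "length W = DIM((real, 'n) heis) - dim h" "coexponential_basis h W"
  shows "\<exists>S. slice h (closed_subgroup_generated (span (set W))) S \<and> submanifold h S (DIM((real, 'n) heis) - dim h)"
proof -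
  have sh: "subspace h" using h by (simp add: lie_subalgebra_def)
  obtain P where P: "splitting h (span (set W)) P"
    using splitting_exists[OF h subspace_span coexponential_basis_complement(1)[OF sh W(2,1)]
      coexponential_basis_complement(2)[OF sh W(2,1)]] z by blast
  have "\<forall>t. central t \<in> h" using subspace_scale[OF sh z] central_scaleR by metis
  thus ?thesis using slice_translations[OF P] closed_subgroup_generated_superset by blast
qed

text \<open>For a Lagrangian \<open>h\<close>, a complement \<open>q\<close> that contains the center is a group; by strong visibility it is commutative
  and then acts by translations. If \<open>q\<close> does not contain the center, the group generated by \<open>q\<close> meets \<open>h\<close> nontrivially.\<close>

lemma slice_of_lagrangian:
  fixes h :: "(real, 'n::finite) heis set"
  assumes h: "lie_subalgebra h" and z: "central 1 \<notin> h"
    and iso: "\<And>u v. u \<in> h \<Longrightarrow> v \<in> h \<Longrightarrow> symp u v = 0"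
    and split: "splitting h c P" and zc: "\<forall>t. central t \<in> c" and ab: "\<forall>u\<in>c. \<forall>v\<in>c. symp u v = 0"
    and W: "length W = DIM((real, 'n) heis) - dim h" "coexponential_basis h W"
    and vis: "strongly_visible h (closed_subgroup_generated (span (set W)))"
  shows "\<exists>S. slice h (closed_subgroup_generated (span (set W))) S \<and> submanifold h S (DIM((real, 'n) heis) - dim h)"
proof -
  interpret splitting h c P by (rule split)
  define q where "q = span (set W)"
  have sq: "subspace q" by (simp add: q_def)
  note int = coexponential_basis_complement(1)[OF subspace_h W(2,1), folded q_def]
    and sum = coexponential_basis_complement(2)[OF subspace_h W(2,1), folded q_def]
  have "\<exists>S. slice h (closed_subgroup_generated q) S \<and> submanifold h S (DIM((real, 'n) heis) - dim h)"
  proof (cases "central 1 \<in> q")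
    case True
    have Zq: "\<forall>t. central t \<in> q" using subspace_scale[OF sq True] central_scaleR by metis
    obtain Pq where Pq: "splitting h q Pq" using splitting_exists[OF h sq int sum] True by blast
    have Q: "closed_subgroup_generated q = q" by (rule closed_subgroup_generated_eq[OF sq]) (simp add: Zq)
    obtain S where "slice h q S" using vis Q by (auto simp: strongly_visible_def q_def)
    hence "symp u v = 0" if "u \<in> q" "v \<in> q" for u v
      using commutative_of_slice[OF split zc ab Pq Zq] that by blast
    thus ?thesis using slice_translations[OF Pq] Q by simp
  next
    case False
    obtain x0 p0 where x0: "x0 \<in> h" "p0 \<in> q" "central 1 = x0 + p0" using sum by blast
    have p0: "p0 = central 1 - x0" using x0(3) by simp
    have x0_nz: "\<exists>b. symp x0 b \<noteq> 0"
    proof (rule ccontr)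
      assume "\<not> (\<exists>b. symp x0 b \<noteq> 0)"
      hence "symp x0 b = 0" for b by blast
      hence "x0 = central (ht x0)" by (rule symp_nondegenerate)
      hence "x0 = 0" using central_mem_imp_zero[OF subspace_h z] x0(1) by (metis central_simps(4))
      thus False using x0 False by simp
    qed
    then obtain b where b: "symp x0 b \<noteq> 0" by blast
    have b0: "symp x0 (P b) \<noteq> 0"
      using iso[OF x0(1) P_diff[of b]] b by (simp add: symp_simps)
    obtain a w where aw: "a \<in> h" "w \<in> q" "b = a + w" using sum by blast
    have pw: "symp p0 w \<noteq> 0" using b iso[OF x0(1) aw(1)] by (simp add: p0 aw(3) symp_simps)
    define q' where "q' = {x + y |x y. x \<in> q \<and> y \<in> range central}"
    have q'I: "u + central t \<in> q'" if "u \<in> q" for u t using that unfolding q'_def by blast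
    have sub_q': "subspace q'"
    proof -
      have "subspace (range (central :: real \<Rightarrow> (real, 'n) heis))"
        by (intro linear_subspace_image[OF _ subspace_UNIV] linearI) (simp_all add: central_simps)
      thus ?thesis unfolding q'_def by (rule subspace_sums[OF sq])
    qed
    show ?thesis
    proof (rule slice_shear[OF split zc ab sub_q'])
      show "q' \<subseteq> closed_subgroup_generated q"
        using center_in_closed_subgroup_generated[OF sq x0(2) aw(2) pw] unfolding q'_def by blast
      show "central 1 \<in> q'" using q'I[OF subspace_0[OF sq], of 1] by simp
      show "\<exists>l\<in>q'. P l = m" if "m \<in> c" for m
      proof -
        obtain a' w' where w': "a' \<in> h" "w' \<in> q" "m = a' + w'" using sum by blast
        have "P w' = m" using P_id[OF that] w' by (simp add: P_simps P_0)
        moreover have "w' \<in> q'" using q'I[OF w'(2), of 0] by (simp add: central_simps)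
        ultimately show ?thesis by blast
      qed
      show "x0 \<in> q'" using q'I[OF subspace_neg[OF sq x0(2)], of 1] p0 by simp
    qed (use x0(1) b0 P_in in auto)
  qed
  thus ?thesis by (simp only: q_def)
qed


section \<open>The theorem\<close>

theorem theorem1p4:
  fixes h :: "(real, 'n::finite) heis set"
    and M :: "(real, 'n) heis set measure"
    and d :: nat
  assumes "lie_subalgebra h" and "h \<noteq> {0}" and "h \<noteq> UNIV"
    and "d = DIM((real, 'n) heis) - dim h"
    and "invariant_measure h M"
    and "multiplicity_free M"
  shows "(\<exists>W. length W = d \<and> coexponential_basis h W \<and>
              strongly_visible h (closed_subgroup_generated (span (set W)))) \<and>
         (\<forall>W. length W = d \<and> coexponential_basis h W \<and>
              strongly_visible h (closed_subgroup_generated (span (set W))) \<longrightarrow>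
            (\<exists>S. slice h (closed_subgroup_generated (span (set W))) S \<and>
                 submanifold h S (support_rank h)))"
proof (cases "central 1 \<in> h")
  case True
  have sh: "subspace h" using assms(1) by (simp add: lie_subalgebra_def)
  have rank: "support_rank h = d"
    unfolding assms(4) by (rule support_rank_eq[OF sh normal_form_of_center_mem[OF sh True assms(3)]])
  note slice = slice_of_center_mem[OF assms(1) True, folded assms(4)]
  obtain c P where split: "splitting h c P" by (rule splitting_of_center_mem[OF assms(1) True])
  have "\<forall>t. central t \<in> h" using subspace_scale[OF sh True] central_scaleR by metis
  then obtain W where W: "length W = dim c" "coexponential_basis h W"
    using coexponential_basis_exists[OF split] by blast
  have "length W = d" using W(1) dim_complement[OF split] assms(4) by simp
  hence "strongly_visible h (closed_subgroup_generated (span (set W)))"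
    using slice[OF _ W(2)] by (auto simp: strongly_visible_def)
  thus ?thesis using W(2) \<open>length W = d\<close> slice rank by metis
next
  case False
  have sh: "subspace h" using assms(1) by (simp add: lie_subalgebra_def)
  have iso: "symp u v = 0" if "u \<in> h" "v \<in> h" for u v
  proof -
    have "central (symp u v) \<in> h" using assms(1) that by (simp add: lie_subalgebra_def flip: hbracket_symp)
    thus ?thesis by (rule central_mem_imp_zero[OF sh False])
  qed
  have "\<not> (\<exists>v w. symp v w = 1 \<and> (\<forall>a\<in>h. symp v a = 0 \<and> symp w a = 0))"
  proof
    assume "\<exists>v w. symp v w = 1 \<and> (\<forall>a\<in>h. symp v a = 0 \<and> symp w a = 0)"
    then obtain v w where vw: "symp v w = 1" "\<forall>a\<in>h. symp v a = 0 \<and> symp w a = 0" by blast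
    obtain c P where split: "splitting h c P" "central 1 \<in> c" by (rule splitting_of_center_not_mem[OF assms(1) False])
    have "\<forall>t. central t \<in> c"
      using subspace_scale[OF splitting.subspace_c[OF split(1)] split(2)] central_scaleR by metis
    hence "homogeneous_measure h c P M"
      using split(1) assms(5) by (intro homogeneous_measure.intro homogeneous_measure_axioms.intro)
    from homogeneous_measure.not_multiplicity_free[OF this _ _ vw(1)] vw(2) assms(6) show False by blast
  qed
  then obtain X Y where XY: "symplectic_family (CARD('n)) X Y" "heisenberg_basis X Y (central 1)"
    "h = span (X ` {1..CARD('n)})"
    using isotropic_normal_form[OF sh False iso] by blast
  have nf: "normal_form X Y (central 1) h" unfolding normal_form_def using XY(3) by blast
  have rank: "support_rank h = d"
    unfolding assms(4) by (rule support_rank_eq[OF sh]) (use XY(2) nf in blast)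
  obtain c P where split: "splitting h c P" and zc: "\<forall>t. central t \<in> c" and ab: "\<forall>u\<in>c. \<forall>v\<in>c. symp u v = 0"
    by (rule splitting_lagrangian[OF assms(1) False XY])
  obtain W where W: "length W = dim c" "span (set W) = c" "coexponential_basis h W"
    using coexponential_basis_exists[OF split] ab by blast
  have len: "length W = d" using W(1) dim_complement[OF split] assms(4) by simp
  have "closed_subgroup_generated c = c"
    using splitting.subspace_c[OF split] zc by (intro closed_subgroup_generated_eq) auto
  moreover obtain S where "slice h c S" using slice_translations[OF split, of c] ab by blast
  ultimately have "strongly_visible h (closed_subgroup_generated (span (set W)))"
    unfolding W(2) strongly_visible_def by metis
  thus ?thesis
    using len W(3) slice_of_lagrangian[OF assms(1) False iso split zc ab, folded assms(4)] rank by metis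
qed

end
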